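(* Let $0<s<1$, $a=1-2s$, let $V:\mathbb R^{n+1}\to\mathbb R$ satisfy, for some $K>0$, $\|V\|_{C^1(\mathbb R^{n+1})}\le K$ if $1/2\le s<1$, and $\|V\|_{C^2(\mathbb R^{n+1})}\le K$, $\|\langle\nabla_xV,x\rangle\|_{L^\infty(\mathbb R^{n+1})}\le K$ if $0<s<1/2$. Let $u\in\mathrm{Dom}(H^s)$ be a solution of $H^su=\frac{\Gamma(1-s)}{2^{2s-1}\Gamma(s)}Vu$ in $\mathbb R^{n+1}$, and let $U$ be its extension. Then $y^aU_y$ is Hölder continuous up to $y=0$ (on $\mathbb B_M^+\times(-M^2,M^2)$, for every $M>0$) with an exponent $\alpha'>0$ depending only on $a$ and $n$.
   Context: Points of $\mathbb R^{n+1}$ are $(x,t)$; $\hat u(\xi,\sigma)=\int e^{-2\pi i(\langle\xi,x\rangle+\sigma t)}u\,dx\,dt$; $H^s=(\partial_t-\Delta)^s$ is defined by $\widehat{H^su}=((2\pi|\xi|)^2+2\pi i\sigma)^s\hat u$ (principal branch), with $\mathrm{Dom}(H^s)=\{u\in L^2(\mathbb R^{n+1}):((2\pi|\xi|)^2+2\pi i\sigma)^s\hat u\in L^2\}$. $\|f\|_{C^k}=\sum_{|\alpha|+j\le k}\sup|D_x^\alpha D_t^jf|$. Extension: for $X=(x,y)$, $y>0$, $$U(x,y,t)=\int_0^\infty\!\!\int_{\mathbb R^n}\frac{1}{4^{n/2+s}\pi^{n/2}\Gamma(s)}\frac{y^{2s}}{\tau^{n/2+1+s}}e^{-\frac{|z|^2+y^2}{4\tau}}u(x-z,t-\tau)\,dz\,d\tau,$$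 which satisfies $y^a\partial_tU=\operatorname{div}_X(y^a\nabla_XU)$, $U(x,0,t)=u(x,t)$, $\lim_{y\to0^+}y^aU_y=-Vu$. $\mathbb B_M^+=\{X=(x,y)\in\mathbb R^{n+1}:|X|<M,\ y>0\}$. Hölder continuity is with respect to the parabolic distance $|X-X'|+|t-t'|^{1/2}$. *)

theory Defs
  imports "HOL-Analysis.Analysis" "HOL-Probability.Essential_Supremum" "HOL-Library.Multiset"
begin

text \<open>
  The space \<open>\<real>\<^sup>n\<close> is \<open>real ^ 'n\<close>, space-time points \<open>(x, t)\<close> have type \<open>(real ^ 'n) \<times> real\<close>,
  and points \<open>(X, t)\<close> with \<open>X = (x, y)\<close> of the extended space have type
  \<open>((real ^ 'n) \<times> real) \<times> real\<close>. The norm of a pair is the Euclidean one.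
\<close>


section \<open>The spaces \<open>C\<^sup>k\<close> and \<open>L\<^sup>\<infinity>\<close>\<close>

definition has_partial :: "'a::real_normed_vector \<Rightarrow> ('a \<Rightarrow> real) \<Rightarrow> bool" where
  "has_partial b f \<longleftrightarrow> (\<forall>p. (\<lambda>h. f (p + h *\<^sub>R b)) differentiable at 0)"

definition partial :: "'a::real_normed_vector \<Rightarrow> ('a \<Rightarrow> real) \<Rightarrow> 'a \<Rightarrow> real" where
  "partial b f p = deriv (\<lambda>h. f (p + h *\<^sub>R b)) 0"

abbreviation D_x :: "'n::finite \<Rightarrow> ((real ^ 'n) \<times> real \<Rightarrow> real) \<Rightarrow> (real ^ 'n) \<times> real \<Rightarrow> real" where
  "D_x i \<equiv> partial (axis i 1, 0)"

abbreviation D_t :: "((real ^ 'n::finite) \<times> real \<Rightarrow> real) \<Rightarrow> (real ^ 'n) \<times> real \<Rightarrow> real" where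
  "D_t \<equiv> partial (0, 1)"

fun C_k :: "nat \<Rightarrow> ((real ^ 'n::finite) \<times> real \<Rightarrow> real) \<Rightarrow> bool" where
  "C_k 0 f \<longleftrightarrow> continuous_on UNIV f"
| "C_k (Suc k) f \<longleftrightarrow> continuous_on UNIV f
     \<and> (\<forall>i. has_partial (axis i 1, 0) f \<and> C_k k (D_x i f))
     \<and> has_partial (0, 1) f \<and> C_k k (D_t f)"

text \<open>
  A multi-index \<open>\<alpha> \<in> \<nat>\<^sup>n\<close> is a multiset over \<open>'n\<close> (the multiplicity of \<open>i\<close> is \<open>\<alpha>\<^sub>i\<close>, and
  \<open>size \<alpha> = |\<alpha>|\<close>). As \<open>'n\<close> carries no order, the order in which the derivatives are taken
  is chosen arbitrarily; for functions of class \<open>C_k k\<close> and \<open>|\<alpha>| + j \<le> k\<close> it is irrelevant.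
\<close>
definition D_multi ::
  "'n multiset \<Rightarrow> nat \<Rightarrow> ((real ^ 'n::finite) \<times> real \<Rightarrow> real) \<Rightarrow> (real ^ 'n) \<times> real \<Rightarrow> real" where
  "D_multi \<alpha> j f = foldr D_x (SOME is. mset is = \<alpha>) ((D_t ^^ j) f)"

definition multi_indices :: "nat \<Rightarrow> ('n::finite multiset \<times> nat) set" where
  "multi_indices k = {(\<alpha>, j). size \<alpha> + j \<le> k}"

lemma finite_multi_indices: "finite (multi_indices k :: ('n::finite multiset \<times> nat) set)"
proof -
  have "finite {is :: 'n list. length is \<le> k}"
    using finite_lists_length_le[of "UNIV :: 'n set" k] by simp
  moreover have "multi_indices k \<subseteq> (mset ` {is :: 'n list. length is \<le> k}) \<times> {..k}"
  proof
    fix z :: "'n multiset \<times> nat" assume z: "z \<in> multi_indices k"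
    obtain "is" where "mset is = fst z" using ex_mset by blast
    then show "z \<in> (mset ` {is :: 'n list. length is \<le> k}) \<times> {..k}"
      using z by (force simp: multi_indices_def mem_Times_iff simp flip: size_mset)
  qed
  ultimately show ?thesis
    by (meson finite_SigmaI finite_atMost finite_imageI finite_subset)
qed

definition C_k_norm :: "nat \<Rightarrow> ((real ^ 'n::finite) \<times> real \<Rightarrow> real) \<Rightarrow> ennreal" where
  "C_k_norm k f = (\<Sum>(\<alpha>, j)\<in>multi_indices k. SUP p. ennreal \<bar>D_multi \<alpha> j f p\<bar>)"

definition L_inf_norm :: "('a::euclidean_space \<Rightarrow> real) \<Rightarrow> ennreal" where
  "L_inf_norm f = esssup lebesgue (\<lambda>p. ennreal \<bar>f p\<bar>)"

definition radial_grad :: "((real ^ 'n::finite) \<times> real \<Rightarrow> real) \<Rightarrow> (real ^ 'n) \<times> real \<Rightarrow> real" where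
  "radial_grad V = (\<lambda>(x, t). (\<chi> i. D_x i V (x, t)) \<bullet> x)"


section \<open>The Fourier transform on \<open>L\<^sup>2\<close> and the fractional heat operator\<close>

definition L2 :: "('a::euclidean_space \<Rightarrow> complex) set" where
  "L2 = {u. u \<in> borel_measurable lebesgue \<and> integrable lebesgue (\<lambda>p. (cmod (u p))\<^sup>2)}"

definition fourier :: "((real ^ 'n::finite) \<times> real \<Rightarrow> complex) \<Rightarrow> (real ^ 'n) \<times> real \<Rightarrow> complex" where
  "fourier u = (\<lambda>(\<xi>, \<sigma>). LINT (x, t)|lebesgue.
      exp (- 2 * complex_of_real pi * \<i> * complex_of_real (\<xi> \<bullet> x + \<sigma> * t)) * u (x, t))"

text \<open>
  \<open>has_L2_fourier u g\<close>: the function \<open>g\<close> represents the Fourier--Plancherel transform of \<open>u\<close>,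
  i.e. it is the limit in \<open>L\<^sup>2\<close> of the Fourier integrals of the truncations of \<open>u\<close> to balls.
  These are truncations in \<open>L\<^sup>1 \<inter> L\<^sup>2\<close>, and \<open>g\<close> is determined up to null sets.
\<close>
definition has_L2_fourier ::
  "((real ^ 'n::finite) \<times> real \<Rightarrow> complex) \<Rightarrow> ((real ^ 'n) \<times> real \<Rightarrow> complex) \<Rightarrow> bool" where
  "has_L2_fourier u g \<longleftrightarrow> u \<in> L2 \<and> g \<in> L2 \<and>
     ((\<lambda>R::real. \<integral>\<^sup>+ p. ennreal ((cmod (fourier (\<lambda>q. indicator (ball 0 R) q * u q) p - g p))\<^sup>2)
         \<partial>lebesgue) \<longlongrightarrow> 0) at_top"

text \<open>\<open>powr\<close> on the complex numbers is the principal branch.\<close>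
definition heat_symbol :: "real \<Rightarrow> (real ^ 'n::finite) \<times> real \<Rightarrow> complex" where
  "heat_symbol s = (\<lambda>(\<xi>, \<sigma>).
     (complex_of_real ((2 * pi * norm \<xi>)\<^sup>2) + 2 * complex_of_real pi * \<i> * complex_of_real \<sigma>)
       powr complex_of_real s)"

definition Dom_H :: "real \<Rightarrow> ((real ^ 'n::finite) \<times> real \<Rightarrow> complex) set" where
  "Dom_H s = {u \<in> L2. \<exists>g. has_L2_fourier u g \<and> (\<lambda>p. heat_symbol s p * g p) \<in> L2}"

text \<open>\<open>H_eq s u f\<close>: the equation \<open>H\<^sup>s u = f\<close> in \<open>L\<^sup>2\<close>, hence almost everywhere, for \<open>u \<in> Dom_H s\<close>.\<close>
definition H_eq ::
  "real \<Rightarrow> ((real ^ 'n::finite) \<times> real \<Rightarrow> complex) \<Rightarrow> ((real ^ 'n) \<times> real \<Rightarrow> complex) \<Rightarrow> bool" where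
  "H_eq s u f \<longleftrightarrow> u \<in> Dom_H s \<and>
     (\<exists>g. has_L2_fourier u g \<and> has_L2_fourier f (\<lambda>p. heat_symbol s p * g p))"


section \<open>The extension\<close>

definition ext_kernel :: "real \<Rightarrow> real ^ 'n::finite \<Rightarrow> real \<Rightarrow> real \<Rightarrow> real" where
  "ext_kernel s z y \<tau> = (let n = real CARD('n) in
     1 / (4 powr (n / 2 + s) * pi powr (n / 2) * Gamma s)
       * (y powr (2 * s) / \<tau> powr (n / 2 + 1 + s))
       * exp (- ((norm z)\<^sup>2 + y\<^sup>2) / (4 * \<tau>)))"

text \<open>Only meant for \<open>y > 0\<close>.\<close>
definition extension ::
  "real \<Rightarrow> ((real ^ 'n::finite) \<times> real \<Rightarrow> complex) \<Rightarrow> real ^ 'n \<Rightarrow> real \<Rightarrow> real \<Rightarrow> complex" where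
  "extension s u x y t =
     (LINT \<tau>:{0<..}|lebesgue. (LINT z|lebesgue.
        complex_of_real (ext_kernel s z y \<tau>) * u (x - z, t - \<tau>)))"


section \<open>Parabolic Hoelder continuity\<close>

definition parabolic_dist :: "'a::real_normed_vector \<times> real \<Rightarrow> 'a \<times> real \<Rightarrow> real" where
  "parabolic_dist P Q = norm (fst P - fst Q) + sqrt \<bar>snd P - snd Q\<bar>"

definition parabolic_holder_on ::
  "real \<Rightarrow> ('a::real_normed_vector \<times> real) set \<Rightarrow> ('a \<times> real \<Rightarrow> complex) \<Rightarrow> bool" where
  "parabolic_holder_on \<alpha> S W \<longleftrightarrow>
     (\<exists>C. \<forall>P\<in>S. \<forall>Q\<in>S. cmod (W P - W Q) \<le> C * parabolic_dist P Q powr \<alpha>)"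

definition half_ball :: "real \<Rightarrow> ((real ^ 'n::finite) \<times> real) set" where
  "half_ball M = {(x, y). norm (x, y) < M \<and> 0 < y}"

text \<open>\<open>half_ball M\<close> together with the flat part of its boundary.\<close>
definition half_ball_upto :: "real \<Rightarrow> ((real ^ 'n::finite) \<times> real) set" where
  "half_ball_upto M = {(x, y). norm (x, y) < M \<and> 0 \<le> y}"

text \<open>
  \<open>F\<close> is defined on \<open>S\<close>; it is Hoelder continuous up to the larger set \<open>S'\<close> if it has
  a Hoelder continuous extension to \<open>S'\<close>.
\<close>
definition parabolic_holder_upto ::
  "real \<Rightarrow> ('a::real_normed_vector \<times> real) set \<Rightarrow> ('a \<times> real) set \<Rightarrow> ('a \<times> real \<Rightarrow> complex) \<Rightarrow> bool" where
  "parabolic_holder_upto \<alpha> S S' F \<longleftrightarrow>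
     (\<exists>W. (\<forall>P\<in>S. W P = F P) \<and> parabolic_holder_on \<alpha> S' W)"

definition weighted_U_y ::
  "real \<Rightarrow> (real ^ 'n \<Rightarrow> real \<Rightarrow> real \<Rightarrow> complex) \<Rightarrow> ((real ^ 'n::finite) \<times> real) \<times> real \<Rightarrow> complex" where
  "weighted_U_y a U = (\<lambda>((x, y), t). y powr a *\<^sub>R vector_derivative (\<lambda>\<eta>. U x \<eta> t) (at y))"

end

(*
  With m = |2 pi xi|^2 + 2 pi i sigma, the multipliers (1 + m)^(-s) and (1 + m)^s - m^s are Laplace
  transforms in m of integrable densities on (0, oo), so they are Fourier transforms of integrable
  superpositions of heat kernels. Hence u = J (f + B u), where f is the right-hand side of the equation
  and J, B are convolutions with such kernels. As |f| <= C |u|, and as the part of J near tau = 0 has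
  small L^1 norm while the rest is square integrable, u is bounded. The L^1 modulus of continuity of the
  kernel of J then makes u Hoelder continuous, and V u with it. Finally y^a U_y is, for y > 0, a constant
  times the extension of f with 1 - s in place of s: on the Fourier side this is the
  symmetry K_s = K_(-s) of the Bessel functions. After the parabolic scaling (z, tau) = (y z', y^2 tau')
  that integral makes sense at y = 0 and inherits the Hoelder continuity of f, with half the exponent
  because y^2 - y'^2 is only of first order in the distance.
*)
theory Submission
  imports Defs "HOL-Probability.Probability" "HOL-Complex_Analysis.Complex_Analysis"
begin

section \<open>Integration on Euclidean spaces\<close>

text \<open>The density \<open>\<tau> powr (s - 1)\<close> belonging to \<open>m powr (- s)\<close>
  is not integrable at infinity, which is why \<open>1 + m\<close> is inverted instead. The price
  \<open>(1 + m) powr s - m powr s\<close> has a nonnegative density of mass at most one, which the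
  boundedness argument can afford. Identities between symbols are classical integrals for positive
  real \<open>m\<close> and are continued analytically to \<open>Re m > 0\<close>; the symbol lies
  there off a null set. Fourier transforms are given only as limits of truncations. Testing against
  Gaussians turns the action of kernels into Fubini, and uniqueness into an argument with
  approximate identities. The modulus of continuity of the kernel is found without differentiating
  it: a forward shift costs at most a factor \<open>exp (- X)\<close>, and equality of masses makes
  this one-sided bound two-sided. The exponent is half of \<open>min s (1 - s)\<close>: up to
  \<open>s\<close>, the Bessel density absorbs the negative powers of \<open>\<tau>\<close> that
  arise; up to \<open>1 - s\<close>, the Poisson kernel of parameter \<open>1 - s\<close> has the
  moments required.\<close>

lemma nn_integral_lborel_affine:
  fixes t :: "'a::euclidean_space" and c :: real
  assumes [measurable]: "f \<in> borel_measurable borel" and c: "c \<noteq> 0"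
  shows "(\<integral>\<^sup>+x. f x \<partial>lborel) = \<bar>c\<bar> ^ DIM('a) * (\<integral>\<^sup>+x. f (t + c *\<^sub>R x) \<partial>lborel)"
  by (subst lborel_affine[OF c, of t])
     (simp add: nn_integral_density nn_integral_distr nn_integral_cmult)

lemma integrable_lborel_affine:
  fixes f :: "'a::euclidean_space \<Rightarrow> 'b::{banach, second_countable_topology}"
  assumes f: "integrable lborel f" and c: "c \<noteq> 0"
  shows "integrable lborel (\<lambda>x. f (t + c *\<^sub>R x))"
  using f f[THEN borel_measurable_integrable] c unfolding integrable_iff_bounded
  by (subst (asm) nn_integral_lborel_affine[where c=c and t=t]) (auto simp: ennreal_mult_less_top)

lemma integral_lborel_affine:
  fixes f :: "'a::euclidean_space \<Rightarrow> 'b::{banach, second_countable_topology}"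
  assumes [measurable]: "f \<in> borel_measurable borel" and c: "c \<noteq> 0"
  shows "(LINT x|lborel. f x) = \<bar>c\<bar> ^ DIM('a) *\<^sub>R (LINT x|lborel. f (t + c *\<^sub>R x))"
  by (subst lborel_affine[OF c, of t]) (simp add: integral_density integral_distr)

lemma nn_integral_lborel_reflect:
  fixes t :: "'a::euclidean_space"
  assumes "f \<in> borel_measurable borel"
  shows "(\<integral>\<^sup>+x. f (t - x) \<partial>lborel) = (\<integral>\<^sup>+x. f x \<partial>lborel)"
  using nn_integral_lborel_affine[OF assms, of "-1" t] by simp

lemma integrable_lborel_reflect:
  fixes f :: "'a::euclidean_space \<Rightarrow> 'b::{banach, second_countable_topology}"
  assumes "integrable lborel f" shows "integrable lborel (\<lambda>x. f (t - x))"
  using integrable_lborel_affine[OF assms, of "-1" t] by simp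

lemma integral_lborel_reflect:
  fixes f :: "'a::euclidean_space \<Rightarrow> 'b::{banach, second_countable_topology}"
  assumes "f \<in> borel_measurable borel"
  shows "(LINT x|lborel. f (t - x)) = (LINT x|lborel. f x)"
  using integral_lborel_affine[OF assms, of "-1" t] by simp

lemma nn_integral_lborel_translate:
  fixes t :: "'a::euclidean_space"
  assumes "f \<in> borel_measurable borel"
  shows "(\<integral>\<^sup>+x. f (x + t) \<partial>lborel) = (\<integral>\<^sup>+x. f x \<partial>lborel)"
  using nn_integral_lborel_affine[OF assms, of 1 t] by (simp add: add.commute)

lemma integrable_lborel_translate:
  fixes f :: "'a::euclidean_space \<Rightarrow> 'b::{banach, second_countable_topology}"
  assumes "integrable lborel f" shows "integrable lborel (\<lambda>x. f (x + t))"
  using integrable_lborel_affine[OF assms, of 1 t] by (simp add: add.commute)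

lemma integral_lborel_translate:
  fixes f :: "'a::euclidean_space \<Rightarrow> 'b::{banach, second_countable_topology}"
  assumes "f \<in> borel_measurable borel"
  shows "(LINT x|lborel. f (x + t)) = (LINT x|lborel. f x)"
  using integral_lborel_affine[OF assms, of 1 t] by (simp add: add.commute)

lemma AE_lborel_reflect:
  fixes t :: "'a::euclidean_space"
  assumes "AE x in lborel. P x"
  shows "AE x in lborel. P (t - x)"
proof -
  from assms obtain N where N: "N \<in> null_sets lborel" "{x. \<not> P x} \<subseteq> N"
    by (auto simp: eventually_ae_filter)
  then have [measurable]: "N \<in> sets borel" by auto
  have "(\<integral>\<^sup>+x. indicator N (t - x) \<partial>lborel) = (\<integral>\<^sup>+x. indicator N x \<partial>lborel)"
    by (rule nn_integral_lborel_reflect) simp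
  also have "\<dots> = 0" using N by (simp add: null_setsD1)
  finally have "AE x in lborel. indicator N (t - x) = (0::ennreal)"
    by (subst (asm) nn_integral_0_iff_AE) auto
  then show ?thesis
    by eventually_elim (use N in \<open>auto simp: indicator_def split: if_splits\<close>)
qed

section \<open>Gaussian integrals and Fourier transforms of Gaussians\<close>

text \<open>Scaling by \<open>c = 1 / sqrt (2 * pi * e)\<close> turns the integrand into the
  standard normal density times a character, so the value is read off from the characteristic
  function of the normal distribution.\<close>

lemma gaussian_fourier_real:
  fixes q e :: real assumes e: "e > 0"
  shows "integrable lborel (\<lambda>x. exp (\<i> * complex_of_real (2 * pi * q * x)) * complex_of_real (exp (- pi * e * x\<^sup>2)))" (is ?I)
    and "(LINT x|lborel. exp (\<i> * complex_of_real (2 * pi * q * x)) * complex_of_real (exp (- pi * e * x\<^sup>2)))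
      = complex_of_real (e powr (- 1/2) * exp (- pi * q\<^sup>2 / e))" (is ?J)
proof -
  define c where "c = 1 / sqrt (2 * pi * e)"
  have c: "c > 0" using e by (simp add: c_def)
  have c2: "c\<^sup>2 = 1 / (2 * pi * e)" using e by (simp add: c_def power_divide)
  define F where "F = (\<lambda>x. exp (\<i> * complex_of_real (2 * pi * q * x)) * complex_of_real (exp (- pi * e * x\<^sup>2)))"
  define D where "D = (\<lambda>x. std_normal_density x *\<^sub>R exp (\<i> * complex_of_real (2 * pi * q * c * x)))"
  have [measurable]: "F \<in> borel_measurable borel" unfolding F_def by measurable
  have Fc: "F (0 + c *\<^sub>R x) = sqrt (2 * pi) *\<^sub>R D x" for x
  proof -
    have "pi * e * (c * x)\<^sup>2 = x\<^sup>2 / 2" unfolding power_mult_distrib c2 using e by simp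
    then have "exp (- pi * e * (c * x)\<^sup>2) = sqrt (2 * pi) * std_normal_density x"
      by (simp add: std_normal_density_def)
    then show ?thesis by (simp add: F_def D_def scaleR_conv_of_real mult_ac)
  qed
  have iD: "integrable lborel D"
  proof (rule Bochner_Integration.integrable_bound)
    show "integrable lborel std_normal_density" by simp
  qed (auto simp: D_def norm_mult)
  have intD: "(LINT x|lborel. D x) = complex_of_real (exp (- ((2 * pi * q * c)\<^sup>2) / 2))"
    using fun_cong[OF char_std_normal_distribution, of "2 * pi * q * c"] unfolding D_def char_def
    by (subst (asm) integral_density) auto
  have "integrable lborel (\<lambda>x. F (0 + c *\<^sub>R x))" unfolding Fc using iD by simp
  from integrable_lborel_affine[OF this, of "1/c" 0] have "integrable lborel F" using c by simp
  then show ?I by (simp add: F_def)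
  have "(LINT x|lborel. F x) = c *\<^sub>R (LINT x|lborel. F (0 + c *\<^sub>R x))"
    by (subst integral_lborel_affine[of F c 0]) (use c in auto)
  also have "\<dots> = (c * sqrt (2 * pi)) *\<^sub>R complex_of_real (exp (- ((2 * pi * q * c)\<^sup>2) / 2))"
    unfolding Fc using intD by simp
  also have "(2 * pi * q * c)\<^sup>2 = 2 * pi * q\<^sup>2 / e"
    unfolding power_mult_distrib c2 using e by (simp add: power2_eq_square field_simps)
  also have "c * sqrt (2 * pi) = e powr (-1/2)"
    using e by (simp add: c_def real_sqrt_mult powr_minus_divide powr_half_sqrt)
  finally show ?J by (simp add: F_def scaleR_conv_of_real)
qed

text \<open>\<open>lborel\<close> is the image of the product of one-dimensional Lebesgue measures
  under the map from coordinates to vectors, so the formula for finite products of measures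
  applies.\<close>

lemma integral_lborel_prod_Basis:
  fixes f :: "'a::euclidean_space \<Rightarrow> real \<Rightarrow> complex"
  assumes f: "\<And>b. b \<in> Basis \<Longrightarrow> integrable lborel (f b)"
  shows "integrable lborel (\<lambda>x. \<Prod>b\<in>Basis. f b (x \<bullet> b))" (is ?I)
    and "(LINT x|lborel. (\<Prod>b\<in>Basis. f b (x \<bullet> b))) = (\<Prod>b\<in>Basis. LINT x|lborel. f b x)" (is ?J)
proof -
  interpret P: product_sigma_finite "\<lambda>_::'a. lborel :: real measure" by standard
  have [measurable]: "f b \<in> borel_measurable borel" if "b \<in> Basis" for b using f[OF that] by auto
  have eq: "(\<Prod>b\<in>Basis. f b ((\<Sum>b\<in>Basis. x b *\<^sub>R b) \<bullet> b)) = (\<Prod>b\<in>Basis. f b (x b))" for x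
    by (intro prod.cong refl) simp
  have m[measurable]: "(\<lambda>x::'a. \<Prod>b\<in>Basis. f b (x \<bullet> b)) \<in> borel_measurable borel"
    by measurable
  have m2[measurable]: "(\<lambda>f::'a \<Rightarrow> real. \<Sum>b\<in>Basis. f b *\<^sub>R b) \<in> (\<Pi>\<^sub>M b\<in>Basis. lborel) \<rightarrow>\<^sub>M borel"
    by measurable
  show ?I
    by (subst lborel_eq, subst integrable_distr_eq, simp, simp, subst eq)
       (use f in \<open>auto intro!: P.product_integrable_prod\<close>)
  show ?J
    by (subst lborel_eq, subst integral_distr, simp, simp, subst eq)
       (use f in \<open>auto intro!: P.product_integral_prod\<close>)
qed

lemma gaussian_fourier:
  fixes q :: "'a::euclidean_space" assumes e: "e > 0"
  shows "integrable lborel (\<lambda>x. exp (\<i> * complex_of_real (2 * pi * (q \<bullet> x))) * complex_of_real (exp (- pi * e * (norm x)\<^sup>2)))" (is ?I)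
    and "(LINT x|lborel. exp (\<i> * complex_of_real (2 * pi * (q \<bullet> x))) * complex_of_real (exp (- pi * e * (norm x)\<^sup>2)))
      = complex_of_real (e powr (- real DIM('a) / 2) * exp (- pi * (norm q)\<^sup>2 / e))" (is ?J)
proof -
  define f where "f = (\<lambda>(b::'a) x. exp (\<i> * complex_of_real (2 * pi * (q \<bullet> b) * x)) * complex_of_real (exp (- pi * e * x\<^sup>2)))"
  have n2: "(norm x)\<^sup>2 = (\<Sum>b\<in>Basis. (x \<bullet> b)\<^sup>2)" for x :: 'a
    by (metis (no_types, lifting) euclidean_inner power2_norm_eq_inner power2_eq_square sum.cong)
  have eq: "exp (\<i> * complex_of_real (2 * pi * (q \<bullet> x))) * complex_of_real (exp (- pi * e * (norm x)\<^sup>2)) = (\<Prod>b\<in>Basis. f b (x \<bullet> b))" for x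
  proof -
    have "(\<Prod>b\<in>Basis. f b (x \<bullet> b)) = exp (\<Sum>b\<in>Basis. \<i> * complex_of_real (2 * pi * (q \<bullet> b) * (x \<bullet> b))) * exp (\<Sum>b\<in>Basis. complex_of_real (- pi * e * (x \<bullet> b)\<^sup>2))"
      by (simp add: f_def prod.distrib exp_sum flip: exp_of_real)
    also have "(\<Sum>b\<in>Basis. \<i> * complex_of_real (2 * pi * (q \<bullet> b) * (x \<bullet> b))) = \<i> * complex_of_real (2 * pi * (q \<bullet> x))"
      by (simp add: euclidean_inner[of q x] sum_distrib_left mult_ac)
    also have "(\<Sum>b\<in>Basis. complex_of_real (- pi * e * (x \<bullet> b)\<^sup>2)) = complex_of_real (- pi * e * (norm x)\<^sup>2)"
      by (simp add: n2 sum_distrib_left sum_negf mult_ac)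
    finally show ?thesis by (simp flip: exp_of_real)
  qed
  have i: "integrable lborel (f b)" for b
    unfolding f_def by (rule gaussian_fourier_real[OF e])
  show ?I unfolding eq by (rule integral_lborel_prod_Basis[OF i])
  have "(LINT x|lborel. (\<Prod>b\<in>Basis. f b (x \<bullet> b))) = (\<Prod>b\<in>Basis. LINT x|lborel. f b x)"
    by (rule integral_lborel_prod_Basis[OF i])
  also have "\<dots> = (\<Prod>b\<in>(Basis::'a set). complex_of_real (e powr (- 1/2) * exp (- pi * (q \<bullet> b)\<^sup>2 / e)))"
    unfolding f_def by (intro prod.cong refl gaussian_fourier_real[OF e])
  also have "\<dots> = complex_of_real ((e powr (-1/2)) ^ DIM('a) * exp (\<Sum>b\<in>Basis. - pi * (q \<bullet> b)\<^sup>2 / e))"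
    by (simp add: prod.distrib exp_sum)
  also have "(\<Sum>b\<in>Basis. - pi * (q \<bullet> b)\<^sup>2 / e) = - pi * (norm q)\<^sup>2 / e"
    by (simp add: n2 sum_distrib_left sum_negf sum_divide_distrib)
  also have "(e powr (-1/2)) ^ DIM('a) = e powr (- real DIM('a) / 2)"
    using e by (simp add: powr_powr flip: powr_realpow)
  finally show ?J unfolding eq .
qed

lemma gaussian_integral:
  assumes e: "e > 0"
  shows "integrable lborel (\<lambda>x::'a::euclidean_space. exp (- pi * e * (norm x)\<^sup>2))" (is ?I)
    and "(LINT x::'a|lborel. exp (- pi * e * (norm x)\<^sup>2)) = e powr (- real DIM('a) / 2)" (is ?J)
proof -
  have "integrable lborel (\<lambda>x::'a. complex_of_real (exp (- pi * e * (norm x)\<^sup>2)))"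
    using gaussian_fourier(1)[OF e, of "0::'a"] by simp
  from integrable_Re[OF this] show ?I by simp
  have "complex_of_real (LINT x::'a|lborel. exp (- pi * e * (norm x)\<^sup>2)) = complex_of_real (e powr (- real DIM('a) / 2))"
    using gaussian_fourier(2)[OF e, of "0::'a"] by (simp flip: integral_complex_of_real)
  then show ?J by (simp only: of_real_eq_iff)
qed

section \<open>Differentiation under the integral sign\<close>

text \<open>Dominated convergence for the remainder quotients: by the mean value inequality on the
  convex set they are bounded by \<open>2 * g\<close>. The parameter ranges over a normed space, so
  that one statement serves complex parameters (holomorphy of Laplace transforms) and real ones (the
  \<open>y\<close>-derivative of the extension).\<close>

lemma has_derivative_lebesgue_integral:
  fixes f :: "'b::real_normed_vector \<Rightarrow> 'r \<Rightarrow> 'c::{banach, second_countable_topology}"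
  assumes S: "open S" "convex S" "y \<in> S"
    and fi: "\<And>z. z \<in> S \<Longrightarrow> integrable M (f z)"
    and der: "\<And>z r. z \<in> S \<Longrightarrow> r \<in> space M \<Longrightarrow> ((\<lambda>z. f z r) has_derivative D z r) (at z)"
    and Dm: "\<And>h. (\<lambda>r. D y r h) \<in> borel_measurable M"
    and bnd: "\<And>z r h. z \<in> S \<Longrightarrow> r \<in> space M \<Longrightarrow> norm (D z r h) \<le> g r * norm h"
    and g: "integrable M g"
  shows "((\<lambda>z. LINT r|M. f z r) has_derivative (\<lambda>h. LINT r|M. D y r h)) (at y)"
    and "\<And>h. integrable M (\<lambda>r. D y r h)"
proof -
  show Di: "integrable M (\<lambda>r. D y r h)" for h
  proof (rule Bochner_Integration.integrable_bound)
    show "integrable M (\<lambda>r. g r * norm h)" using g by simp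
    show "AE r in M. norm (D y r h) \<le> norm (g r * norm h)"
      using bnd[OF S(3)] by (intro AE_I2) (metis norm_ge_zero abs_of_nonneg order_trans real_norm_def)
  qed (rule Dm)
  have lin: "linear (D y r)" if "r \<in> space M" for r
    using der[OF S(3) that] has_derivative_linear by blast
  have bl: "bounded_linear (\<lambda>h. LINT r|M. D y r h)"
  proof (rule bounded_linear_intro[where K="LINT r|M. g r"])
    fix a b show "(LINT r|M. D y r (a + b)) = (LINT r|M. D y r a) + (LINT r|M. D y r b)"
      by (subst Bochner_Integration.integral_add[symmetric, OF Di Di], rule Bochner_Integration.integral_cong[OF refl])
         (simp add: lin linear_add)
  next
    fix c a show "(LINT r|M. D y r (c *\<^sub>R a)) = c *\<^sub>R (LINT r|M. D y r a)"
      by (subst integral_scaleR_right[symmetric], rule Bochner_Integration.integral_cong[OF refl])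
         (simp add: lin linear_scale)
  next
    fix a have "norm (LINT r|M. D y r a) \<le> (LINT r|M. g r * norm a)"
      by (rule order_trans[OF integral_norm_bound Bochner_Integration.integral_mono]) (use bnd[OF S(3)] g Di in auto)
    then show "norm (LINT r|M. D y r a) \<le> norm a * (LINT r|M. g r)"
      using g by (simp add: mult.commute)
  qed
  define q where "q = (\<lambda>z r. inverse (norm (z - y)) *\<^sub>R (f z r - f y r - D y r (z - y)))"
  have lim: "((\<lambda>z. LINT r|M. q z r) \<longlongrightarrow> 0) (at y)"
  proof -
    have "(\<lambda>n. LINT r|M. q (X n) r) \<longlonglongrightarrow> (LINT r|M. 0)"
      if X: "\<forall>n. X n \<in> UNIV - {y}" "X \<longlonglongrightarrow> y" for X
    proof -
      \<comment> \<open>From index \<open>N\<close> on the points lie in \<open>S\<close>, where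
        integrability and the mean value bound hold; dropping finitely many terms keeps the
        limit.\<close>
      obtain N where N: "\<And>n. n \<ge> N \<Longrightarrow> X n \<in> S"
        using topological_tendstoD[OF X(2) S(1,3)] by (auto simp: eventually_sequentially)
      have "(\<lambda>n. LINT r|M. q (X (n + N)) r) \<longlonglongrightarrow> (LINT r|M. 0)"
      proof (rule integral_dominated_convergence[where w="\<lambda>r. 2 * g r"])
        show "integrable M (\<lambda>r. 2 * g r)" using g by simp
        show "(\<lambda>r. q (X (n + N)) r) \<in> borel_measurable M" for n
        proof -
          have "integrable M (q (X (n + N)))" unfolding q_def
            by (intro integrable_scaleR_right Bochner_Integration.integrable_diff fi N S Di) auto
          then show ?thesis by auto
        qed
        show "AE r in M. (\<lambda>n. q (X (n + N)) r) \<longlonglongrightarrow> 0"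
        proof (rule AE_I2)
          fix r assume r: "r \<in> space M"
          have "((\<lambda>z. q z r) \<longlongrightarrow> 0) (at y)"
            using der[OF S(3) r] unfolding has_derivative_iff_norm
            unfolding q_def by (subst tendsto_norm_zero_iff[symmetric]) (simp add: divide_inverse mult.commute)
          then have "(\<lambda>n. q (X n) r) \<longlonglongrightarrow> 0"
            using X unfolding tendsto_at_iff_sequentially comp_def by auto
          then show "(\<lambda>n. q (X (n + N)) r) \<longlonglongrightarrow> 0" by (rule LIMSEQ_ignore_initial_segment)
        qed
        show "AE r in M. norm (q (X (n + N)) r) \<le> 2 * g r" for n
        proof (rule AE_I2)
          fix r assume r: "r \<in> space M"
          let ?z = "X (n + N)"
          have z: "?z \<in> S" using N by simp
          have nz: "norm (?z - y) > 0" using X(1) by auto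
          have "norm (f ?z r - f y r) \<le> g r * norm (?z - y)"
          proof (rule differentiable_bound[OF S(2) _ _ z S(3), where f="\<lambda>z. f z r" and f'="\<lambda>z. D z r"])
            fix x assume x: "x \<in> S"
            show "((\<lambda>z. f z r) has_derivative D x r) (at x within S)"
              using der[OF x r] has_derivative_at_withinI by blast
            show "onorm (D x r) \<le> g r"
            proof (rule onorm_bound)
              \<comment> \<open>The sign of \<open>g r\<close> follows from the bound at the nonzero
                vector \<open>?z - y\<close>.\<close>
              show "0 \<le> g r"
                using bnd[OF S(3) r, of "?z - y"] nz
                by (metis norm_ge_zero order_trans zero_le_mult_iff not_less)
            qed (use bnd[OF x r] in auto)
          qed
          moreover have "norm (D y r (?z - y)) \<le> g r * norm (?z - y)" by (rule bnd[OF S(3) r])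
          ultimately have "norm (f ?z r - f y r - D y r (?z - y)) \<le> 2 * g r * norm (?z - y)"
            using norm_triangle_ineq4[of "f ?z r - f y r" "D y r (?z - y)"] by linarith
          then show "norm (q ?z r) \<le> 2 * g r"
            using nz unfolding q_def norm_scaleR by (simp add: field_simps)
        qed
      qed simp_all
      then show ?thesis by (rule LIMSEQ_offset)
    qed
    then show ?thesis unfolding tendsto_at_iff_sequentially comp_def by auto
  qed
  have "((\<lambda>z. inverse (norm (z - y)) *\<^sub>R ((LINT r|M. f z r) - (LINT r|M. f y r) - (LINT r|M. D y r (z - y)))) \<longlongrightarrow> 0) (at y)"
  proof (rule Lim_transform_eventually[OF lim])
    show "\<forall>\<^sub>F z in at y. (LINT r|M. q z r) = inverse (norm (z - y)) *\<^sub>R ((LINT r|M. f z r) - (LINT r|M. f y r) - (LINT r|M. D y r (z - y)))"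
      using eventually_at_in_open'[OF S(1,3)]
    proof eventually_elim
      case (elim z)
      then show ?case unfolding q_def using fi[OF elim] fi[OF S(3)] Di
        by (simp add: )
    qed
  qed
  then have "((\<lambda>z. norm ((LINT r|M. f z r) - (LINT r|M. f y r) - (LINT r|M. D y r (z - y))) / norm (z - y)) \<longlongrightarrow> 0) (at y)"
    by (subst (asm) tendsto_norm_zero_iff[symmetric]) (simp add: divide_inverse mult.commute)
  with bl show "((\<lambda>z. LINT r|M. f z r) has_derivative (\<lambda>h. LINT r|M. D y r h)) (at y)"
    unfolding has_derivative_iff_norm by auto
qed

section \<open>Convolutions and the Fourier transform of square integrable functions\<close>

text \<open>Borel counterpart of \<open>L2\<close>: measurability of convolutions and Fubini on
  products of \<open>lborel\<close> require Borel functions.\<close>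

definition sq_int :: "('a::euclidean_space \<Rightarrow> complex) \<Rightarrow> bool" where
  "sq_int w \<longleftrightarrow> w \<in> borel_measurable borel \<and> integrable lborel (\<lambda>p. (cmod (w p))\<^sup>2)"

definition conv :: "('a::euclidean_space \<Rightarrow> real) \<Rightarrow> ('a \<Rightarrow> complex) \<Rightarrow> 'a \<Rightarrow> complex" where
  "conv k w p = (LINT r|lborel. k r *\<^sub>R w (p - r))"

text \<open>With values in \<open>ennreal\<close> the convolution exists everywhere, so bounds can
  be stated before any integrability is known.\<close>

definition nnconv :: "('a::euclidean_space \<Rightarrow> ennreal) \<Rightarrow> ('a \<Rightarrow> ennreal) \<Rightarrow> 'a \<Rightarrow> ennreal" where
  "nnconv k w p = (\<integral>\<^sup>+r. k r * w (p - r) \<partial>lborel)"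

lemma sq_intD [measurable_dest]: "sq_int w \<Longrightarrow> w \<in> borel_measurable borel"
  by (simp add: sq_int_def)

lemma borel_measurable_nnconv [measurable]:
  assumes [measurable]: "k \<in> borel_measurable borel" "w \<in> borel_measurable borel"
  shows "nnconv k w \<in> borel_measurable borel"
  unfolding nnconv_def by measurable

lemma borel_measurable_conv [measurable]:
  assumes [measurable]: "k \<in> borel_measurable borel" "w \<in> borel_measurable borel"
  shows "conv k w \<in> borel_measurable borel"
  unfolding conv_def by measurable

lemma nnconv_mono_AE:
  fixes k :: "'a::euclidean_space \<Rightarrow> ennreal"
  assumes "AE r in lborel. w r \<le> w' r"
  shows "nnconv k w p \<le> nnconv k w' p"
  unfolding nnconv_def
  by (intro nn_integral_mono_AE, use AE_lborel_reflect[OF assms, of p] in eventually_elim) (auto intro: mult_left_mono)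

lemma conv_cong_AE:
  fixes k :: "'a::euclidean_space \<Rightarrow> real"
  assumes [measurable]: "k \<in> borel_measurable borel" "w \<in> borel_measurable borel" "w' \<in> borel_measurable borel"
    and "AE r in lborel. w r = w' r"
  shows "conv k w p = conv k w' p"
  unfolding conv_def by (intro integral_cong_AE) (use AE_lborel_reflect[OF assms(4), of p] in auto)

text \<open>Where the convolution integral does not converge absolutely its value is 0 by
  convention, so the bound persists there.\<close>

lemma norm_conv_le_nnconv:
  fixes k :: "'a::euclidean_space \<Rightarrow> real"
  shows "ennreal (cmod (conv k w p)) \<le> nnconv (\<lambda>r. ennreal \<bar>k r\<bar>) (\<lambda>r. ennreal (cmod (w r))) p"
proof (cases "integrable lborel (\<lambda>r. k r *\<^sub>R w (p - r))")
  case True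
  then show ?thesis
    unfolding conv_def nnconv_def using integral_norm_bound_ennreal[OF True] by (simp add: ennreal_mult)
next
  case False
  then show ?thesis by (simp add: conv_def not_integrable_integral_eq)
qed

text \<open>Cauchy-Schwarz for the measure with density \<open>k\<close> bounds the square
  pointwise; Tonelli and translation invariance then integrate it.\<close>

lemma young_L2:
  fixes k :: "'a::euclidean_space \<Rightarrow> ennreal"
  assumes [measurable]: "k \<in> borel_measurable borel" "w \<in> borel_measurable borel"
  shows "(\<integral>\<^sup>+p. (nnconv k w p)\<^sup>2 \<partial>lborel) \<le> (\<integral>\<^sup>+r. k r \<partial>lborel)\<^sup>2 * (\<integral>\<^sup>+p. (w p)\<^sup>2 \<partial>lborel)"
proof -
  define A where "A = (\<integral>\<^sup>+r. k r \<partial>lborel)"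
  have "(nnconv k w p)\<^sup>2 \<le> A * (\<integral>\<^sup>+r. k r * (w (p - r))\<^sup>2 \<partial>lborel)" for p
    using Cauchy_Schwarz_nn_integral[of "\<lambda>_. 1" "density lborel k" "\<lambda>r. w (p - r)"]
    by (simp add: nn_integral_density nnconv_def A_def emeasure_density)
  then have "(\<integral>\<^sup>+p. (nnconv k w p)\<^sup>2 \<partial>lborel) \<le> (\<integral>\<^sup>+p. A * (\<integral>\<^sup>+r. k r * (w (p - r))\<^sup>2 \<partial>lborel) \<partial>lborel)"
    by (intro nn_integral_mono)
  also have "\<dots> = A * (\<integral>\<^sup>+p. \<integral>\<^sup>+r. k r * (w (p - r))\<^sup>2 \<partial>lborel \<partial>lborel)"
    by (rule nn_integral_cmult) measurable
  also have "(\<integral>\<^sup>+p. \<integral>\<^sup>+r. k r * (w (p - r))\<^sup>2 \<partial>lborel \<partial>lborel) = (\<integral>\<^sup>+r. \<integral>\<^sup>+p. k r * (w (p - r))\<^sup>2 \<partial>lborel \<partial>lborel)"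
    by (rule lborel_pair.Fubini') measurable
  also have "\<dots> = (\<integral>\<^sup>+r. k r * (\<integral>\<^sup>+p. (w p)\<^sup>2 \<partial>lborel) \<partial>lborel)"
  proof (intro nn_integral_cong)
    fix r :: 'a
    have "(\<integral>\<^sup>+p. (w (p - r))\<^sup>2 \<partial>lborel) = (\<integral>\<^sup>+p. (w p)\<^sup>2 \<partial>lborel)"
      using nn_integral_lborel_translate[of "\<lambda>p. (w p)\<^sup>2" "- r"] by simp
    then show "(\<integral>\<^sup>+p. k r * (w (p - r))\<^sup>2 \<partial>lborel) = k r * (\<integral>\<^sup>+p. (w p)\<^sup>2 \<partial>lborel)"
      by (simp add: nn_integral_cmult)
  qed
  also have "\<dots> = A * (\<integral>\<^sup>+p. (w p)\<^sup>2 \<partial>lborel)" by (simp add: nn_integral_multc A_def)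
  finally show ?thesis by (simp add: A_def power2_eq_square mult.assoc)
qed

lemma sq_int_iff:
  "sq_int w \<longleftrightarrow> w \<in> borel_measurable borel \<and> (\<integral>\<^sup>+p. (ennreal (cmod (w p)))\<^sup>2 \<partial>lborel) < \<infinity>"
  unfolding sq_int_def integrable_iff_bounded by (auto simp: ennreal_power)

lemma sq_int_conv:
  assumes k: "integrable lborel k" and w: "sq_int w"
  shows "sq_int (conv k w)"
proof -
  note [measurable] = borel_measurable_integrable[OF k] sq_intD[OF w]
  have "(\<integral>\<^sup>+p. (ennreal (cmod (conv k w p)))\<^sup>2 \<partial>lborel)
      \<le> (\<integral>\<^sup>+p. (nnconv (\<lambda>r. ennreal \<bar>k r\<bar>) (\<lambda>r. ennreal (cmod (w r))) p)\<^sup>2 \<partial>lborel)"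
    by (intro nn_integral_mono power_mono norm_conv_le_nnconv) auto
  also have "\<dots> \<le> (\<integral>\<^sup>+r. ennreal \<bar>k r\<bar> \<partial>lborel)\<^sup>2 * (\<integral>\<^sup>+p. (ennreal (cmod (w p)))\<^sup>2 \<partial>lborel)"
    by (rule young_L2) auto
  also have "\<dots> < \<infinity>"
    using k w by (auto simp: sq_int_iff integrable_iff_bounded power2_eq_square ennreal_mult_less_top)
  finally show ?thesis by (auto simp: sq_int_iff)
qed

lemma sq_int_add:
  assumes "sq_int u" "sq_int v" shows "sq_int (\<lambda>p. u p + v p)"
proof -
  note [measurable] = sq_intD[OF assms(1)] sq_intD[OF assms(2)]
  have "integrable lborel (\<lambda>p. (cmod (u p + v p))\<^sup>2)"
  proof (rule Bochner_Integration.integrable_bound)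
    show "integrable lborel (\<lambda>p. 2 * (cmod (u p))\<^sup>2 + 2 * (cmod (v p))\<^sup>2)" using assms by (auto simp: sq_int_def)
    have "(cmod (u p + v p))\<^sup>2 \<le> 2 * (cmod (u p))\<^sup>2 + 2 * (cmod (v p))\<^sup>2" for p
    proof -
      have "(cmod (u p + v p))\<^sup>2 \<le> (cmod (u p) + cmod (v p))\<^sup>2"
        by (intro power_mono norm_triangle_ineq) auto
      also have "\<dots> \<le> 2 * (cmod (u p))\<^sup>2 + 2 * (cmod (v p))\<^sup>2"
        by (simp add: power2_sum) (use sum_squares_bound[of "cmod (u p)" "cmod (v p)"] in linarith)
      finally show ?thesis .
    qed
    then show "AE p in lborel. norm ((cmod (u p + v p))\<^sup>2) \<le> norm (2 * (cmod (u p))\<^sup>2 + 2 * (cmod (v p))\<^sup>2)" by auto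
  qed auto
  then show ?thesis by (auto simp: sq_int_def)
qed

lemma sq_int_mult_bounded:
  assumes "sq_int u" and [measurable]: "v \<in> borel_measurable borel" and "AE p in lborel. cmod (v p) \<le> B"
  shows "sq_int (\<lambda>p. v p * u p)"
proof -
  note [measurable] = sq_intD[OF assms(1)]
  have "integrable lborel (\<lambda>p. (cmod (v p * u p))\<^sup>2)"
  proof (rule Bochner_Integration.integrable_bound)
    show "integrable lborel (\<lambda>p. B\<^sup>2 * (cmod (u p))\<^sup>2)" using assms by (auto simp: sq_int_def)
    show "AE p in lborel. norm ((cmod (v p * u p))\<^sup>2) \<le> norm (B\<^sup>2 * (cmod (u p))\<^sup>2)"
      using assms(3) by eventually_elim (auto simp: norm_mult power_mult_distrib intro!: mult_right_mono power_mono)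
  qed auto
  then show ?thesis by (auto simp: sq_int_def)
qed

lemma sq_int_cmult: "sq_int u \<Longrightarrow> sq_int (\<lambda>p. c * u p)"
  using sq_int_mult_bounded[of u "\<lambda>_. c" "cmod c"] by simp

lemma integrable_mult_sq_int:
  assumes "sq_int u" and [measurable]: "v \<in> borel_measurable borel" and "integrable lborel (\<lambda>p. (v p)\<^sup>2 :: real)"
  shows "integrable lborel (\<lambda>p. v p *\<^sub>R u p)"
    and "(\<integral>\<^sup>+p. ennreal (\<bar>v p\<bar> * cmod (u p)) \<partial>lborel) \<le> ennreal ((LINT p|lborel. (v p)\<^sup>2) + (LINT p|lborel. (cmod (u p))\<^sup>2))"
proof -
  note [measurable] = sq_intD[OF assms(1)]
  have i: "integrable lborel (\<lambda>p. (v p)\<^sup>2 + (cmod (u p))\<^sup>2)" using assms by (auto simp: sq_int_def)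
  have le: "\<bar>v p\<bar> * cmod (u p) \<le> (v p)\<^sup>2 + (cmod (u p))\<^sup>2" for p
    using sum_squares_bound[of "\<bar>v p\<bar>" "cmod (u p)"] mult_nonneg_nonneg[of "\<bar>v p\<bar>" "cmod (u p)"] by (simp add: mult.assoc del: mult_nonneg_nonneg)
  show "integrable lborel (\<lambda>p. v p *\<^sub>R u p)"
    by (rule Bochner_Integration.integrable_bound[OF i]) (use le in auto)
  have "(\<integral>\<^sup>+p. ennreal (\<bar>v p\<bar> * cmod (u p)) \<partial>lborel) \<le> (\<integral>\<^sup>+p. ennreal ((v p)\<^sup>2 + (cmod (u p))\<^sup>2) \<partial>lborel)"
    using le by (intro nn_integral_mono ennreal_leI)
  also have "\<dots> = ennreal (LINT p|lborel. (v p)\<^sup>2 + (cmod (u p))\<^sup>2)"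
    by (rule nn_integral_eq_integral[OF i]) auto
  finally show "(\<integral>\<^sup>+p. ennreal (\<bar>v p\<bar> * cmod (u p)) \<partial>lborel) \<le> ennreal ((LINT p|lborel. (v p)\<^sup>2) + (LINT p|lborel. (cmod (u p))\<^sup>2))"
    using assms by (simp add: sq_int_def)
qed

text \<open>The bound is independent of the shift \<open>p\<close>. This uniformity supplies the
  absolute convergence behind the Fubini exchanges and later a pointwise bound on the smooth part of
  a convolution.\<close>

lemma integrable_shift_mult_sq_int:
  assumes u: "sq_int u" and [measurable]: "v \<in> borel_measurable borel" and v: "integrable lborel (\<lambda>p. (v p)\<^sup>2 :: real)"
  shows "integrable lborel (\<lambda>r. v r *\<^sub>R u (p - r))"
    and "(\<integral>\<^sup>+r. ennreal (\<bar>v r\<bar> * cmod (u (p - r))) \<partial>lborel) \<le> ennreal ((LINT p|lborel. (v p)\<^sup>2) + (LINT p|lborel. (cmod (u p))\<^sup>2))"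
proof -
  have "integrable lborel (\<lambda>r. (cmod (u (p - r)))\<^sup>2)"
    using integrable_lborel_reflect[of "\<lambda>r. (cmod (u r))\<^sup>2" p] u by (simp add: sq_int_def)
  then have s: "sq_int (\<lambda>r. u (p - r))" using sq_intD[OF u] by (auto simp: sq_int_def)
  have e: "(LINT r|lborel. (cmod (u (p - r)))\<^sup>2) = (LINT r|lborel. (cmod (u r))\<^sup>2)"
    using integral_lborel_reflect[of "\<lambda>r. (cmod (u r))\<^sup>2" p] sq_intD[OF u] by simp
  show "integrable lborel (\<lambda>r. v r *\<^sub>R u (p - r))"
    by (rule integrable_mult_sq_int(1)[OF s _ v]) simp
  show "(\<integral>\<^sup>+r. ennreal (\<bar>v r\<bar> * cmod (u (p - r))) \<partial>lborel) \<le> ennreal ((LINT p|lborel. (v p)\<^sup>2) + (LINT p|lborel. (cmod (u p))\<^sup>2))"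
    using integrable_mult_sq_int(2)[OF s _ v] by (simp add: e)
qed

section \<open>Gaussian regularization and spectral pairs\<close>

text \<open>The heat kernel at time \<open>e / (4 * pi)\<close>, of mass one; its Fourier transform
  is \<open>exp (- pi * e * (norm z)\<^sup>2)\<close>.\<close>

definition gauss :: "real \<Rightarrow> 'a::euclidean_space \<Rightarrow> real" where
  "gauss e q = e powr (- real DIM('a) / 2) * exp (- pi * (norm q)\<^sup>2 / e)"

lemma gauss_nonneg [simp]: "0 \<le> gauss e q" by (simp add: gauss_def)

lemma borel_measurable_gauss [measurable]: "gauss e \<in> borel_measurable borel"
  unfolding gauss_def by measurable

lemma gauss_integral:
  assumes "e > 0"
  shows "integrable lborel (gauss e :: 'a::euclidean_space \<Rightarrow> real)" "(LINT q::'a|lborel. gauss e q) = 1"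
proof -
  have eq: "gauss e q = e powr (- real DIM('a) / 2) * exp (- pi * (1/e) * (norm q)\<^sup>2)" for q :: 'a
    by (simp add: gauss_def)
  show "integrable lborel (gauss e :: 'a \<Rightarrow> real)"
    unfolding eq[abs_def] using gaussian_integral(1)[of "1/e", where 'a='a] assms by simp
  show "(LINT q::'a|lborel. gauss e q) = 1"
    unfolding eq using gaussian_integral(2)[of "1/e", where 'a='a] assms
    by (simp add: powr_divide powr_minus_divide)
qed

lemma gaussian_sq: "(exp (- pi * e * (norm q)\<^sup>2))\<^sup>2 = exp (- pi * (2 * e) * (norm q)\<^sup>2)"
  by (simp add: power2_eq_square flip: exp_add)

lemma integrable_gaussian_sq:
  assumes "e > 0" shows "integrable lborel (\<lambda>q::'a::euclidean_space. (exp (- pi * e * (norm q)\<^sup>2))\<^sup>2)"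
  unfolding gaussian_sq using assms by (intro gaussian_integral) auto

lemma gauss_sq_integrable:
  assumes "e > 0"
  shows "integrable lborel (\<lambda>q::'a::euclidean_space. (gauss e q)\<^sup>2)"
proof -
  have "(gauss e q)\<^sup>2 = (e powr (- real DIM('a) / 2))\<^sup>2 * (exp (- pi * (1/e) * (norm q)\<^sup>2))\<^sup>2" for q :: 'a
    by (simp add: gauss_def power_mult_distrib)
  then show ?thesis using integrable_gaussian_sq[of "1/e", where 'a='a] assms by simp
qed

definition wave :: "'a::euclidean_space \<Rightarrow> 'a \<Rightarrow> complex" where
  "wave p z = exp (\<i> * complex_of_real (2 * pi * (p \<bullet> z)))"

lemma norm_wave [simp]: "cmod (wave p z) = 1" by (simp add: wave_def)

lemma wave_diff: "wave (p - r) z = wave p z * wave (- r) z"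
  by (simp add: wave_def inner_diff_left algebra_simps flip: exp_add)

lemma borel_measurable_wave [measurable]: "wave p \<in> borel_measurable borel"
  unfolding wave_def by measurable

lemma borel_measurable_wave2 [measurable (raw)]:
  assumes [measurable]: "f \<in> borel_measurable M" "g \<in> borel_measurable M"
  shows "(\<lambda>x. wave (f x) (g x)) \<in> borel_measurable M"
  unfolding wave_def by measurable

text \<open>
  \<open>g\<close> is the Fourier transform of the square integrable \<open>u\<close>, expressed through Gaussian
  regularizations. All integrals converge absolutely, so that neither the Plancherel theorem
  nor Fourier inversion is needed.
\<close>
definition spectral :: "('a::euclidean_space \<Rightarrow> complex) \<Rightarrow> ('a \<Rightarrow> complex) \<Rightarrow> bool" where
  "spectral u g \<longleftrightarrow> sq_int u \<and> sq_int g \<and>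
     (\<forall>e>0. \<forall>p. conv (gauss e) u p = (LINT z|lborel. exp (- pi * e * (norm z)\<^sup>2) *\<^sub>R (wave p z * g z)))"

lemma sq_int_wave: "sq_int g \<Longrightarrow> sq_int (\<lambda>z. wave p z * g z)"
  by (rule sq_int_mult_bounded[where B=1]) auto

lemma integrable_spectral:
  assumes "sq_int g" "e > 0"
  shows "integrable lborel (\<lambda>z. exp (- pi * e * (norm z)\<^sup>2) *\<^sub>R (wave p z * g z))"
  using assms by (intro integrable_mult_sq_int integrable_gaussian_sq sq_int_wave) auto

lemma integrable_conv_gauss:
  assumes "sq_int u" "e > 0"
  shows "integrable lborel (\<lambda>r. gauss e r *\<^sub>R u (p - r))"
  by (rule integrable_shift_mult_sq_int[OF assms(1) _ gauss_sq_integrable[OF assms(2)]]) measurable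

lemma spectral_add:
  assumes "spectral u g" "spectral v h" shows "spectral (\<lambda>p. u p + v p) (\<lambda>z. g z + h z)"
proof -
  have "(LINT z|lborel. exp (- pi * e * (norm z)\<^sup>2) *\<^sub>R (wave p z * (g z + h z)))
      = (LINT z|lborel. exp (- pi * e * (norm z)\<^sup>2) *\<^sub>R (wave p z * g z)) + (LINT z|lborel. exp (- pi * e * (norm z)\<^sup>2) *\<^sub>R (wave p z * h z))"
    if "e > 0" for e p
    unfolding distrib_left scaleR_add_right
    using assms that by (intro Bochner_Integration.integral_add integrable_spectral) (auto simp: spectral_def)
  moreover have "conv (gauss e) (\<lambda>p. u p + v p) p = conv (gauss e) u p + conv (gauss e) v p" if "e > 0" for e p
    unfolding conv_def scaleR_add_right
    using assms that by (intro Bochner_Integration.integral_add integrable_conv_gauss) (auto simp: spectral_def)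
  ultimately show ?thesis using assms unfolding spectral_def by (simp add: sq_int_add)
qed

lemma spectral_cmult:
  assumes "spectral u g" shows "spectral (\<lambda>p. c * u p) (\<lambda>z. c * g z)"
proof -
  have "conv (gauss e) (\<lambda>p. c * u p) p = c * conv (gauss e) u p" for e p
    unfolding conv_def by (subst integral_mult_right_zero[symmetric]) (simp add: scaleR_conv_of_real mult_ac)
  moreover have "(LINT z|lborel. exp (- pi * e * (norm z)\<^sup>2) *\<^sub>R (wave p z * (c * g z)))
      = c * (LINT z|lborel. exp (- pi * e * (norm z)\<^sup>2) *\<^sub>R (wave p z * g z))" for e p
    by (subst integral_mult_right_zero[symmetric]) (simp add: scaleR_conv_of_real mult_ac)
  ultimately show ?thesis using assms unfolding spectral_def by (auto intro: sq_int_cmult)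
qed

text \<open>Absolutely convergent Fourier integral of an integrable kernel, with the sign convention
  of \<open>fourier\<close>.\<close>

definition khat :: "('a::euclidean_space \<Rightarrow> real) \<Rightarrow> 'a \<Rightarrow> complex" where
  "khat k z = (LINT r|lborel. k r *\<^sub>R wave (- r) z)"

lemma borel_measurable_khat [measurable]:
  assumes [measurable]: "k \<in> borel_measurable borel"
  shows "khat k \<in> borel_measurable borel"
  unfolding khat_def by measurable

lemma norm_khat_le:
  assumes "integrable lborel k" shows "cmod (khat k z) \<le> (LINT r|lborel. \<bar>k r\<bar>)"
  unfolding khat_def by (rule order_trans[OF integral_norm_bound]) simp

text \<open>Convolution theorem by two exchanges of integrals: the first brings the Gaussian to
  \<open>u\<close>; in the second, \<open>wave (p - r) z\<close> splits and
  \<open>wave (- r) z\<close> is collected with \<open>k r\<close> into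
  \<open>khat k z\<close>.\<close>

lemma spectral_conv:
  assumes s: "spectral u g" and k: "integrable lborel k"
  shows "spectral (conv k u) (\<lambda>z. khat k z * g z)"
proof -
  have u: "sq_int u" and g: "sq_int g" using s by (auto simp: spectral_def)
  note [measurable] = borel_measurable_integrable[OF k] sq_intD[OF u] sq_intD[OF g]
  have "conv (gauss e) (conv k u) p = (LINT z|lborel. exp (- pi * e * (norm z)\<^sup>2) *\<^sub>R (wave p z * (khat k z * g z)))"
    if e: "e > 0" for e p
  proof -
    \<comment> \<open>For fixed \<open>r\<close> the integral over \<open>q\<close> is at most
      \<open>C\<close> whatever the shift \<open>p - r\<close>; what remains is the mass of
      \<open>k\<close>.\<close>
    have int1: "integrable (lborel \<Otimes>\<^sub>M lborel) (\<lambda>(r, q). gauss e q *\<^sub>R k r *\<^sub>R u (p - q - r))"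
    proof (subst integrable_iff_bounded, intro conjI)
      show "(\<lambda>(r, q). gauss e q *\<^sub>R k r *\<^sub>R u (p - q - r)) \<in> borel_measurable (lborel \<Otimes>\<^sub>M lborel)" by measurable
      define C where "C = ennreal ((LINT p::'a|lborel. (gauss e p)\<^sup>2) + (LINT p|lborel. (cmod (u p))\<^sup>2))"
      have "(\<integral>\<^sup>+x. ennreal (norm (case x of (r, q) \<Rightarrow> gauss e q *\<^sub>R k r *\<^sub>R u (p - q - r))) \<partial>(lborel \<Otimes>\<^sub>M lborel))
        = (\<integral>\<^sup>+r. \<integral>\<^sup>+q. ennreal (norm (gauss e q *\<^sub>R k r *\<^sub>R u (p - q - r))) \<partial>lborel \<partial>lborel)"
        by (subst lborel.nn_integral_fst[symmetric]) (auto intro!: nn_integral_cong)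
      also have "\<dots> = (\<integral>\<^sup>+r. ennreal \<bar>k r\<bar> * (\<integral>\<^sup>+q. ennreal (\<bar>gauss e q\<bar> * cmod (u ((p - r) - q))) \<partial>lborel) \<partial>lborel)"
        by (intro nn_integral_cong, subst nn_integral_cmult[symmetric])
           (auto intro!: nn_integral_cong simp: ennreal_mult[symmetric] algebra_simps abs_mult)
      also have "\<dots> \<le> (\<integral>\<^sup>+r. ennreal \<bar>k r\<bar> * C \<partial>lborel)"
        unfolding C_def by (intro nn_integral_mono mult_left_mono integrable_shift_mult_sq_int(2)[OF u borel_measurable_gauss gauss_sq_integrable[OF e]] zero_le)
      also have "\<dots> = (\<integral>\<^sup>+r. ennreal \<bar>k r\<bar> \<partial>lborel) * C" by (rule nn_integral_multc) measurable
      also have "\<dots> < \<infinity>" using k by (auto simp: integrable_iff_bounded ennreal_mult_less_top C_def)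
      finally show "(\<integral>\<^sup>+x. ennreal (norm (case x of (r, q) \<Rightarrow> gauss e q *\<^sub>R k r *\<^sub>R u (p - q - r))) \<partial>(lborel \<Otimes>\<^sub>M lborel)) < \<infinity>" .
    qed
    have i3: "integrable lborel (\<lambda>z. exp (- pi * e * (norm z)\<^sup>2) * cmod (g z))"
      using integrable_norm[OF integrable_spectral[OF g e, of 0]] by (simp add: norm_mult)
    have int2: "integrable (lborel \<Otimes>\<^sub>M lborel) (\<lambda>(r, z). k r *\<^sub>R (exp (- pi * e * (norm z)\<^sup>2) *\<^sub>R (wave (p - r) z * g z)))"
    proof (rule lborel_pair.Fubini_integrable)
      show "(\<lambda>(r, z). k r *\<^sub>R (exp (- pi * e * (norm z)\<^sup>2) *\<^sub>R (wave (p - r) z * g z))) \<in> borel_measurable (lborel \<Otimes>\<^sub>M lborel)"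
        by measurable
      have "integrable lborel (\<lambda>r. \<bar>k r\<bar> * (LINT z|lborel. exp (- pi * e * (norm z)\<^sup>2) * cmod (g z)))"
        using k by auto
      then show "integrable lborel (\<lambda>r. LINT z|lborel. norm (case (r, z) of (r, z) \<Rightarrow> k r *\<^sub>R (exp (- pi * e * (norm z)\<^sup>2) *\<^sub>R (wave (p - r) z * g z))))"
        by (simp add: norm_mult abs_mult mult.assoc)
      show "AE r in lborel. integrable lborel (\<lambda>z. case (r, z) of (r, z) \<Rightarrow> k r *\<^sub>R (exp (- pi * e * (norm z)\<^sup>2) *\<^sub>R (wave (p - r) z * g z)))"
        unfolding prod.case by (intro AE_I2 integrable_scaleR_right integrable_spectral[OF g e])
    qed
    have "conv (gauss e) (conv k u) p = (LINT q|lborel. LINT r|lborel. gauss e q *\<^sub>R k r *\<^sub>R u (p - q - r))"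
      unfolding conv_def integral_scaleR_right ..
    also have "\<dots> = (LINT r|lborel. LINT q|lborel. gauss e q *\<^sub>R k r *\<^sub>R u (p - q - r))"
      by (rule lborel_pair.Fubini_integral[OF int1])
    also have "\<dots> = (LINT r|lborel. k r *\<^sub>R conv (gauss e) u (p - r))"
      unfolding conv_def integral_scaleR_right[symmetric] by (simp add: algebra_simps)
    also have "\<dots> = (LINT r|lborel. LINT z|lborel. k r *\<^sub>R (exp (- pi * e * (norm z)\<^sup>2) *\<^sub>R (wave (p - r) z * g z)))"
      using s e unfolding spectral_def integral_scaleR_right by simp
    also have "\<dots> = (LINT z|lborel. LINT r|lborel. k r *\<^sub>R (exp (- pi * e * (norm z)\<^sup>2) *\<^sub>R (wave (p - r) z * g z)))"
      by (rule lborel_pair.Fubini_integral[OF int2, symmetric])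
    also have "\<dots> = (LINT z|lborel. LINT r|lborel. (k r *\<^sub>R wave (- r) z) * (exp (- pi * e * (norm z)\<^sup>2) *\<^sub>R (wave p z * g z)))"
      by (simp add: wave_diff mult_ac scaleR_conv_of_real)
    also have "\<dots> = (LINT z|lborel. exp (- pi * e * (norm z)\<^sup>2) *\<^sub>R (wave p z * (khat k z * g z)))"
      unfolding khat_def integral_mult_left_zero by (simp add: mult_ac scaleR_conv_of_real)
    finally show ?thesis .
  qed
  moreover have "sq_int (\<lambda>z. khat k z * g z)"
    by (rule sq_int_mult_bounded[OF g _ AE_I2[OF norm_khat_le[OF k]]]) measurable
  ultimately show ?thesis using sq_int_conv[OF k u] by (simp add: spectral_def)
qed

section \<open>Injectivity of Gaussian regularization\<close>

text \<open>Boxes are stable under intersection and generate the Borel sets, so vanishing of the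
  integral spreads from boxes to all Borel sets by the pi-lambda theorem.\<close>

lemma AE_zero_of_box_integrals:
  fixes w :: "'a::euclidean_space \<Rightarrow> complex"
  assumes wm[measurable]: "w \<in> borel_measurable borel"
    and int: "\<And>a b. integrable lborel (\<lambda>q. indicator (box a b) q *\<^sub>R w q)"
    and zero: "\<And>a b. (LINT q|lborel. indicator (box a b) q *\<^sub>R w q) = 0"
  shows "AE q in lborel. w q = 0"
proof -
  let ?A = "\<lambda>n::nat. box (- (real n *\<^sub>R One)) (real n *\<^sub>R One) :: 'a set"
  have sB: "sets borel = sigma_sets UNIV (range (\<lambda>(a, b). box a b :: 'a set))"
    by (simp add: borel_eq_box)
  \<comment> \<open>Cutting off to a bounded box makes the function integrable, as complements and
    disjoint unions require, and the intersection of two boxes is again a box.\<close>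
  have AE0: "AE q in lborel. indicator (?A n) q *\<^sub>R w q = 0" for n
  proof (rule sigma_finite_measure.density_zero[OF sigma_finite_lborel int])
    define f where "f = (\<lambda>q. indicator (?A n) q *\<^sub>R w q)"
    have fint: "integrable lborel f" and f0: "integral\<^sup>L lborel f = 0"
      unfolding f_def by (rule int, rule zero)
    let ?E = "range (\<lambda>(a, b). box a b :: 'a set)"
    fix A :: "'a set" assume "A \<in> sets lborel"
    then have 3: "A \<in> sigma_sets UNIV ?E" by (simp add: sB)
    have 1: "Int_stable ?E" by (auto simp: Int_stable_def box_Int_box)
    have 2: "?E \<subseteq> Pow UNIV" by simp
    from 1 2 3 have "set_lebesgue_integral lborel A f = 0"
    proof (induction rule: sigma_sets_induct_disjoint)
      case (basic B)
      then obtain a b where B: "B = box a b" by auto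
      obtain c d where cd: "box a b \<inter> ?A n = box c d" using box_Int_box[of a b] by (rule that)
      have "indicator B q *\<^sub>R f q = indicator (box c d) q *\<^sub>R w q" for q
        by (simp add: f_def B indicator_inter_arith flip: cd)
      then show ?case unfolding set_lebesgue_integral_def by (simp only: zero)
    next
      case empty then show ?case by (simp add: set_lebesgue_integral_def)
    next
      case (compl B)
      then have [measurable]: "B \<in> sets borel" by (simp add: sB)
      have "indicator (UNIV - B) q *\<^sub>R f q = f q - indicator B q *\<^sub>R f q" for q
        by (auto simp: indicator_def)
      moreover have "integrable lborel (\<lambda>q. indicator B q *\<^sub>R f q)"
        by (rule integrable_mult_indicator[OF _ fint]) simp
      ultimately show ?case using compl fint f0
        by (simp add: set_lebesgue_integral_def)
    next
      case (union B)
      then have B[measurable]: "B i \<in> sets borel" for i unfolding sB by blast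
      have "set_lebesgue_integral lborel (\<Union>i. B i) f = (\<Sum>i. set_lebesgue_integral lborel (B i) f)"
      proof (rule lebesgue_integral_countable_add)
        show "B i \<inter> B j = {}" if "i \<noteq> j" for i j using union(1) that by (auto simp: disjoint_family_on_def)
        show "set_integrable lborel (\<Union>i. B i) f" unfolding set_integrable_def
          by (rule integrable_mult_indicator[OF _ fint]) simp
      qed simp
      then show ?case using union by simp
    qed
    then show "set_lebesgue_integral lborel A (\<lambda>q. indicator (?A n) q *\<^sub>R w q) = 0" by (simp only: f_def)
  qed
  have "AE q in lborel. \<forall>n. indicator (?A n) q *\<^sub>R w q = 0" unfolding AE_all_countable using AE0 by blast
  then show ?thesis
  proof eventually_elim
    case (elim q)
    have "q \<in> (\<Union>n. ?A n)" by (simp only: UN_box_eq_UNIV UNIV_I)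
    then obtain n where q: "q \<in> ?A n" by (rule UN_E)
    have "indicator (?A n) q *\<^sub>R w q = 0" using elim by (rule spec)
    then show ?case unfolding indicator_simps(1)[OF q] by (simp only: scaleR_one)
  qed
qed

text \<open>Moving the Gaussian average from \<open>w\<close> onto the indicator of a box gives
  functions \<open>\<Phi> c\<close> whose integrals against \<open>w\<close> vanish. As
  \<open>c\<close> tends to 0 they converge to the indicator off the boundary of the box, under a
  Gaussian majorant; so the box integrals of \<open>w\<close> vanish.\<close>

lemma sq_int_zero_if_conv_gauss_zero:
  fixes w :: "'a::euclidean_space \<Rightarrow> complex"
  assumes w: "sq_int w" and z: "\<And>e p. e > 0 \<Longrightarrow> conv (gauss e) w p = 0"
  shows "AE q in lborel. w q = 0"
proof (rule AE_zero_of_box_integrals)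
  show [measurable]: "w \<in> borel_measurable borel" using w by (rule sq_intD)
  fix a b :: 'a
  let ?A = "box a b"
  have ind2: "integrable lborel (\<lambda>q. (indicator ?A q :: real)\<^sup>2)"
    using integrable_real_indicator[of ?A lborel] emeasure_lborel_box_finite[of a b]
    by (simp add: power2_eq_square flip: indicator_inter_arith)
  show "integrable lborel (\<lambda>q. indicator ?A q *\<^sub>R w q)"
    by (rule integrable_mult_sq_int(1)[OF w _ ind2]) measurable
  define \<Phi> where "\<Phi> = (\<lambda>c q. LINT r|lborel. gauss 1 r * indicator ?A (q + c *\<^sub>R r) :: real)"
  \<comment> \<open>Rescaling turns \<open>gauss (c\<^sup>2)\<close> into \<open>gauss 1\<close>,
    the Jacobian \<open>c ^ DIM('a)\<close> cancelling its normalization.\<close>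
  have scaled: "(LINT r|lborel. gauss 1 r *\<^sub>R w (p - c *\<^sub>R r)) = 0" if c: "c > 0" for c p
  proof -
    have "gauss 1 r = c ^ DIM('a) * gauss (c\<^sup>2) (c *\<^sub>R r)" for r :: 'a
    proof -
      have "(c\<^sup>2) powr (- real DIM('a) / 2) = c powr (- real DIM('a))"
        using c powr_powr[of c 2 "- real DIM('a) / 2"] by simp
      also have "\<dots> = inverse (c ^ DIM('a))" using c by (simp add: powr_minus powr_realpow)
      finally show ?thesis using c by (simp add: gauss_def power_mult_distrib)
    qed
    then have "(LINT r|lborel. gauss 1 r *\<^sub>R w (p - c *\<^sub>R r)) = c ^ DIM('a) *\<^sub>R (LINT r|lborel. gauss (c\<^sup>2) (c *\<^sub>R r) *\<^sub>R w (p - c *\<^sub>R r))"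
      by (simp flip: integral_scaleR_right)
    also have "\<dots> = conv (gauss (c\<^sup>2)) w p"
      using integral_lborel_affine[of "\<lambda>r. gauss (c\<^sup>2) r *\<^sub>R w (p - r)" c 0] c by (simp add: conv_def)
    finally show ?thesis using z c by simp
  qed
  have zero: "(LINT q|lborel. \<Phi> c q *\<^sub>R w q) = 0" if c: "c > 0" for c
  proof -
    \<comment> \<open>Translating the box does not change the square integral of its indicator, so
      the inner integral over \<open>q\<close> is bounded uniformly in \<open>r\<close>.\<close>
    have 1: "integrable (lborel \<Otimes>\<^sub>M lborel) (\<lambda>(r, q). (gauss 1 r * indicator ?A (q + c *\<^sub>R r)) *\<^sub>R w q)"
    proof (subst integrable_iff_bounded, intro conjI)
      show "(\<lambda>(r, q). (gauss 1 r * indicator ?A (q + c *\<^sub>R r)) *\<^sub>R w q) \<in> borel_measurable (lborel \<Otimes>\<^sub>M lborel)" by measurable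
      define C where "C = ennreal ((LINT p::'a|lborel. (indicator ?A p)\<^sup>2) + (LINT p|lborel. (cmod (w p))\<^sup>2))"
      have "(\<integral>\<^sup>+x. ennreal (norm (case x of (r, q) \<Rightarrow> (gauss 1 r * indicator ?A (q + c *\<^sub>R r)) *\<^sub>R w q)) \<partial>(lborel \<Otimes>\<^sub>M lborel))
        = (\<integral>\<^sup>+r. \<integral>\<^sup>+q. ennreal (norm ((gauss 1 r * indicator ?A (q + c *\<^sub>R r)) *\<^sub>R w q)) \<partial>lborel \<partial>lborel)"
        by (subst lborel.nn_integral_fst[symmetric]) (auto intro!: nn_integral_cong)
      also have "\<dots> = (\<integral>\<^sup>+r. ennreal (gauss 1 r) * (\<integral>\<^sup>+q. ennreal (\<bar>indicator ?A (q + c *\<^sub>R r)\<bar> * cmod (w q)) \<partial>lborel) \<partial>lborel)"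
        by (intro nn_integral_cong, subst nn_integral_cmult[symmetric])
           (auto intro!: nn_integral_cong simp: ennreal_mult[symmetric] algebra_simps abs_mult)
      also have "\<dots> \<le> (\<integral>\<^sup>+r. ennreal (gauss 1 (r::'a)) * C \<partial>lborel)"
      proof (intro nn_integral_mono mult_left_mono zero_le)
        fix r :: 'a
        have i: "integrable lborel (\<lambda>q. (indicator ?A (q + c *\<^sub>R r) :: real)\<^sup>2)"
          using integrable_lborel_translate[OF ind2] .
        have e: "(LINT q|lborel. (indicator ?A (q + c *\<^sub>R r) :: real)\<^sup>2) = (LINT q|lborel. (indicator ?A q)\<^sup>2)"
          by (rule integral_lborel_translate) measurable
        show "(\<integral>\<^sup>+q. ennreal (\<bar>indicator ?A (q + c *\<^sub>R r)\<bar> * cmod (w q)) \<partial>lborel) \<le> C"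
          using integrable_mult_sq_int(2)[OF w _ i] unfolding C_def e by simp
      qed
      also have "\<dots> = (\<integral>\<^sup>+r. ennreal (gauss 1 (r::'a)) \<partial>lborel) * C" by (rule nn_integral_multc) measurable
      also have "\<dots> < \<infinity>" using gauss_integral(1)[of 1, where 'a='a] by (auto simp: integrable_iff_bounded ennreal_mult_less_top C_def)
      finally show "(\<integral>\<^sup>+x. ennreal (norm (case x of (r, q) \<Rightarrow> (gauss 1 r * indicator ?A (q + c *\<^sub>R r)) *\<^sub>R w q)) \<partial>(lborel \<Otimes>\<^sub>M lborel)) < \<infinity>" .
    qed
    have 2: "integrable (lborel \<Otimes>\<^sub>M lborel) (\<lambda>(r, p). (gauss 1 r * indicator ?A p) *\<^sub>R w (p - c *\<^sub>R r))"
    proof (subst integrable_iff_bounded, intro conjI)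
      show "(\<lambda>(r, p). (gauss 1 r * indicator ?A p) *\<^sub>R w (p - c *\<^sub>R r)) \<in> borel_measurable (lborel \<Otimes>\<^sub>M lborel)" by measurable
      have "(\<integral>\<^sup>+x. ennreal (norm (case x of (r, p) \<Rightarrow> (gauss 1 r * indicator ?A p) *\<^sub>R w (p - c *\<^sub>R r))) \<partial>(lborel \<Otimes>\<^sub>M lborel))
        = (\<integral>\<^sup>+r. \<integral>\<^sup>+p. ennreal (norm ((gauss 1 r * indicator ?A p) *\<^sub>R w (p - c *\<^sub>R r))) \<partial>lborel \<partial>lborel)"
        by (subst lborel.nn_integral_fst[symmetric]) (auto intro!: nn_integral_cong)
      also have "\<dots> = (\<integral>\<^sup>+r. \<integral>\<^sup>+q. ennreal (norm ((gauss 1 r * indicator ?A (q + c *\<^sub>R r)) *\<^sub>R w q)) \<partial>lborel \<partial>lborel)"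
      proof (rule nn_integral_cong)
        fix r :: 'a
        show "(\<integral>\<^sup>+p. ennreal (norm ((gauss 1 r * indicator ?A p) *\<^sub>R w (p - c *\<^sub>R r))) \<partial>lborel) = (\<integral>\<^sup>+q. ennreal (norm ((gauss 1 r * indicator ?A (q + c *\<^sub>R r)) *\<^sub>R w q)) \<partial>lborel)"
          using nn_integral_lborel_translate[of "\<lambda>p. ennreal (norm ((gauss 1 r * indicator ?A p) *\<^sub>R w (p - c *\<^sub>R r)))" "c *\<^sub>R r"] by simp
      qed
      also have "\<dots> = (\<integral>\<^sup>+x. ennreal (norm (case x of (r, q) \<Rightarrow> (gauss 1 r * indicator ?A (q + c *\<^sub>R r)) *\<^sub>R w q)) \<partial>(lborel \<Otimes>\<^sub>M lborel))"
        by (subst lborel.nn_integral_fst[symmetric]) (auto intro!: nn_integral_cong)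
      also have "\<dots> < \<infinity>" using 1 unfolding integrable_iff_bounded by blast
      finally show "(\<integral>\<^sup>+x. ennreal (norm (case x of (r, p) \<Rightarrow> (gauss 1 r * indicator ?A p) *\<^sub>R w (p - c *\<^sub>R r))) \<partial>(lborel \<Otimes>\<^sub>M lborel)) < \<infinity>" .
    qed
    have "(LINT q|lborel. \<Phi> c q *\<^sub>R w q) = (LINT q|lborel. LINT r|lborel. (gauss 1 r * indicator ?A (q + c *\<^sub>R r)) *\<^sub>R w q)"
    proof (rule Bochner_Integration.integral_cong[OF refl])
      fix q
      have "integrable lborel (\<lambda>r. gauss 1 r * indicator ?A (q + c *\<^sub>R r) :: real)"
        by (rule Bochner_Integration.integrable_bound[OF gauss_integral(1)[of 1]]) (auto intro!: AE_I2 mult_left_le simp: indicator_le_1)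
      then show "\<Phi> c q *\<^sub>R w q = (LINT r|lborel. (gauss 1 r * indicator ?A (q + c *\<^sub>R r)) *\<^sub>R w q)"
        unfolding \<Phi>_def by (rule integral_scaleR_left[symmetric])
    qed
    also have "\<dots> = (LINT r|lborel. LINT q|lborel. (gauss 1 r * indicator ?A (q + c *\<^sub>R r)) *\<^sub>R w q)"
      by (rule lborel_pair.Fubini_integral[OF 1])
    also have "\<dots> = (LINT r|lborel. LINT p|lborel. (gauss 1 r * indicator ?A p) *\<^sub>R w (p - c *\<^sub>R r))"
    proof (rule Bochner_Integration.integral_cong[OF refl])
      fix r :: 'a
      show "(LINT q|lborel. (gauss 1 r * indicator ?A (q + c *\<^sub>R r)) *\<^sub>R w q) = (LINT p|lborel. (gauss 1 r * indicator ?A p) *\<^sub>R w (p - c *\<^sub>R r))"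
        using integral_lborel_translate[of "\<lambda>p. (gauss 1 r * indicator ?A p) *\<^sub>R w (p - c *\<^sub>R r)" "c *\<^sub>R r"] by simp
    qed
    also have "\<dots> = (LINT p|lborel. LINT r|lborel. (gauss 1 r * indicator ?A p) *\<^sub>R w (p - c *\<^sub>R r))"
      by (rule lborel_pair.Fubini_integral[OF 2, symmetric])
    also have "\<dots> = (LINT p|lborel. indicator ?A p *\<^sub>R (LINT r|lborel. gauss 1 r *\<^sub>R w (p - c *\<^sub>R r)))"
      unfolding integral_scaleR_right[symmetric] by (simp add: mult.commute)
    also have "\<dots> = 0" by (simp add: scaled[OF c])
    finally show ?thesis .
  qed
  have g1: "integrable lborel (gauss 1 :: 'a \<Rightarrow> real)" "(LINT r::'a|lborel. gauss 1 r) = 1"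
    by (rule gauss_integral, simp)+
  obtain R where R: "\<And>q. q \<in> ?A \<Longrightarrow> norm q \<le> R" using bounded_box[of a b] unfolding bounded_iff by blast
  \<comment> \<open>For \<open>c \<le> 1\<close>, \<open>q + c *\<^sub>R r\<close> in the box forces
    \<open>norm q \<le> R + norm r\<close>. Half of the exponent of the Gaussian in \<open>r\<close>
    then pays for decay in \<open>q\<close>; integrating the other half gives the power of
    2.\<close>
  define W where "W = (\<lambda>q. 2 powr (real DIM('a) / 2) * exp (pi * R\<^sup>2 / 2) * exp (- pi * (1/4) * (norm (q::'a))\<^sup>2))"
  have \<Phi>W: "\<bar>\<Phi> c q\<bar> \<le> W q" if c: "0 < c" "c \<le> 1" for c q
  proof -
    let ?h = "\<lambda>r::'a. exp (pi * R\<^sup>2 / 2) * exp (- pi * (1/4) * (norm q)\<^sup>2) * exp (- pi * (1/2) * (norm r)\<^sup>2)"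
    have le: "\<bar>gauss 1 r * indicator ?A (q + c *\<^sub>R r)\<bar> \<le> ?h r" for r
    proof (cases "q + c *\<^sub>R r \<in> ?A")
      case True
      have "norm q \<le> norm (q + c *\<^sub>R r) + norm (c *\<^sub>R r)"
        using norm_triangle_ineq4[of "q + c *\<^sub>R r" "c *\<^sub>R r"] by simp
      also have "\<dots> \<le> R + norm r" using R[OF True] c mult_right_mono[of c 1 "norm r"] by simp
      finally have "(norm q)\<^sup>2 \<le> (R + norm r)\<^sup>2" by (intro power_mono) auto
      also have "\<dots> \<le> 2 * R\<^sup>2 + 2 * (norm r)\<^sup>2" using sum_squares_bound[of R "norm r"] by (simp add: power2_sum)
      finally have "pi * ((norm q)\<^sup>2 / 4) \<le> pi * (R\<^sup>2 / 2 + (norm r)\<^sup>2 / 2)" by (intro mult_left_mono) auto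
      then have "- pi * (norm r)\<^sup>2 \<le> pi * R\<^sup>2 / 2 + - pi * (1/4) * (norm q)\<^sup>2 + - pi * (1/2) * (norm r)\<^sup>2"
        by (simp add: algebra_simps)
      then show ?thesis using True by (simp add: gauss_def flip: exp_add)
    qed simp
    have hi: "integrable lborel ?h" using gaussian_integral(1)[of "1/2", where 'a='a] by simp
    have "\<bar>\<Phi> c q\<bar> \<le> (LINT r|lborel. \<bar>gauss 1 r * indicator ?A (q + c *\<^sub>R r)\<bar>)"
      unfolding \<Phi>_def using integral_norm_bound[of lborel "\<lambda>r. gauss 1 r * indicator ?A (q + c *\<^sub>R r) :: real"] by simp
    also have "\<dots> \<le> (LINT r|lborel. ?h r)"
    proof (rule integral_mono[OF _ hi le])
      show "integrable lborel (\<lambda>r. \<bar>gauss 1 r * indicator ?A (q + c *\<^sub>R r)\<bar> :: real)"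
        by (rule Bochner_Integration.integrable_bound[OF hi]) (use le in auto)
    qed
    also have "\<dots> = W q" using gaussian_integral(2)[of "1/2", where 'a='a]
      by (simp add: W_def powr_divide powr_minus_divide)
    finally show ?thesis .
  qed
  have "(LINT q|lborel. indicator ?A q *\<^sub>R w q) = 0"
  proof (rule LIMSEQ_unique)
    show "(\<lambda>n. LINT q|lborel. \<Phi> (1 / real (Suc n)) q *\<^sub>R w q) \<longlonglongrightarrow> 0"
      by (simp add: zero del: of_nat_Suc)
    show "(\<lambda>n. LINT q|lborel. \<Phi> (1 / real (Suc n)) q *\<^sub>R w q) \<longlonglongrightarrow> (LINT q|lborel. indicator ?A q *\<^sub>R w q)"
    proof (rule integral_dominated_convergence[where w="\<lambda>q. W q * cmod (w q)"])
      have "integrable lborel (\<lambda>q::'a. (W q)\<^sup>2)" unfolding W_def power_mult_distrib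
        by (intro integrable_mult_right integrable_gaussian_sq) simp
      then have "integrable lborel (\<lambda>q. W q *\<^sub>R w q)"
        by (intro integrable_mult_sq_int(1)[OF w]) (auto simp: W_def)
      from integrable_norm[OF this] show "integrable lborel (\<lambda>q. W q * cmod (w q))" by (simp add: W_def)
      show "(\<lambda>q. \<Phi> (1 / real (Suc n)) q *\<^sub>R w q) \<in> borel_measurable lborel" for n
        unfolding \<Phi>_def by measurable
      show "AE q in lborel. norm (\<Phi> (1 / real (Suc n)) q *\<^sub>R w q) \<le> W q * cmod (w q)" for n
        using \<Phi>W[of "1 / real (Suc n)"] by (auto intro!: AE_I2 mult_right_mono)
      \<comment> \<open>Off the boundary of the box the indicator is locally constant, which gives
        pointwise convergence of the averages.\<close>
      have "negligible (frontier ?A)" by (intro negligible_convex_frontier) (simp add: convex_box)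
      then have "frontier ?A \<in> null_sets lborel"
        by (auto simp: negligible_iff_null_sets null_sets_completion_iff)
      then have "AE q in lborel. q \<notin> frontier ?A" by (rule AE_not_in)
      then show "AE q in lborel. (\<lambda>n. \<Phi> (1 / real (Suc n)) q *\<^sub>R w q) \<longlonglongrightarrow> indicator ?A q *\<^sub>R w q"
      proof eventually_elim
        case (elim q)
        have "(\<lambda>n. \<Phi> (1 / real (Suc n)) q) \<longlonglongrightarrow> (LINT r::'a|lborel. gauss 1 r * indicator ?A q)"
          unfolding \<Phi>_def
        proof (rule integral_dominated_convergence[where w="gauss 1"])
          show "AE r in lborel. (\<lambda>n. gauss 1 r * indicator ?A (q + (1 / real (Suc n)) *\<^sub>R r) :: real) \<longlonglongrightarrow> gauss 1 r * indicator ?A q"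
          proof (intro AE_I2 tendsto_mult_left)
            fix r
            have l: "(\<lambda>n. q + (1 / real (Suc n)) *\<^sub>R r) \<longlonglongrightarrow> q + 0 *\<^sub>R r"
              by (intro tendsto_intros LIMSEQ_Suc lim_1_over_n)
            show "(\<lambda>n. indicator ?A (q + (1 / real (Suc n)) *\<^sub>R r) :: real) \<longlonglongrightarrow> indicator ?A q"
            proof (cases "q \<in> ?A")
              case True
              have "\<forall>\<^sub>F n in sequentially. q + (1 / real (Suc n)) *\<^sub>R r \<in> ?A"
                using topological_tendstoD[OF l, of ?A] True by (simp add: open_box)
              then have "\<forall>\<^sub>F n in sequentially. (indicator ?A (q + (1 / real (Suc n)) *\<^sub>R r) :: real) = indicator ?A q"
                by (rule eventually_mono) (simp only: indicator_simps(1) True)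
              then show ?thesis by (rule tendsto_eventually)
            next
              case False
              then have "q \<in> - closure ?A" using elim by (simp add: frontier_def interior_open open_box)
              then have "\<forall>\<^sub>F n in sequentially. q + (1 / real (Suc n)) *\<^sub>R r \<in> - closure ?A"
                using topological_tendstoD[OF l, of "- closure ?A"] by (simp add: open_Compl)
              then have "\<forall>\<^sub>F n in sequentially. (indicator ?A (q + (1 / real (Suc n)) *\<^sub>R r) :: real) = indicator ?A q"
              proof eventually_elim
                case (elim n)
                then have "q + (1 / real (Suc n)) *\<^sub>R r \<notin> ?A" using closure_subset by blast
                with False show ?case by simp
              qed
              then show ?thesis by (rule tendsto_eventually)
            qed
          qed
          show "AE r in lborel. norm (gauss 1 r * indicator ?A (q + (1 / real (Suc n)) *\<^sub>R r) :: real) \<le> gauss 1 r" for n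
            by (intro AE_I2) (simp add: mult_left_le indicator_le_1)
        qed (use g1(1) in simp_all)
        then have "(\<lambda>n. \<Phi> (1 / real (Suc n)) q) \<longlonglongrightarrow> indicator ?A q" using g1 by simp
        then show ?case by (intro tendsto_intros)
      qed
    qed measurable
  qed
  then show "(LINT q|lborel. indicator ?A q *\<^sub>R w q) = 0" .
qed

text \<open>Takes the place of injectivity of the Fourier transform: the difference is square
  integrable and all its Gaussian regularizations are 0.\<close>

lemma spectral_unique:
  assumes u: "spectral u g" and v: "spectral v h" and eq: "AE z in lborel. g z = h z"
  shows "AE q in lborel. u q = v q"
proof -
  have "spectral (\<lambda>q. u q + (-1) * v q) (\<lambda>z. g z + (-1) * h z)"
    by (intro spectral_add u spectral_cmult v)
  then have s: "sq_int (\<lambda>q. u q + (-1) * v q)"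
    and c: "\<And>e p. e > 0 \<Longrightarrow> conv (gauss e) (\<lambda>q. u q + (-1) * v q) p = (LINT z|lborel. exp (- pi * e * (norm z)\<^sup>2) *\<^sub>R (wave p z * (g z + (-1) * h z)))"
    unfolding spectral_def by blast+
  have "conv (gauss e) (\<lambda>q. u q + (-1) * v q) p = 0" if "e > 0" for e p
    unfolding c[OF that] by (intro integral_eq_zero_AE, use eq in eventually_elim) simp
  with s have "AE q in lborel. u q + (-1) * v q = 0" by (rule sq_int_zero_if_conv_gauss_zero)
  then show ?thesis by eventually_elim simp
qed

section \<open>From Lebesgue classes and limits of truncations to spectral pairs\<close>

lemma integrable_lebesgue_iff_lborel:
  fixes f :: "'a::euclidean_space \<Rightarrow> 'b::{banach, second_countable_topology}"
  assumes "f \<in> borel_measurable borel"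
  shows "integrable lebesgue f \<longleftrightarrow> integrable lborel f"
  using assms by (intro integrable_completion) simp

lemma integral_lebesgue_eq_lborel:
  fixes f :: "'a::euclidean_space \<Rightarrow> 'b::{banach, second_countable_topology}"
  assumes "f \<in> borel_measurable borel"
  shows "(LINT x|lebesgue. f x) = (LINT x|lborel. f x)"
  using assms by (intro integral_completion) simp

text \<open>Preimages under the two functions differ by a subset of a null set, which is measurable
  because Lebesgue measure is complete.\<close>

lemma borel_measurable_lebesgueI_AE:
  fixes f g :: "'a::euclidean_space \<Rightarrow> 'b::topological_space"
  assumes g: "g \<in> borel_measurable lebesgue" and eq: "AE x in lebesgue. f x = g x"
  shows "f \<in> borel_measurable lebesgue"
proof (rule measurableI)
  fix A :: "'b set" assume A: "A \<in> sets borel"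
  define N where "N = {x. f x \<noteq> g x}"
  have N: "N \<in> null_sets lebesgue" using eq by (simp add: completion.AE_iff_null_sets N_def)
  have "f -` A \<inter> N \<in> null_sets lebesgue" by (rule completion.complete2[OF _ N]) auto
  then have "(g -` A \<inter> space lebesgue - N) \<union> (f -` A \<inter> N) \<in> sets lebesgue"
    using N measurable_sets[OF g A] by (intro sets.Un sets.Diff) auto
  moreover have "f -` A \<inter> space lebesgue = (g -` A \<inter> space lebesgue - N) \<union> (f -` A \<inter> N)"
    by (auto simp: N_def)
  ultimately show "f -` A \<inter> space lebesgue \<in> sets lebesgue" by simp
qed simp

lemma lebesgue_borel_representative:
  fixes f :: "'a::euclidean_space \<Rightarrow> complex"
  assumes f: "f \<in> borel_measurable lebesgue"
  obtains g where "g \<in> borel_measurable borel" "AE x in lebesgue. f x = g x"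
proof -
  have "(\<lambda>x. Re (f x)) \<in> borel_measurable lebesgue" "(\<lambda>x. Im (f x)) \<in> borel_measurable lebesgue" using f by auto
  from this[THEN completion_ex_borel_measurable_real]
  obtain r i where [measurable]: "r \<in> borel_measurable borel" "i \<in> borel_measurable borel"
    and ri: "AE x in lborel. Re (f x) = r x" "AE x in lborel. Im (f x) = i x" by auto
  from ri have "AE x in lborel. f x = Complex (r x) (i x)" by eventually_elim (simp add: complex_eq_iff)
  moreover have "(\<lambda>x. Complex (r x) (i x)) \<in> borel_measurable borel" unfolding Complex_eq by measurable
  ultimately show ?thesis using that[OF _ AE_completion] by simp
qed

lemma sq_int_representative:
  assumes "f \<in> L2"
  obtains g where "sq_int g" "AE x in lebesgue. f x = g x"
proof -
  have "f \<in> borel_measurable lebesgue" using assms by (simp add: L2_def)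
  then obtain g where g: "g \<in> borel_measurable borel" and eq: "AE x in lebesgue. f x = g x"
    by (rule lebesgue_borel_representative)
  have "integrable lebesgue (\<lambda>p. (cmod (g p))\<^sup>2)"
  proof (rule integrable_cong_AE_imp)
    show "integrable lebesgue (\<lambda>p. (cmod (f p))\<^sup>2)" using assms by (simp add: L2_def)
    show "AE x in lebesgue. (cmod (f x))\<^sup>2 = (cmod (g x))\<^sup>2" using eq by eventually_elim simp
    show "(\<lambda>p. (cmod (g p))\<^sup>2) \<in> borel_measurable lebesgue"
      using g by (intro measurable_completion) simp
  qed
  moreover have "(\<lambda>p. (cmod (g p))\<^sup>2) \<in> borel_measurable borel" using g by simp
  ultimately have "sq_int g" using g by (simp add: sq_int_def integrable_lebesgue_iff_lborel)
  from that[OF this eq] show ?thesis .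
qed

lemma inner_prod_eq: "(\<xi>, \<sigma>) \<bullet> (x, t) = \<xi> \<bullet> x + \<sigma> * t"
  by (simp add: inner_prod_def)

lemma fourier_eq_wave:
  fixes u w :: "(real ^ 'n::finite) \<times> real \<Rightarrow> complex"
  assumes w: "w \<in> borel_measurable borel" and eq: "AE x in lebesgue. u x = w x"
  shows "fourier (\<lambda>q. indicator (ball 0 R) q * u q) z
    = (LINT q|lborel. indicator (ball 0 R) q *\<^sub>R (wave (- q) z * w q))"
proof -
  note [measurable] = w
  have [measurable]: "ball 0 R \<in> sets (borel :: ((real ^ 'n) \<times> real) measure)" by simp
  obtain \<xi> \<sigma> where z: "z = (\<xi>, \<sigma>)" by (cases z)
  have eq': "exp (- 2 * complex_of_real pi * \<i> * complex_of_real (\<xi> \<bullet> x + \<sigma> * t)) * (indicator (ball 0 R) (x, t) * u (x, t))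
    = indicator (ball 0 R) (x, t) *\<^sub>R (wave (- (x, t)) z * u (x, t))" for x t
  proof -
    have "- (x, t) \<bullet> z = - (\<xi> \<bullet> x + \<sigma> * t)"
      unfolding z by (simp only: inner_minus_left inner_prod_eq inner_commute[of x] mult.commute[of t])
    then have "wave (- (x, t)) z = exp (- 2 * complex_of_real pi * \<i> * complex_of_real (\<xi> \<bullet> x + \<sigma> * t))"
      by (simp only: wave_def, intro arg_cong[where f=exp]) (simp add: algebra_simps)
    then show ?thesis by (cases "(x, t) \<in> ball 0 R") (simp_all only: indicator_simps scaleR_one scaleR_zero_left mult_1_left mult_zero_left mult_zero_right not_False_eq_True)
  qed
  have "fourier (\<lambda>q. indicator (ball 0 R) q * u q) z = (LINT (x, t)|lebesgue. indicator (ball 0 R) (x, t) *\<^sub>R (wave (- (x, t)) z * u (x, t)))"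
    by (simp only: fourier_def z prod.case eq'[unfolded z])
  also have "\<dots> = (LINT q|lebesgue. indicator (ball 0 R) q *\<^sub>R (wave (- q) z * u q))"
    by (rule Bochner_Integration.integral_cong) auto
  also have "\<dots> = (LINT q|lebesgue. indicator (ball 0 R) q *\<^sub>R (wave (- q) z * w q))"
  proof (rule integral_cong_AE)
    have wl: "w \<in> borel_measurable lebesgue" using w by (intro measurable_completion) simp
    have wv: "(\<lambda>q. wave (- q) z) \<in> borel_measurable lebesgue"
      by (rule measurable_completion) simp
    have i: "(indicator (ball 0 R) :: _ \<Rightarrow> real) \<in> borel_measurable lebesgue"
      by (rule measurable_completion, rule borel_measurable_indicator) simp
    have "u \<in> borel_measurable lebesgue" by (rule borel_measurable_lebesgueI_AE[OF wl eq])
    then show "(\<lambda>q. indicator (ball 0 R) q *\<^sub>R (wave (- q) z * u q)) \<in> borel_measurable lebesgue"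
      using wv i by (intro borel_measurable_scaleR borel_measurable_times)
    show "(\<lambda>q. indicator (ball 0 R) q *\<^sub>R (wave (- q) z * w q)) \<in> borel_measurable lebesgue"
      using wv i wl by (intro borel_measurable_scaleR borel_measurable_times)
    show "AE q in lebesgue. indicator (ball 0 R) q *\<^sub>R (wave (- q) z * u q) = indicator (ball 0 R) q *\<^sub>R (wave (- q) z * w q)"
      using eq by eventually_elim simp
  qed
  also have "\<dots> = (LINT q|lborel. indicator (ball 0 R) q *\<^sub>R (wave (- q) z * w q))"
    by (intro integral_lebesgue_eq_lborel) measurable
  finally show ?thesis .
qed

lemma integral_gaussian_wave:
  fixes q :: "'a::euclidean_space"
  assumes "e > 0"
  shows "integrable lborel (\<lambda>z. exp (- pi * e * (norm z)\<^sup>2) *\<^sub>R wave q z)"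
    and "(LINT z|lborel. exp (- pi * e * (norm z)\<^sup>2) *\<^sub>R wave q z) = complex_of_real (gauss e q)"
  using gaussian_fourier[OF assms, of q] unfolding wave_def gauss_def
  by (simp_all add: scaleR_conv_of_real mult.commute)

text \<open>Strong convergence implies weak convergence by Cauchy-Schwarz. The estimate is carried
  out in \<open>ennreal\<close>, since individual distances may be infinite before the limit is
  approached.\<close>

lemma tendsto_integral_mult_L2:
  fixes v h :: "'a::euclidean_space \<Rightarrow> complex" and T :: "nat \<Rightarrow> 'a \<Rightarrow> complex"
  assumes v: "sq_int v" and h: "sq_int h" and Tm [measurable]: "\<And>n. T n \<in> borel_measurable borel"
    and iT: "\<And>n. integrable lborel (\<lambda>z. v z * T n z)"
    and lim: "(\<lambda>n. \<integral>\<^sup>+z. ennreal ((cmod (T n z - h z))\<^sup>2) \<partial>lborel) \<longlonglongrightarrow> 0"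
  shows "(\<lambda>n. LINT z|lborel. v z * T n z) \<longlonglongrightarrow> (LINT z|lborel. v z * h z)"
proof -
  note [measurable] = sq_intD[OF v] sq_intD[OF h]
  define A where "A = (\<integral>\<^sup>+z. (ennreal (cmod (v z)))\<^sup>2 \<partial>lborel)"
  define D where "D = (\<lambda>n. \<integral>\<^sup>+z. ennreal ((cmod (T n z - h z))\<^sup>2) \<partial>lborel)"
  define d where "d = (\<lambda>n. (LINT z|lborel. v z * T n z) - (LINT z|lborel. v z * h z))"
  have A: "A < top" using v by (simp add: sq_int_iff A_def)
  have ih: "integrable lborel (\<lambda>z. v z * h z)"
  proof (rule Bochner_Integration.integrable_bound)
    show "integrable lborel (\<lambda>z. cmod (v z) *\<^sub>R h z)"
      using v by (intro integrable_mult_sq_int(1)[OF h]) (auto simp: sq_int_def)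
  qed (auto simp: norm_mult)
  have bd: "ennreal ((cmod (d n))\<^sup>2) \<le> A * D n" for n
  proof -
    have "d n = (LINT z|lborel. v z * T n z - v z * h z)"
      unfolding d_def by (rule Bochner_Integration.integral_diff[OF iT ih, symmetric])
    then have "ennreal (cmod (d n)) \<le> (\<integral>\<^sup>+z. ennreal (cmod (v z * T n z - v z * h z)) \<partial>lborel)"
      using integral_norm_bound_ennreal[OF Bochner_Integration.integrable_diff[OF iT ih]] by simp
    also have "\<dots> = (\<integral>\<^sup>+z. ennreal (cmod (v z)) * ennreal (cmod (T n z - h z)) \<partial>lborel)"
      by (intro nn_integral_cong) (simp only: right_diff_distrib[symmetric] norm_mult ennreal_mult norm_ge_zero)
    finally have "(ennreal (cmod (d n)))\<^sup>2 \<le> (\<integral>\<^sup>+z. ennreal (cmod (v z)) * ennreal (cmod (T n z - h z)) \<partial>lborel)\<^sup>2"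
      by (rule power_mono) simp
    also have "\<dots> \<le> A * (\<integral>\<^sup>+z. (ennreal (cmod (T n z - h z)))\<^sup>2 \<partial>lborel)"
      unfolding A_def by (rule Cauchy_Schwarz_nn_integral) measurable
    finally show ?thesis by (simp add: ennreal_power D_def)
  qed
  have "(\<lambda>n. A * D n) \<longlonglongrightarrow> A * 0"
    using A lim unfolding D_def by (intro ennreal_tendsto_cmult) auto
  then have AD: "(\<lambda>n. A * D n) \<longlonglongrightarrow> 0" by simp
  have "(\<lambda>n. ennreal ((cmod (d n))\<^sup>2)) \<longlonglongrightarrow> ennreal 0"
    using tendsto_sandwich[OF always_eventually[of "\<lambda>n. 0 \<le> ennreal ((cmod (d n))\<^sup>2)"] always_eventually[of "\<lambda>n. ennreal ((cmod (d n))\<^sup>2) \<le> A * D n"] tendsto_const AD] bd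
    by simp
  then have "(\<lambda>n. (cmod (d n))\<^sup>2) \<longlonglongrightarrow> 0"
    by (subst (asm) tendsto_ennreal_iff) auto
  then have "(\<lambda>n. sqrt ((cmod (d n))\<^sup>2)) \<longlonglongrightarrow> sqrt 0"
    by (rule tendsto_real_sqrt)
  then have "(\<lambda>n. cmod (d n)) \<longlonglongrightarrow> 0" by simp
  then have "d \<longlonglongrightarrow> 0" by (rule tendsto_norm_zero_cancel)
  then show ?thesis unfolding d_def by (rule LIM_zero_cancel)
qed

text \<open>For a truncation the identity is Fubini together with the Fourier transform of a
  Gaussian. As the radius grows, the convolution side converges by domination and the spectral side
  by the given \<open>L2\<close> limit, tested against the square integrable product of a Gaussian
  and a wave.\<close>

lemma spectral_if_L2_fourier:
  fixes u :: "(real ^ 'n::finite) \<times> real \<Rightarrow> complex"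
  assumes F: "has_L2_fourier u g" and w: "sq_int w" and uw: "AE x in lebesgue. u x = w x"
    and h: "sq_int h" and gh: "AE x in lebesgue. g x = h x"
  shows "spectral w h"
proof -
  note [measurable] = sq_intD[OF w] sq_intD[OF h]
  define B where "B = (\<lambda>n::nat. ball 0 (real n) :: ((real ^ 'n) \<times> real) set)"
  have [measurable]: "B n \<in> sets borel" for n by (simp add: B_def)
  define T where "T = (\<lambda>n z. LINT q|lborel. indicator (B n) q *\<^sub>R (wave (- q) z * w q))"
  have T1: "T n z = (LINT q|lborel. indicator (ball 0 (real n)) q *\<^sub>R (wave (- q) z * w q))" for n z
    by (simp only: T_def B_def)
  note fw = fourier_eq_wave[OF sq_intD[OF w] uw]
  have [measurable]: "T n \<in> borel_measurable borel" for n unfolding T_def by measurable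
  have wB: "integrable lborel (\<lambda>q. indicator (B n) q *\<^sub>R w q)" for n
  proof (rule integrable_mult_sq_int(1)[OF w])
    show "integrable lborel (\<lambda>p. (indicator (B n) p :: real)\<^sup>2)"
    proof -
      have "integrable lborel (indicator (B n) :: _ \<Rightarrow> real)"
        by (rule integrable_real_indicator) (simp, unfold B_def, rule emeasure_lborel_ball_finite)
      then show ?thesis by (simp add: power2_eq_square flip: indicator_inter_arith)
    qed
  qed simp
  have lim0: "(\<lambda>n. \<integral>\<^sup>+z. ennreal ((cmod (T n z - h z))\<^sup>2) \<partial>lborel) \<longlonglongrightarrow> 0"
  proof -
    have "(\<lambda>n. \<integral>\<^sup>+z. ennreal ((cmod (fourier (\<lambda>q. indicator (ball 0 (real n)) q * u q) z - g z))\<^sup>2) \<partial>lebesgue) \<longlonglongrightarrow> 0"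
      by (rule filterlim_compose[OF F[unfolded has_L2_fourier_def, THEN conjunct2, THEN conjunct2] filterlim_real_sequentially])
    moreover have "(\<integral>\<^sup>+z. ennreal ((cmod (fourier (\<lambda>q. indicator (ball 0 (real n)) q * u q) z - g z))\<^sup>2) \<partial>lebesgue)
      = (\<integral>\<^sup>+z. ennreal ((cmod (T n z - h z))\<^sup>2) \<partial>lborel)" for n
    proof -
      have "(\<integral>\<^sup>+z. ennreal ((cmod (fourier (\<lambda>q. indicator (ball 0 (real n)) q * u q) z - g z))\<^sup>2) \<partial>lebesgue)
        = (\<integral>\<^sup>+z. ennreal ((cmod (T n z - h z))\<^sup>2) \<partial>lebesgue)"
      proof (rule nn_integral_cong_AE)
        have F: "fourier (\<lambda>q. indicator (ball 0 (real n)) q * u q) z = T n z" for z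
          by (simp only: T1 fw)
        show "AE z in lebesgue. ennreal ((cmod (fourier (\<lambda>q. indicator (ball 0 (real n)) q * u q) z - g z))\<^sup>2) = ennreal ((cmod (T n z - h z))\<^sup>2)"
        proof (rule AE_mp[OF gh], intro AE_I2 impI)
          fix z assume gz: "g z = h z"
          show "ennreal ((cmod (fourier (\<lambda>q. indicator (ball 0 (real n)) q * u q) z - g z))\<^sup>2) = ennreal ((cmod (T n z - h z))\<^sup>2)"
            unfolding F gz ..
        qed
      qed
      also have "\<dots> = (\<integral>\<^sup>+z. ennreal ((cmod (T n z - h z))\<^sup>2) \<partial>lborel)"
        by (rule nn_integral_completion)
      finally show ?thesis .
    qed
    ultimately show ?thesis by simp
  qed
  have "conv (gauss e) w p = (LINT z|lborel. exp (- pi * e * (norm z)\<^sup>2) *\<^sub>R (wave p z * h z))"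
    if e: "e > 0" for e p
  proof (rule LIMSEQ_unique)
    let ?G = "\<lambda>z::(real ^ 'n) \<times> real. exp (- pi * e * (norm z)\<^sup>2)"
    have Gi: "integrable lborel ?G" using gaussian_integral(1)[OF e] .
    \<comment> \<open>Inserting the Fourier integral \<open>T n\<close> and exchanging the integrals
      leaves the Gaussian integral of \<open>wave (p - q)\<close>, which is
      \<open>gauss e (p - q)\<close>.\<close>
    have trunc: "(LINT z|lborel. ?G z *\<^sub>R (wave p z * T n z)) = (LINT r|lborel. gauss e r *\<^sub>R (indicator (B n) (p - r) *\<^sub>R w (p - r)))" for n
    proof -
      have int: "integrable (lborel \<Otimes>\<^sub>M lborel) (\<lambda>(z, q). (?G z *\<^sub>R wave (p - q) z) * (indicator (B n) q *\<^sub>R w q))"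
      proof (rule lborel_pair.Fubini_integrable)
        have "integrable lborel (\<lambda>z. ?G z * (LINT q|lborel. cmod (indicator (B n) q *\<^sub>R w q)))"
          using Gi by simp
        show "integrable lborel (\<lambda>z. LINT q|lborel. norm (case (z, q) of (z, q) \<Rightarrow> (?G z *\<^sub>R wave (p - q) z) * (indicator (B n) q *\<^sub>R w q)))"
        proof -
          have "(LINT q|lborel. norm (case (z, q) of (z, q) \<Rightarrow> (?G z *\<^sub>R wave (p - q) z) * (indicator (B n) q *\<^sub>R w q)))
              = ?G z * (LINT q|lborel. cmod (indicator (B n) q *\<^sub>R w q))" for z
            unfolding integral_mult_right_zero[symmetric] by (intro Bochner_Integration.integral_cong refl) (simp add: norm_mult)
          then show ?thesis using \<open>integrable lborel (\<lambda>z. ?G z * (LINT q|lborel. cmod (indicator (B n) q *\<^sub>R w q)))\<close> by (simp only:)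
        qed
        show "AE z in lborel. integrable lborel (\<lambda>q. case (z, q) of (z, q) \<Rightarrow> (?G z *\<^sub>R wave (p - q) z) * (indicator (B n) q *\<^sub>R w q))"
        proof (intro AE_I2)
          fix z
          show "integrable lborel (\<lambda>q. case (z, q) of (z, q) \<Rightarrow> (?G z *\<^sub>R wave (p - q) z) * (indicator (B n) q *\<^sub>R w q))"
            unfolding prod.case
          proof (rule Bochner_Integration.integrable_bound)
            show "integrable lborel (\<lambda>q. ?G z *\<^sub>R (indicator (B n) q *\<^sub>R w q))"
              by (intro integrable_scaleR_right wB)
            show "(\<lambda>q. (?G z *\<^sub>R wave (p - q) z) * (indicator (B n) q *\<^sub>R w q)) \<in> borel_measurable lborel"
              by measurable
            show "AE q in lborel. norm ((?G z *\<^sub>R wave (p - q) z) * (indicator (B n) q *\<^sub>R w q)) \<le> norm (?G z *\<^sub>R (indicator (B n) q *\<^sub>R w q))"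
              by (intro AE_I2) (simp add: norm_mult)
          qed
        qed
      qed measurable
      have "(LINT z|lborel. ?G z *\<^sub>R (wave p z * T n z)) = (LINT z|lborel. LINT q|lborel. (?G z *\<^sub>R wave (p - q) z) * (indicator (B n) q *\<^sub>R w q))"
      proof (rule Bochner_Integration.integral_cong[OF refl])
        fix z
        have "?G z *\<^sub>R (wave p z * T n z) = (LINT q|lborel. (?G z *\<^sub>R wave p z) * (indicator (B n) q *\<^sub>R (wave (- q) z * w q)))"
          unfolding T_def integral_mult_right_zero by simp
        also have "\<dots> = (LINT q|lborel. (?G z *\<^sub>R wave (p - q) z) * (indicator (B n) q *\<^sub>R w q))"
          by (simp add: wave_diff mult_ac)
        finally show "?G z *\<^sub>R (wave p z * T n z) = (LINT q|lborel. (?G z *\<^sub>R wave (p - q) z) * (indicator (B n) q *\<^sub>R w q))" .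
      qed
      also have "\<dots> = (LINT q|lborel. LINT z|lborel. (?G z *\<^sub>R wave (p - q) z) * (indicator (B n) q *\<^sub>R w q))"
        by (rule lborel_pair.Fubini_integral[OF int, symmetric])
      also have "\<dots> = (LINT q|lborel. gauss e (p - q) *\<^sub>R (indicator (B n) q *\<^sub>R w q))"
        unfolding integral_mult_left_zero integral_gaussian_wave(2)[OF e] by (simp add: scaleR_conv_of_real)
      also have "\<dots> = (LINT r|lborel. gauss e r *\<^sub>R (indicator (B n) (p - r) *\<^sub>R w (p - r)))"
        using integral_lborel_reflect[of "\<lambda>q. gauss e (p - q) *\<^sub>R (indicator (B n) q *\<^sub>R w q)" p] by simp
      finally show ?thesis .
    qed
    show "(\<lambda>n. LINT z|lborel. ?G z *\<^sub>R (wave p z * T n z)) \<longlonglongrightarrow> conv (gauss e) w p"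
      unfolding trunc conv_def
    proof (rule integral_dominated_convergence[where w="\<lambda>r. norm (gauss e r *\<^sub>R w (p - r))"])
      show "integrable lborel (\<lambda>r. norm (gauss e r *\<^sub>R w (p - r)))"
        by (intro integrable_norm integrable_conv_gauss w e)
      show "AE r in lborel. (\<lambda>n. gauss e r *\<^sub>R (indicator (B n) (p - r) *\<^sub>R w (p - r))) \<longlonglongrightarrow> gauss e r *\<^sub>R w (p - r)"
      proof (intro AE_I2 tendsto_eventually)
        fix r
        obtain N :: nat where N: "norm (p - r) < real N" using reals_Archimedean2[of "norm (p - r)"] by (rule exE)
        show "\<forall>\<^sub>F n in sequentially. gauss e r *\<^sub>R (indicator (B n) (p - r) *\<^sub>R w (p - r)) = gauss e r *\<^sub>R w (p - r)"
          using eventually_ge_at_top[of N]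
        proof eventually_elim
          case (elim n)
          then have "p - r \<in> B n" using N by (simp add: B_def)
          then show ?case by simp
        qed
      qed
      show "AE r in lborel. norm (gauss e r *\<^sub>R (indicator (B n) (p - r) *\<^sub>R w (p - r))) \<le> norm (gauss e r *\<^sub>R w (p - r))" for n
        by (intro AE_I2) (auto simp: indicator_def)
    qed measurable
    show "(\<lambda>n. LINT z|lborel. ?G z *\<^sub>R (wave p z * T n z)) \<longlonglongrightarrow> (LINT z|lborel. ?G z *\<^sub>R (wave p z * h z))"
    proof -
      have v: "sq_int (\<lambda>z. ?G z *\<^sub>R wave p z)"
        using integrable_gaussian_sq[OF e, where 'a="(real ^ 'n) \<times> real"] by (simp add: sq_int_def norm_mult)
      have "integrable lborel (\<lambda>z. (?G z *\<^sub>R wave p z) * T n z)" for n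
      proof (rule Bochner_Integration.integrable_bound)
        show "integrable lborel (\<lambda>z. ?G z * (LINT q|lborel. cmod (indicator (B n) q *\<^sub>R w q)))"
          using Gi by simp
        show "AE z in lborel. norm ((?G z *\<^sub>R wave p z) * T n z) \<le> norm (?G z * (LINT q|lborel. cmod (indicator (B n) q *\<^sub>R w q)))"
        proof (intro AE_I2)
          fix z
          have "cmod (T n z) \<le> (LINT q|lborel. cmod (indicator (B n) q *\<^sub>R (wave (- q) z * w q)))"
            unfolding T_def by (rule integral_norm_bound)
          also have "\<dots> = (LINT q|lborel. cmod (indicator (B n) q *\<^sub>R w q))" by (simp add: norm_mult)
          finally have "cmod (T n z) \<le> (LINT q|lborel. cmod (indicator (B n) q *\<^sub>R w q))" .
          then have "?G z * cmod (T n z) \<le> ?G z * (LINT q|lborel. cmod (indicator (B n) q *\<^sub>R w q))"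
            by (rule mult_left_mono) simp
          also have "\<dots> \<le> norm (?G z * (LINT q|lborel. cmod (indicator (B n) q *\<^sub>R w q)))" by simp
          finally show "norm ((?G z *\<^sub>R wave p z) * T n z) \<le> norm (?G z * (LINT q|lborel. cmod (indicator (B n) q *\<^sub>R w q)))"
            by (simp only: norm_mult norm_scaleR norm_wave abs_exp_cancel mult_1_right)
        qed
      qed measurable
      from tendsto_integral_mult_L2[OF v h _ this lim0]
      show ?thesis by simp
    qed
  qed
  with w h show ?thesis by (simp add: spectral_def)
qed

section \<open>Laplace transforms\<close>

definition laplace :: "(real \<Rightarrow> real) \<Rightarrow> complex \<Rightarrow> complex" where
  "laplace \<phi> m = (LINT \<tau>:{0<..}|lborel. \<phi> \<tau> *\<^sub>R exp (- (complex_of_real \<tau> * m)))"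

lemma set_integrable_mult_bounded:
  fixes f :: "'a \<Rightarrow> real" and g :: "'a \<Rightarrow> 'b::{banach, second_countable_topology}"
  assumes f: "set_integrable M A f" and g: "g \<in> borel_measurable M"
    and b: "\<And>x. x \<in> A \<Longrightarrow> x \<in> space M \<Longrightarrow> norm (g x) \<le> B"
  shows "set_integrable M A (\<lambda>x. f x *\<^sub>R g x)"
proof -
  have f': "integrable M (\<lambda>x. indicator A x *\<^sub>R f x)" using f by (simp add: set_integrable_def)
  have "integrable M (\<lambda>x. (indicator A x *\<^sub>R f x) *\<^sub>R g x)"
  proof (rule Bochner_Integration.integrable_bound)
    show "integrable M (\<lambda>x. (indicator A x *\<^sub>R f x) * B)" using f' by (rule integrable_mult_left)
    show "(\<lambda>x. (indicator A x *\<^sub>R f x) *\<^sub>R g x) \<in> borel_measurable M"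
      by (rule borel_measurable_scaleR[OF borel_measurable_integrable[OF f'] g])
    show "AE x in M. norm ((indicator A x *\<^sub>R f x) *\<^sub>R g x) \<le> norm ((indicator A x *\<^sub>R f x) * B)"
    proof (rule AE_I2)
      fix x assume "x \<in> space M"
      then show "norm ((indicator A x *\<^sub>R f x) *\<^sub>R g x) \<le> norm ((indicator A x *\<^sub>R f x) * B)"
        using b[of x] by (cases "x \<in> A") (auto simp: abs_mult intro!: mult_left_mono)
    qed
  qed
  then show ?thesis by (simp add: set_integrable_def)
qed

lemma set_integrable_laplace:
  assumes "set_integrable lborel {0<..} \<phi>" "Re m \<ge> 0"
  shows "set_integrable lborel {0<..} (\<lambda>\<tau>. \<phi> \<tau> *\<^sub>R exp (- (complex_of_real \<tau> * m)))"
  using assms by (intro set_integrable_mult_bounded[where B=1]) auto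

text \<open>The integral is differentiated as a function of a point of the plane; the resulting real
  derivative is complex linear.\<close>

lemma laplace_holomorphic:
  assumes \<phi>: "set_integrable lborel {0<..} \<phi>"
  shows "laplace \<phi> holomorphic_on {m. Re m > 0}"
proof (rule holomorphic_onI)
  fix m assume "m \<in> {m. Re m > 0}"
  then have m: "Re m > 0" by simp
  \<comment> \<open>On this half-plane the factor \<open>\<tau>\<close> that differentiation
    produces is absorbed: \<open>\<tau> * exp (- (\<tau> * Re z)) \<le> 2 / Re m\<close>.\<close>
  define S where "S = {z. Re z > Re m / 2}"
  define f where "f = (\<lambda>z \<tau>. indicator {0<..} \<tau> *\<^sub>R (\<phi> \<tau> *\<^sub>R exp (- (complex_of_real \<tau> * z))))"
  define D where "D = (\<lambda>z \<tau> h. indicator {0<..} \<tau> *\<^sub>R (\<phi> \<tau> *\<^sub>R (- (complex_of_real \<tau> * h) * exp (- (complex_of_real \<tau> * z)))))"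
  have ip: "integrable lborel (\<lambda>\<tau>. indicator {0<..} \<tau> *\<^sub>R \<phi> \<tau>)" using \<phi> by (simp add: set_integrable_def)
  have [measurable]: "(\<lambda>\<tau>. indicator {0<..} \<tau> *\<^sub>R \<phi> \<tau>) \<in> borel_measurable borel"
    using borel_measurable_integrable[OF ip] by simp
  have d1: "((\<lambda>z. LINT \<tau>|lborel. f z \<tau>) has_derivative (\<lambda>h. LINT \<tau>|lborel. D m \<tau> h)) (at m)"
  proof (rule has_derivative_lebesgue_integral(1)[where S=S and D=D and g="\<lambda>\<tau>. norm (indicator {0<..} \<tau> *\<^sub>R \<phi> \<tau>) * (2 / Re m)"])
    show "open S" unfolding S_def by (rule open_halfspace_Re_gt)
    show "convex S" unfolding S_def by (rule convex_halfspace_Re_gt)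
    show "m \<in> S" using m by (simp add: S_def)
    show "integrable lborel (f z)" if "z \<in> S" for z
      using set_integrable_laplace[OF \<phi>, of z] that m by (simp add: set_integrable_def f_def S_def)
    show "((\<lambda>z. f z r) has_derivative D z r) (at z)" for z r
    proof -
      have "((\<lambda>z. exp (- (complex_of_real r * z))) has_field_derivative (- complex_of_real r * exp (- (complex_of_real r * z)))) (at z)"
        by (auto intro!: derivative_eq_intros)
      then have "((\<lambda>z. exp (- (complex_of_real r * z))) has_derivative (\<lambda>h. - (complex_of_real r * h) * exp (- (complex_of_real r * z)))) (at z)"
        by (rule has_derivative_eq_rhs[OF has_field_derivative_imp_has_derivative]) (simp add: fun_eq_iff mult_ac)
      then show ?thesis unfolding f_def D_def by (intro has_derivative_scaleR_right)
    qed
    show "(\<lambda>r. D m r h) \<in> borel_measurable lborel" for h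
    proof -
      have "(\<lambda>r. D m r h) = (\<lambda>r. (indicator {0<..} r *\<^sub>R \<phi> r) *\<^sub>R (- (complex_of_real r * h) * exp (- (complex_of_real r * m))))"
        by (simp add: D_def)
      moreover have "(\<lambda>r. (indicator {0<..} r *\<^sub>R \<phi> r) *\<^sub>R (- (complex_of_real r * h) * exp (- (complex_of_real r * m)))) \<in> borel_measurable lborel"
        by (rule borel_measurable_scaleR[OF borel_measurable_integrable[OF ip]]) measurable
      ultimately show ?thesis by (simp only:)
    qed
    show "integrable lborel (\<lambda>\<tau>. norm (indicator {0<..} \<tau> *\<^sub>R \<phi> \<tau>) * (2 / Re m))"
      by (intro integrable_mult_left integrable_norm ip)
    fix z h :: complex and r :: real assume z: "z \<in> S"
    show "norm (D z r h) \<le> norm (indicator {0<..} r *\<^sub>R \<phi> r) * (2 / Re m) * norm h"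
    proof (cases "r > 0")
      case True
      have "r * (Re m / 2) \<le> exp (r * (Re m / 2))" using exp_ge_add_one_self[of "r * (Re m / 2)"] by linarith
      also have "\<dots> \<le> exp (r * Re z)" using z mult_left_mono[of "Re m / 2" "Re z" r] True by (simp add: S_def)
      finally have "r * exp (- (r * Re z)) \<le> 2 / Re m" using m by (simp add: exp_minus field_simps)
      then have "\<bar>\<phi> r\<bar> * norm h * (r * exp (- (r * Re z))) \<le> \<bar>\<phi> r\<bar> * norm h * (2 / Re m)"
        by (rule mult_left_mono) simp
      then show ?thesis using True by (simp add: D_def norm_mult mult_ac)
    qed (simp add: D_def)
  qed
  \<comment> \<open>The derivative is multiplication by a complex number, hence a field
    derivative.\<close>
  have d2: "(LINT \<tau>|lborel. D m \<tau> h) = (LINT \<tau>|lborel. D m \<tau> 1) * h" for h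
  proof -
    have "D m \<tau> h = D m \<tau> 1 * h" for \<tau> by (simp add: D_def scaleR_conv_of_real)
    then have "(LINT \<tau>|lborel. D m \<tau> h) = (LINT \<tau>|lborel. D m \<tau> 1 * h)" by (intro Bochner_Integration.integral_cong refl)
    also have "\<dots> = (LINT \<tau>|lborel. D m \<tau> 1) * h" by (rule integral_mult_left_zero)
    finally show ?thesis .
  qed
  have d3: "laplace \<phi> = (\<lambda>z. LINT \<tau>|lborel. f z \<tau>)"
    unfolding laplace_def f_def set_lebesgue_integral_def by (rule refl)
  have "(\<lambda>h. LINT \<tau>|lborel. D m \<tau> h) = (\<lambda>h. (LINT \<tau>|lborel. D m \<tau> 1) * h)"
    by (rule ext) (rule d2)
  from d1[unfolded this] have "(laplace \<phi> has_derivative (\<lambda>h. (LINT \<tau>|lborel. D m \<tau> 1) * h)) (at m)"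
    unfolding d3 .
  then have "(laplace \<phi> has_field_derivative (LINT \<tau>|lborel. D m \<tau> 1)) (at m)"
    unfolding has_field_derivative_def .
  then have "laplace \<phi> field_differentiable at m" unfolding field_differentiable_def ..
  then show "laplace \<phi> field_differentiable (at m within {m. Re m > 0})"
    by (rule field_differentiable_at_within)
qed

text \<open>Both sides are holomorphic on the connected half-plane and agree on the positive reals,
  which accumulate at 1; the identity theorem does the rest. This reduces every symbol identity to a
  real integral.\<close>

lemma laplace_eqI:
  assumes \<phi>: "set_integrable lborel {0<..} \<phi>"
    and f: "f holomorphic_on {m. Re m > 0}"
    and eq: "\<And>r. r > 0 \<Longrightarrow> laplace \<phi> (complex_of_real r) = f (complex_of_real r)"
    and m: "Re m > 0"
  shows "laplace \<phi> m = f m"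
proof -
  let ?S = "{m. Re m > 0}"
  have "laplace \<phi> m - f m = 0"
  proof (rule analytic_continuation[where f="\<lambda>m. laplace \<phi> m - f m" and S="?S" and U="complex_of_real ` {0<..}" and \<xi>=1])
    show "(\<lambda>m. laplace \<phi> m - f m) holomorphic_on ?S"
      by (intro holomorphic_intros laplace_holomorphic \<phi> f)
    show "open ?S" by (rule open_halfspace_Re_gt)
    show "connected ?S" by (intro convex_connected convex_halfspace_Re_gt)
    show "1 islimpt complex_of_real ` {0<..}"
    proof -
      have "(1::real) islimpt {0<..}" by (intro open_imp_islimpt) auto
      then have "\<exists>f. (\<forall>n. f n \<in> {0<..} - {1::real}) \<and> f \<longlonglongrightarrow> 1" by (simp add: islimpt_sequential)
      then obtain g where g: "\<And>n. g n \<in> {0<..} - {1::real}" "g \<longlonglongrightarrow> 1" by blast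
      have "(\<lambda>n. complex_of_real (g n)) \<longlonglongrightarrow> complex_of_real 1" by (rule tendsto_of_real[OF g(2)])
      then show ?thesis unfolding islimpt_sequential
        using g(1) by (intro exI[of _ "\<lambda>n. complex_of_real (g n)"]) auto
    qed
  qed (use eq m in auto)
  then show ?thesis by simp
qed

section \<open>Integrals of Gamma and Bessel type\<close>

text \<open>Euler's integral after the substitution \<open>t = c * \<tau>\<close>; the half-lines
  with and without 0 differ by a null set.\<close>

lemma set_integrable_powr_exp:
  fixes a c :: real assumes a: "a > 0" and c: "c > 0"
  shows "set_integrable lborel {0<..} (\<lambda>\<tau>. \<tau> powr (a - 1) * exp (- (c * \<tau>)))"
    and "(LINT \<tau>:{0<..}|lborel. \<tau> powr (a - 1) * exp (- (c * \<tau>))) = Gamma a * c powr (- a)"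
proof -
  let ?g = "\<lambda>t::real. indicator {0<..} t * (t powr (a - 1) * exp (- t))"
  have hb: "has_bochner_integral lborel ?g (Gamma a)"
  proof (rule has_bochner_integral_nn_integral)
    have "(\<integral>\<^sup>+t. ennreal (?g t) \<partial>lborel) = (\<integral>\<^sup>+t. ennreal (indicator {0..} t * t powr (a - 1) / exp t) \<partial>lborel)"
    proof (rule nn_integral_cong_AE)
      have "AE t in lborel. t \<noteq> (0::real)" by (rule AE_lborel_singleton)
      then show "AE t in lborel. ennreal (?g t) = ennreal (indicator {0..} t * t powr (a - 1) / exp t)"
        by eventually_elim (auto simp: indicator_def exp_minus field_simps)
    qed
    then show "(\<integral>\<^sup>+t. ennreal (?g t) \<partial>lborel) = ennreal (Gamma a)"
      using Gamma_conv_nn_integral_real[OF a] by simp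
  qed (use a in auto)
  have gc: "indicator {0<..} \<tau> *\<^sub>R (\<tau> powr (a - 1) * exp (- (c * \<tau>))) = c powr (1 - a) * ?g (0 + c * \<tau>)" for \<tau>
  proof (cases "\<tau> > 0")
    case True
    then have "(c * \<tau>) powr (a - 1) = c powr (a - 1) * \<tau> powr (a - 1)" using c by (simp add: powr_mult)
    moreover have "c powr (1 - a) * c powr (a - 1) = 1" using c by (simp flip: powr_add)
    ultimately show ?thesis using True c by (simp add: mult.assoc[symmetric])
  qed (use c in \<open>auto simp: zero_less_mult_iff\<close>)
  have i: "integrable lborel (\<lambda>\<tau>. ?g (0 + c * \<tau>))"
    by (intro lborel_integrable_real_affine) (use hb c in \<open>auto simp: has_bochner_integral_iff\<close>)
  show "set_integrable lborel {0<..} (\<lambda>\<tau>. \<tau> powr (a - 1) * exp (- (c * \<tau>)))"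
    unfolding set_integrable_def gc using i by (rule integrable_mult_right)
  have "Gamma a = (LINT t|lborel. ?g t)" using hb by (simp add: has_bochner_integral_iff)
  also have "\<dots> = c * (LINT \<tau>|lborel. ?g (0 + c * \<tau>))"
    using lborel_integral_real_affine[of c ?g 0] c by simp
  finally have "(LINT \<tau>|lborel. ?g (0 + c * \<tau>)) = Gamma a / c" using c by (simp add: field_simps)
  then have "(LINT \<tau>:{0<..}|lborel. \<tau> powr (a - 1) * exp (- (c * \<tau>))) = c powr (1 - a) * (Gamma a / c)"
    unfolding set_lebesgue_integral_def gc integral_mult_right_zero by simp
  also have "\<dots> = Gamma a * c powr (- a)" using c by (simp add: powr_diff powr_minus field_simps)
  finally show "(LINT \<tau>:{0<..}|lborel. \<tau> powr (a - 1) * exp (- (c * \<tau>))) = Gamma a * c powr (- a)" .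
qed

lemma powr_le_exp:
  fixes x q :: real assumes "x \<ge> 0" "q > 0" shows "x powr q \<le> q powr q * exp x"
proof -
  have "x / q \<le> exp (x / q)" using exp_ge_add_one_self[of "x / q"] by linarith
  then have "(x / q) powr q \<le> exp (x / q) powr q" using assms by (intro powr_mono2) auto
  also have "\<dots> = exp x" using assms by (simp add: powr_def)
  finally show ?thesis using assms by (simp add: powr_divide field_simps)
qed

text \<open>This factor beats every negative power of \<open>\<tau>\<close> at 0; \<open>q\<close>
  stays free to be adapted to the power that has to be absorbed.\<close>

lemma exp_inverse_le_powr:
  fixes b q \<tau> :: real assumes "b > 0" "q > 0" "\<tau> > 0"
  shows "exp (- (b / \<tau>)) \<le> (q / b) powr q * \<tau> powr q"
proof -
  have "(b / \<tau>) powr q \<le> q powr q * exp (b / \<tau>)" using assms by (intro powr_le_exp) auto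
  then show ?thesis using assms by (simp add: powr_divide exp_minus field_simps)
qed

lemma set_integrable_bessel:
  fixes b m p :: real assumes b: "b > 0" and m: "m > 0"
  shows "set_integrable lborel {0<..} (\<lambda>\<tau>. \<tau> powr p * exp (- (b / \<tau> + m * \<tau>)))"
proof -
  \<comment> \<open>Positive as \<open>exp_inverse_le_powr\<close> demands, and large enough that
    \<open>p + q + 1\<close> is an admissible argument of Gamma.\<close>
  define q where "q = \<bar>p\<bar> + 1"
  have q: "q > 0" "p + q + 1 > 0" by (auto simp: q_def)
  have "set_integrable lborel {0<..} (\<lambda>\<tau>. (q / b) powr q * (\<tau> powr (p + q + 1 - 1) * exp (- (m * \<tau>))))"
    by (intro set_integrable_mult_right set_integrable_powr_exp q m)
  then show ?thesis
  proof (rule set_integrable_bound)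
    show "set_borel_measurable lborel {0<..} (\<lambda>\<tau>. \<tau> powr p * exp (- (b / \<tau> + m * \<tau>)))"
      unfolding set_borel_measurable_def by measurable
    show "AE \<tau> in lborel. \<tau> \<in> {0<..} \<longrightarrow> norm (\<tau> powr p * exp (- (b / \<tau> + m * \<tau>))) \<le> norm ((q / b) powr q * (\<tau> powr (p + q + 1 - 1) * exp (- (m * \<tau>))))"
    proof (intro AE_I2 impI)
      fix \<tau> :: real assume "\<tau> \<in> {0<..}"
      then have t: "\<tau> > 0" by simp
      have "\<tau> powr p * exp (- (m * \<tau>)) * exp (- (b / \<tau>)) \<le> \<tau> powr p * exp (- (m * \<tau>)) * ((q / b) powr q * \<tau> powr q)"
        by (rule mult_left_mono[OF exp_inverse_le_powr[OF b q(1) t]]) simp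
      then show "norm (\<tau> powr p * exp (- (b / \<tau> + m * \<tau>))) \<le> norm ((q / b) powr q * (\<tau> powr (p + q + 1 - 1) * exp (- (m * \<tau>))))"
      proof -
        have "exp (- (b / \<tau> + m * \<tau>)) = exp (- (m * \<tau>)) * exp (- (b / \<tau>))" by (simp flip: exp_add)
        then show ?thesis using \<open>\<tau> powr p * exp (- (m * \<tau>)) * exp (- (b / \<tau>)) \<le> _\<close> by (simp add: powr_add mult_ac)
      qed
    qed
  qed
qed

lemma set_integrable_powr_tail:
  fixes p :: real assumes p: "p < - 1"
  shows "set_integrable lborel {1..} (\<lambda>\<tau>. \<tau> powr p)"
proof -
  have "((\<lambda>\<tau>. \<tau> powr p) has_integral -(1 powr (p + 1)) / (p + 1)) {1..}"
    using has_integral_powr_to_inf[of p 1] p by simp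
  then have "(\<lambda>\<tau>::real. \<tau> powr p) absolutely_integrable_on {1..}"
    by (intro nonnegative_absolutely_integrable_1) auto
  then show ?thesis unfolding set_integrable_def
    by (subst (asm) integrable_lebesgue_iff_lborel) auto
qed

text \<open>The exponential controls the origin, where \<open>C\<close> bounds the integrand up to
  1, and \<open>p < - 1\<close> controls the tail. This is the limit case \<open>m = 0\<close> of
  the previous integrals, needed for the Poisson and conormal densities.\<close>

lemma set_integrable_powr_exp_inverse:
  fixes b p :: real assumes b: "b > 0" and p: "p < - 1"
  shows "set_integrable lborel {0<..} (\<lambda>\<tau>. \<tau> powr p * exp (- (b / \<tau>)))"
proof -
  define C where "C = (- p / b) powr (- p)"
  have "integrable lborel (\<lambda>\<tau>. indicator {0..1::real} \<tau> * C)"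
    by (intro integrable_mult_left integrable_real_indicator) auto
  then have "integrable lborel (\<lambda>\<tau>. indicator {0..1} \<tau> * C + indicator {1..} \<tau> * \<tau> powr p :: real)"
    using set_integrable_powr_tail[OF p] by (auto simp: set_integrable_def)
  then have "integrable lborel (\<lambda>\<tau>. indicator {0<..} \<tau> *\<^sub>R (\<tau> powr p * exp (- (b / \<tau>))))"
  proof (rule Bochner_Integration.integrable_bound)
    show "AE \<tau> in lborel. norm (indicator {0<..} \<tau> *\<^sub>R (\<tau> powr p * exp (- (b / \<tau>)))) \<le> norm (indicator {0..1} \<tau> * C + indicator {1..} \<tau> * \<tau> powr p :: real)"
    proof (intro AE_I2)
      fix \<tau> :: real
      have "0 \<le> C" by (simp add: C_def)
      show "norm (indicator {0<..} \<tau> *\<^sub>R (\<tau> powr p * exp (- (b / \<tau>)))) \<le> norm (indicator {0..1} \<tau> * C + indicator {1..} \<tau> * \<tau> powr p :: real)"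
      proof (cases "\<tau> > 0")
        case True
        show ?thesis
        proof (cases "\<tau> < 1")
          case less: True
          have "\<tau> powr p * exp (- (b / \<tau>)) \<le> \<tau> powr p * (C * \<tau> powr (- p))"
            unfolding C_def using exp_inverse_le_powr[of b "- p" \<tau>] b p True by (intro mult_left_mono) auto
          also have "\<dots> = C" using True by (simp flip: powr_add)
          finally show ?thesis using True less \<open>0 \<le> C\<close> by simp
        next
          case False
          have "\<tau> powr p * exp (- (b / \<tau>)) \<le> \<tau> powr p * 1" using True b by (intro mult_left_mono) auto
          also have "\<dots> \<le> indicator {0..1} \<tau> * C + indicator {1..} \<tau> * \<tau> powr p"
            using False \<open>0 \<le> C\<close> by (auto simp: indicator_def)
          finally show ?thesis using True by simp
        qed
      qed simp
    qed
  qed measurable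
  then show ?thesis by (simp add: set_integrable_def)
qed

lemma laplace_of_real:
  "laplace \<phi> (complex_of_real m) = complex_of_real (LINT \<tau>:{0<..}|lborel. \<phi> \<tau> * exp (- (m * \<tau>)))"
proof -
  have eq: "indicator {0<..} \<tau> *\<^sub>R (\<phi> \<tau> *\<^sub>R exp (- (complex_of_real \<tau> * complex_of_real m)))
      = complex_of_real (indicator {0<..} \<tau> *\<^sub>R (\<phi> \<tau> * exp (- (m * \<tau>))))" for \<tau>
  proof -
    have "exp (- (complex_of_real \<tau> * complex_of_real m)) = complex_of_real (exp (- (m * \<tau>)))"
      by (simp add: exp_of_real[symmetric] mult.commute)
    then show ?thesis by (simp add: scaleR_conv_of_real)
  qed
  show ?thesis unfolding laplace_def set_lebesgue_integral_def by (simp only: eq integral_complex_of_real)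
qed

section \<open>Densities of the Bessel potential and of its defect\<close>

text \<open>The Gamma distribution of shape \<open>s\<close>; averaging heat kernels against it
  gives the parabolic Bessel potential.\<close>

definition bessel_density :: "real \<Rightarrow> real \<Rightarrow> real" where
  "bessel_density s \<tau> = \<tau> powr (s - 1) * exp (- \<tau>) / Gamma s"

lemma bessel_density_integrable:
  assumes "s > 0" shows "set_integrable lborel {0<..} (bessel_density s)"
  using set_integrable_powr_exp(1)[OF assms, of 1] unfolding bessel_density_def
  by (intro set_integrable_divide) simp

lemma laplace_bessel_density:
  assumes s: "s > 0" and m: "Re m > 0"
  shows "laplace (bessel_density s) m = (1 + m) powr (- complex_of_real s)"
proof (rule laplace_eqI[OF bessel_density_integrable[OF s] _ _ m])
  show "(\<lambda>m. (1 + m) powr (- complex_of_real s)) holomorphic_on {m. Re m > 0}"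
  proof (intro holomorphic_intros)
    fix z assume "z \<in> {m. Re m > 0}"
    then show "1 + z \<notin> \<real>\<^sub>\<le>\<^sub>0" by (auto simp: complex_nonpos_Reals_iff)
  qed
  fix r :: real assume r: "r > 0"
  have "bessel_density s \<tau> * exp (- (r * \<tau>)) = (\<tau> powr (s - 1) * exp (- ((1 + r) * \<tau>))) / Gamma s" for \<tau>
  proof -
    have "exp (- \<tau>) * exp (- (r * \<tau>)) = exp (- ((1 + r) * \<tau>))" by (simp add: algebra_simps flip: exp_add)
    then show ?thesis by (simp add: bessel_density_def mult.assoc)
  qed
  then have "(LINT \<tau>:{0<..}|lborel. bessel_density s \<tau> * exp (- (r * \<tau>))) = (LINT \<tau>:{0<..}|lborel. (\<tau> powr (s - 1) * exp (- ((1 + r) * \<tau>))) / Gamma s)"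
    by simp
  also have "\<dots> = (1 + r) powr (- s)"
    unfolding set_integral_divide_zero using set_integrable_powr_exp(2)[OF s, of "1 + r"] r s
    by (simp add: Gamma_eq_zero_iff nonpos_Ints_def)
  finally show "laplace (bessel_density s) (complex_of_real r) = (1 + complex_of_real r) powr (- complex_of_real s)"
    using r powr_of_real[of "1 + r" "- s"] by (simp add: laplace_of_real)
qed

text \<open>Difference of the Levy-Khinchine formulas for \<open>(1 + m) powr s\<close> and
  \<open>m powr s\<close>, in which \<open>m powr s\<close> is \<open>s / Gamma (1 - s)\<close>
  times the integral of \<open>(1 - exp (- (m * \<tau>))) * \<tau> powr (- 1 - s)\<close>. The
  factor \<open>1 - exp (- \<tau>)\<close> makes the singularity at 0 integrable.\<close>

definition defect_density :: "real \<Rightarrow> real \<Rightarrow> real" where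
  "defect_density s \<tau> = s / Gamma (1 - s) * ((1 - exp (- \<tau>)) * \<tau> powr (- 1 - s))"

lemma defect_density_nonneg: "0 < s \<Longrightarrow> s < 1 \<Longrightarrow> 0 < \<tau> \<Longrightarrow> 0 \<le> defect_density s \<tau>"
  by (auto simp: defect_density_def intro!: mult_nonneg_nonneg divide_nonneg_nonneg Gamma_real_nonneg)

text \<open>The right-hand side is the integral of \<open>s * (r + \<theta>) powr (s - 1)\<close>
  over the unit interval. Writing this power as a Gamma integral and integrating first in
  \<open>\<theta>\<close> produces the density.\<close>

lemma laplace_defect_density_real:
  assumes s: "0 < s" "s < 1" and r: "r > 0"
  shows "(LINT \<tau>:{0<..}|lborel. defect_density s \<tau> * exp (- (r * \<tau>))) = (1 + r) powr s - r powr s"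
proof -
  define c where "c = s / Gamma (1 - s)"
  have G: "Gamma (1 - s) > 0" using s by (intro Gamma_real_pos) simp
  have c: "c > 0" using s G by (simp add: c_def)
  let ?I = "{0..1::real}"
  let ?f = "\<lambda>\<theta> \<tau>::real. indicator ?I \<theta> * (indicator {0<..} \<tau> * (c * (\<tau> powr (- s) * exp (- ((r + \<theta>) * \<tau>)))))"
  have inner1: "(\<integral>\<^sup>+\<tau>. ennreal (?f \<theta> \<tau>) \<partial>lborel) = ennreal (s * (r + \<theta>) powr (s - 1)) * indicator ?I \<theta>" for \<theta>
  proof (cases "\<theta> \<in> ?I")
    case True
    then have p: "r + \<theta> > 0" using r by simp
    have i: "set_integrable lborel {0<..} (\<lambda>\<tau>. c * (\<tau> powr (1 - s - 1) * exp (- ((r + \<theta>) * \<tau>))))"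
      by (intro set_integrable_mult_right set_integrable_powr_exp) (use s p in auto)
    have "(\<integral>\<^sup>+\<tau>. ennreal (?f \<theta> \<tau>) \<partial>lborel) = (\<integral>\<^sup>+\<tau>. ennreal (indicator {0<..} \<tau> *\<^sub>R (c * (\<tau> powr (1 - s - 1) * exp (- ((r + \<theta>) * \<tau>))))) \<partial>lborel)"
      using True by (simp add: mult.commute)
    also have "\<dots> = ennreal (LINT \<tau>:{0<..}|lborel. c * (\<tau> powr (1 - s - 1) * exp (- ((r + \<theta>) * \<tau>))))"
      unfolding set_lebesgue_integral_def
      by (rule nn_integral_eq_integral) (use i c in \<open>auto simp: set_integrable_def\<close>)
    also have "(LINT \<tau>:{0<..}|lborel. c * (\<tau> powr (1 - s - 1) * exp (- ((r + \<theta>) * \<tau>)))) = c * (Gamma (1 - s) * (r + \<theta>) powr (- (1 - s)))"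
      unfolding set_integral_mult_right using set_integrable_powr_exp(2)[of "1 - s" "r + \<theta>"] s p by simp
    also have "\<dots> = s * (r + \<theta>) powr (s - 1)" using G by (simp add: c_def)
    finally show ?thesis using True by simp
  qed simp
  have inner2: "(\<integral>\<^sup>+\<theta>. ennreal (?f \<theta> \<tau>) \<partial>lborel) = ennreal (indicator {0<..} \<tau> * (defect_density s \<tau> * exp (- (r * \<tau>))))" for \<tau>
  proof (cases "\<tau> > 0")
    case True
    define k where "k = c * \<tau> powr (- s) * exp (- (r * \<tau>))"
    have k: "k \<ge> 0" using c by (simp add: k_def)
    have "(\<integral>\<^sup>+\<theta>. ennreal (?f \<theta> \<tau>) \<partial>lborel) = (\<integral>\<^sup>+\<theta>. ennreal (k * exp (- (\<theta> * \<tau>))) * indicator {0..1} \<theta> \<partial>lborel)"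
      by (intro nn_integral_cong) (use True in \<open>auto simp: indicator_def k_def algebra_simps exp_add exp_diff exp_minus divide_simps\<close>)
    also have "\<dots> = ennreal ((- k / \<tau> * exp (- (1 * \<tau>))) - (- k / \<tau> * exp (- (0 * \<tau>))))"
    proof (rule nn_integral_FTC_Icc)
      fix x :: real
      show "((\<lambda>\<theta>. - k / \<tau> * exp (- (\<theta> * \<tau>))) has_real_derivative k * exp (- (x * \<tau>))) (at x)"
        using True by (auto intro!: derivative_eq_intros)
    qed (use k in auto)
    also have "(- k / \<tau> * exp (- (1 * \<tau>))) - (- k / \<tau> * exp (- (0 * \<tau>))) = defect_density s \<tau> * exp (- (r * \<tau>))"
    proof -
      have "\<tau> powr (- 1 - s) = \<tau> powr (- s) / \<tau>" using True by (simp add: powr_diff powr_minus field_simps)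
      then have "defect_density s \<tau> * exp (- (r * \<tau>)) = c * ((1 - exp (- \<tau>)) * (\<tau> powr (- s) / \<tau>)) * exp (- (r * \<tau>))"
        by (simp add: defect_density_def c_def)
      also have "\<dots> = k / \<tau> * (1 - exp (- \<tau>))" by (simp add: k_def)
      finally show ?thesis by (simp add: algebra_simps)
    qed
    finally show ?thesis using True by simp
  qed simp
  have "(\<integral>\<^sup>+\<tau>. ennreal (indicator {0<..} \<tau> * (defect_density s \<tau> * exp (- (r * \<tau>)))) \<partial>lborel)
      = (\<integral>\<^sup>+\<tau>. \<integral>\<^sup>+\<theta>. ennreal (?f \<theta> \<tau>) \<partial>lborel \<partial>lborel)"
    by (simp only: inner2)
  also have "\<dots> = (\<integral>\<^sup>+\<theta>. \<integral>\<^sup>+\<tau>. ennreal (?f \<theta> \<tau>) \<partial>lborel \<partial>lborel)"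
    by (rule lborel_pair.Fubini') measurable
  also have "\<dots> = (\<integral>\<^sup>+\<theta>. ennreal (s * (r + \<theta>) powr (s - 1)) * indicator ?I \<theta> \<partial>lborel)"
    by (simp only: inner1)
  also have "\<dots> = ennreal ((r + 1) powr s - (r + 0) powr s)"
  proof -
    have D: "((\<lambda>\<theta>. (r + \<theta>) powr s) has_real_derivative s * (r + x) powr (s - 1)) (at x)" if "0 \<le> x" "x \<le> 1" for x
      using r that by (auto intro!: derivative_eq_intros simp: powr_diff)
    show ?thesis by (rule nn_integral_FTC_Icc[where F="\<lambda>\<theta>. (r + \<theta>) powr s"]) (use s D in auto)
  qed
  finally have n: "(\<integral>\<^sup>+\<tau>. ennreal (indicator {0<..} \<tau> * (defect_density s \<tau> * exp (- (r * \<tau>)))) \<partial>lborel) = ennreal ((1 + r) powr s - r powr s)"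
    by (simp add: add.commute)
  have "has_bochner_integral lborel (\<lambda>\<tau>. indicator {0<..} \<tau> * (defect_density s \<tau> * exp (- (r * \<tau>)))) ((1 + r) powr s - r powr s)"
  proof (rule has_bochner_integral_nn_integral[OF _ _ _ n])
    show "(\<lambda>\<tau>. indicator {0<..} \<tau> * (defect_density s \<tau> * exp (- (r * \<tau>)))) \<in> borel_measurable lborel"
      unfolding defect_density_def by measurable
    show "AE \<tau> in lborel. 0 \<le> indicator {0<..} \<tau> * (defect_density s \<tau> * exp (- (r * \<tau>)))"
      using defect_density_nonneg[OF s] by (auto simp: indicator_def)
    show "0 \<le> (1 + r) powr s - r powr s" using r s by (simp add: powr_mono2)
  qed
  then show ?thesis by (simp add: has_bochner_integral_iff set_lebesgue_integral_def)
qed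

lemma defect_density_integrable:
  assumes s: "0 < s" "s < 1"
  shows "set_integrable lborel {0<..} (defect_density s)"
proof -
  define c where "c = s / Gamma (1 - s)"
  have G: "Gamma (1 - s) > 0" using s by (intro Gamma_real_pos) simp
  have c: "c > 0" using s G by (simp add: c_def)
  have "set_integrable lborel {0<..} (\<lambda>\<tau>. \<tau> powr (1 - s - 1) * exp (- (1 * \<tau>)))"
    by (rule set_integrable_powr_exp) (use s in auto)
  \<comment> \<open>Up to \<open>\<tau> = 1\<close> the factor \<open>exp 1 * exp (- \<tau>)\<close>
    is at least 1, so a Gamma integrand dominates the singular part
    \<open>\<tau> powr (- s)\<close>.\<close>
  then have "integrable lborel (\<lambda>\<tau>. exp 1 * (indicator {0<..} \<tau> * (\<tau> powr (- s) * exp (- \<tau>))) :: real)"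
    by (auto simp: set_integrable_def)
  moreover have "integrable lborel (\<lambda>\<tau>. indicator {1..} \<tau> * \<tau> powr (- 1 - s) :: real)"
    using set_integrable_powr_tail[of "- 1 - s"] s by (simp add: set_integrable_def)
  ultimately have int: "integrable lborel (\<lambda>\<tau>. c * (exp 1 * (indicator {0<..} \<tau> * (\<tau> powr (- s) * exp (- \<tau>))) + indicator {1..} \<tau> * \<tau> powr (- 1 - s)) :: real)"
    by (rule integrable_mult_right[OF Bochner_Integration.integrable_add])
  have "integrable lborel (\<lambda>\<tau>. indicator {0<..} \<tau> *\<^sub>R defect_density s \<tau>)"
  proof (rule Bochner_Integration.integrable_bound[OF int])
    show "(\<lambda>\<tau>. indicator {0<..} \<tau> *\<^sub>R defect_density s \<tau>) \<in> borel_measurable lborel"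
      unfolding defect_density_def by measurable
    show "AE \<tau> in lborel. norm (indicator {0<..} \<tau> *\<^sub>R defect_density s \<tau>) \<le> norm (c * (exp 1 * (indicator {0<..} \<tau> * (\<tau> powr (- s) * exp (- \<tau>))) + indicator {1..} \<tau> * \<tau> powr (- 1 - s)) :: real)"
    proof (rule AE_I2)
      fix \<tau> :: real
      show "norm (indicator {0<..} \<tau> *\<^sub>R defect_density s \<tau>) \<le> norm (c * (exp 1 * (indicator {0<..} \<tau> * (\<tau> powr (- s) * exp (- \<tau>))) + indicator {1..} \<tau> * \<tau> powr (- 1 - s)) :: real)"
      proof (cases "\<tau> > 0")
        case True
        have "(1 - exp (- \<tau>)) * \<tau> powr (- 1 - s) \<le> exp 1 * (\<tau> powr (- s) * exp (- \<tau>)) + indicator {1..} \<tau> * \<tau> powr (- 1 - s)"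
        proof (cases "\<tau> < 1")
          case less: True
          have "(1 - exp (- \<tau>)) * \<tau> powr (- 1 - s) \<le> \<tau> * \<tau> powr (- 1 - s)"
            using exp_ge_add_one_self[of "- \<tau>"] by (intro mult_right_mono) auto
          also have "\<dots> = \<tau> powr (- s)" using True by (simp add: powr_diff powr_minus field_simps)
          also have "\<dots> \<le> \<tau> powr (- s) * (exp 1 * exp (- \<tau>))"
            using less mult_left_mono[of 1 "exp (1 - \<tau>)" "\<tau> powr (- s)"] by (simp flip: exp_add)
          finally show ?thesis using less by (simp add: mult_ac)
        next
          case False
          have "(1 - exp (- \<tau>)) * \<tau> powr (- 1 - s) \<le> 1 * \<tau> powr (- 1 - s)" by (intro mult_right_mono) auto
          then show ?thesis using False by (simp add: add_increasing)
        qed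
        then have "c * ((1 - exp (- \<tau>)) * \<tau> powr (- 1 - s)) \<le> c * (exp 1 * (\<tau> powr (- s) * exp (- \<tau>)) + indicator {1..} \<tau> * \<tau> powr (- 1 - s))"
          using c by (intro mult_left_mono) auto
        moreover have "norm (indicator {0<..} \<tau> *\<^sub>R defect_density s \<tau>) = c * ((1 - exp (- \<tau>)) * \<tau> powr (- 1 - s))"
          using True defect_density_nonneg[OF s True] by (simp add: abs_of_nonneg) (simp add: defect_density_def c_def)
        ultimately have "norm (indicator {0<..} \<tau> *\<^sub>R defect_density s \<tau>) \<le> c * (exp 1 * (indicator {0<..} \<tau> * (\<tau> powr (- s) * exp (- \<tau>))) + indicator {1..} \<tau> * \<tau> powr (- 1 - s))"
          using True by simp
        then show ?thesis by (rule order_trans) simp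
      qed simp
    qed
  qed
  then show ?thesis by (simp add: set_integrable_def)
qed

lemma laplace_defect_density:
  assumes s: "0 < s" "s < 1" and m: "Re m > 0"
  shows "laplace (defect_density s) m = (1 + m) powr complex_of_real s - m powr complex_of_real s"
proof (rule laplace_eqI[OF defect_density_integrable[OF s] _ _ m])
  show "(\<lambda>m. (1 + m) powr complex_of_real s - m powr complex_of_real s) holomorphic_on {m. Re m > 0}"
    by (intro holomorphic_intros) (auto simp: complex_nonpos_Reals_iff)
  fix r :: real assume r: "r > 0"
  show "laplace (defect_density s) (complex_of_real r) = (1 + complex_of_real r) powr complex_of_real s - complex_of_real r powr complex_of_real s"
    using laplace_defect_density_real[OF s r] powr_of_real[of "1 + r" s] powr_of_real[of r s] r
    by (simp add: laplace_of_real)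
qed

section \<open>Symmetry of Bessel functions and the conormal derivative\<close>

lemma set_integral_inverse_substitution:
  fixes f :: "real \<Rightarrow> real" and k :: real
  assumes k: "k > 0" and f: "set_integrable lborel {0<..} f" and fm: "f \<in> borel_measurable borel"
  shows "(LINT \<tau>:{0<..}|lborel. f \<tau>) = (LINT \<rho>:{0<..}|lborel. k / \<rho>\<^sup>2 * f (k / \<rho>))"
proof -
  have im: "(\<lambda>\<rho>. k / \<rho>) ` {0<..} = {0<..}"
  proof safe
    fix x :: real assume "0 < x"
    then show "x \<in> (\<lambda>\<rho>. k / \<rho>) ` {0<..}" using k by (intro image_eqI[of _ _ "k / x"]) auto
  qed (use k in auto)
  have fa: "f absolutely_integrable_on {0<..}"
    using f fm unfolding set_integrable_def by (subst integrable_lebesgue_iff_lborel) auto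
  have "(\<lambda>x. \<bar>- k / x\<^sup>2\<bar> * f (k / x)) absolutely_integrable_on {0<..} \<and>
           integral {0<..} (\<lambda>x. \<bar>- k / x\<^sup>2\<bar> * f (k / x)) = integral {0<..} f
     \<longleftrightarrow> f absolutely_integrable_on ((\<lambda>\<rho>. k / \<rho>) ` {0<..}) \<and> integral ((\<lambda>\<rho>. k / \<rho>) ` {0<..}) f = integral {0<..} f"
  proof (rule has_absolute_integral_change_of_variables_1')
    show "((\<lambda>\<rho>. k / \<rho>) has_real_derivative - k / x\<^sup>2) (at x within {0<..})" if "x \<in> {0<..}" for x
      using that by (auto intro!: derivative_eq_intros simp: power2_eq_square)
    show "inj_on (\<lambda>\<rho>. k / \<rho>) {0<..}" using k by (auto simp: inj_on_def)
  qed simp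
  then have 1: "(\<lambda>x. \<bar>- k / x\<^sup>2\<bar> * f (k / x)) absolutely_integrable_on {0<..}"
    and 2: "integral {0<..} (\<lambda>x. \<bar>- k / x\<^sup>2\<bar> * f (k / x)) = integral {0<..} f"
    using fa unfolding im by auto
  have "(LINT \<tau>:{0<..}|lborel. f \<tau>) = integral {0<..} f"
    using set_lebesgue_integral_eq_integral(2)[OF fa] fm unfolding set_lebesgue_integral_def
    by (subst (asm) integral_lebesgue_eq_lborel) auto
  also have "\<dots> = (LINT x:{0<..}|lborel. \<bar>- k / x\<^sup>2\<bar> * f (k / x))"
    unfolding 2[symmetric] using set_lebesgue_integral_eq_integral(2)[OF 1] fm unfolding set_lebesgue_integral_def
    by (subst (asm) integral_lebesgue_eq_lborel) auto
  also have "\<dots> = (LINT \<rho>:{0<..}|lborel. k / \<rho>\<^sup>2 * f (k / \<rho>))"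
    using k by simp
  finally show ?thesis .
qed

text \<open>For positive \<open>b\<close> and \<open>m\<close> this is
  \<open>2 * (b / m) powr ((p + 1) / 2)\<close> times the modified Bessel function K of order
  \<open>p + 1\<close> at \<open>2 * sqrt (b * m)\<close>.\<close>

definition bessel_integral :: "real \<Rightarrow> real \<Rightarrow> real \<Rightarrow> real" where
  "bessel_integral p b m = (LINT \<tau>:{0<..}|lborel. \<tau> powr p * exp (- (b / \<tau> + m * \<tau>)))"

text \<open>The substitution \<open>\<tau> = (b / m) / \<rho>\<close> exchanges the two terms of the
  exponent and changes the sign of the order \<open>p + 1\<close>.\<close>

lemma bessel_integral_reflect:
  assumes b: "b > 0" and m: "m > 0"
  shows "bessel_integral p b m = (b / m) powr (p + 1) * bessel_integral (- p - 2) b m"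
proof -
  define k where "k = b / m"
  have k: "k > 0" using b m by (simp add: k_def)
  have "bessel_integral p b m = (LINT \<rho>:{0<..}|lborel. k / \<rho>\<^sup>2 * ((k / \<rho>) powr p * exp (- (b / (k / \<rho>) + m * (k / \<rho>)))))"
    unfolding bessel_integral_def by (rule set_integral_inverse_substitution[OF k set_integrable_bessel[OF b m]]) measurable
  also have "\<dots> = (LINT \<rho>:{0<..}|lborel. k powr (p + 1) * (\<rho> powr (- p - 2) * exp (- (b / \<rho> + m * \<rho>))))"
  proof (rule set_lebesgue_integral_cong)
    show "\<forall>\<rho>. \<rho> \<in> {0<..} \<longrightarrow> k / \<rho>\<^sup>2 * ((k / \<rho>) powr p * exp (- (b / (k / \<rho>) + m * (k / \<rho>)))) = k powr (p + 1) * (\<rho> powr (- p - 2) * exp (- (b / \<rho> + m * \<rho>)))"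
    proof (intro allI impI)
      fix \<rho> :: real assume "\<rho> \<in> {0<..}"
      then have r: "\<rho> > 0" by simp
      have "b / (k / \<rho>) + m * (k / \<rho>) = b / \<rho> + m * \<rho>" using b m by (simp add: k_def field_simps)
      moreover have "k / \<rho>\<^sup>2 * (k / \<rho>) powr p = k powr (p + 1) * \<rho> powr (- p - 2)"
      proof -
        have "\<rho> powr (- p - 2) = 1 / (\<rho> powr p * \<rho>\<^sup>2)"
          using r by (simp add: powr_diff powr_minus field_simps)
        then show ?thesis using r k by (simp add: powr_divide powr_add mult_ac)
      qed
      ultimately show "k / \<rho>\<^sup>2 * ((k / \<rho>) powr p * exp (- (b / (k / \<rho>) + m * (k / \<rho>)))) = k powr (p + 1) * (\<rho> powr (- p - 2) * exp (- (b / \<rho> + m * \<rho>)))"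
        by (simp add: mult.assoc[symmetric])
    qed
  qed simp
  also have "\<dots> = k powr (p + 1) * bessel_integral (- p - 2) b m"
    unfolding bessel_integral_def by simp
  finally show ?thesis by (simp add: k_def)
qed

text \<open>The derivative of \<open>\<tau> powr (- s) * exp (- (b / \<tau> + m * \<tau>))\<close>
  has integral zero because the function vanishes at both ends; its three terms are the three
  integrals.\<close>

lemma bessel_integral_recurrence:
  assumes b: "b > 0" and m: "m > 0"
  shows "s * bessel_integral (- 1 - s) b m - b * bessel_integral (- 2 - s) b m = - m * bessel_integral (- s) b m"
proof -
  define F where "F = (\<lambda>\<tau>. \<tau> powr (- s) * exp (- (b / \<tau> + m * \<tau>)))"
  define f where "f = (\<lambda>\<tau>. - s * (\<tau> powr (- 1 - s) * exp (- (b / \<tau> + m * \<tau>))) + b * (\<tau> powr (- 2 - s) * exp (- (b / \<tau> + m * \<tau>))) - m * (\<tau> powr (- s) * exp (- (b / \<tau> + m * \<tau>))))"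
  note i = set_integrable_bessel[OF b m]
  have fi: "set_integrable lborel {0<..} f"
    unfolding f_def by (intro set_integral_diff(1) set_integral_add(1) set_integrable_mult_right i)
  have DF: "(F has_real_derivative f \<tau>) (at \<tau>)" if "\<tau> > 0" for \<tau>
  proof -
    have "\<tau> powr (- s - 1) = \<tau> powr (- 1 - s)" "\<tau> powr (- 2 - s) = \<tau> powr (- s) / \<tau>\<^sup>2"
      using that by (simp_all add: algebra_simps powr_diff powr_minus field_simps)
    then show ?thesis unfolding F_def f_def using that
      by (auto intro!: derivative_eq_intros simp: power2_eq_square algebra_simps)
  qed
  have bound: "\<bar>F \<tau>\<bar> \<le> (q / b) powr q * \<tau> powr (q - s) * exp (- (m * \<tau>))" if "q > 0" "\<tau> > 0" for q \<tau>
  proof -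
    have "\<tau> powr (- s) * exp (- (m * \<tau>)) * exp (- (b / \<tau>)) \<le> \<tau> powr (- s) * exp (- (m * \<tau>)) * ((q / b) powr q * \<tau> powr q)"
      by (rule mult_left_mono[OF exp_inverse_le_powr[OF b that]]) simp
    moreover have "exp (- (b / \<tau> + m * \<tau>)) = exp (- (m * \<tau>)) * exp (- (b / \<tau>))" by (simp flip: exp_add)
    moreover have "\<tau> powr (q - s) = \<tau> powr (- s) * \<tau> powr q" by (simp flip: powr_add)
    ultimately show ?thesis by (simp add: F_def mult_ac)
  qed
  have "(LBINT \<tau>=0..\<infinity>. f \<tau>) = 0 - 0"
  proof (rule interval_integral_FTC_integrable)
    show "(F has_vector_derivative f x) (at x)" if "0 < ereal x" for x
      using DF[of x] that by (simp add: has_real_derivative_iff_has_vector_derivative)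
    show "isCont f x" if "0 < ereal x" for x
      unfolding f_def using that by (intro continuous_intros) auto
    show "set_integrable lborel (einterval 0 \<infinity>) f"
      using fi by (simp add: einterval_def greaterThan_def)
    \<comment> \<open>With \<open>q > s\<close> the bound on \<open>F\<close> vanishes at 0; at
      infinity its factor \<open>exp (- (m * \<tau>))\<close> prevails.\<close>
    define q where "q = \<bar>s\<bar> + 1"
    have q: "q > 0" "q - s > 0" by (auto simp: q_def)
    have "((\<lambda>\<tau>. (q / b) powr q * \<tau> powr (q - s) * exp (- (m * \<tau>))) \<longlongrightarrow> (q / b) powr q * 0 * exp (- (m * 0))) (at_right 0)"
      using q by (intro tendsto_intros tendsto_zero_powrI[of _ _ _ "q - s"]) (auto intro!: tendsto_intros simp: eventually_at_right_less eventually_mono[OF eventually_at_right_less])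
    then have l0: "((\<lambda>\<tau>. (q / b) powr q * \<tau> powr (q - s) * exp (- (m * \<tau>))) \<longlongrightarrow> 0) (at_right 0)" by simp
    have F0: "(F \<longlongrightarrow> 0) (at_right 0)"
      by (rule tendsto_rabs_zero_cancel, rule tendsto_sandwich[OF _ _ tendsto_const l0])
         (use bound[OF q(1)] in \<open>auto intro: eventually_mono[OF eventually_at_right_less]\<close>)
    then show "((F \<circ> real_of_ereal) \<longlongrightarrow> 0) (at_right 0)"
      unfolding zero_ereal_def by (simp add: ereal_tendsto_simps)
    have li: "((\<lambda>\<tau>. (q / b) powr q * \<tau> powr (q - s) * exp (- (m * \<tau>))) \<longlongrightarrow> 0) at_top"
      using m q by real_asymp
    have Fi: "(F \<longlongrightarrow> 0) at_top"
      by (rule tendsto_rabs_zero_cancel, rule tendsto_sandwich[OF _ _ tendsto_const li])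
         (use bound[OF q(1)] in \<open>auto intro: eventually_mono[OF eventually_gt_at_top[of 0]]\<close>)
    then show "((F \<circ> real_of_ereal) \<longlongrightarrow> 0) (at_left \<infinity>)"
      by (simp add: ereal_tendsto_simps)
  qed simp
  then have "0 = (LINT \<tau>:{0<..}|lborel. f \<tau>)"
    unfolding zero_ereal_def by (simp add: interval_integral_to_infinity_eq)
  also have "\<dots> = - s * bessel_integral (- 1 - s) b m + b * bessel_integral (- 2 - s) b m - m * bessel_integral (- s) b m"
  proof -
    let ?A = "\<lambda>\<tau>. - s * (\<tau> powr (- 1 - s) * exp (- (b / \<tau> + m * \<tau>)))"
    let ?B = "\<lambda>\<tau>. b * (\<tau> powr (- 2 - s) * exp (- (b / \<tau> + m * \<tau>)))"
    let ?C = "\<lambda>\<tau>. m * (\<tau> powr (- s) * exp (- (b / \<tau> + m * \<tau>)))"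
    have A: "set_integrable lborel {0<..} ?A" and B: "set_integrable lborel {0<..} ?B" and C: "set_integrable lborel {0<..} ?C"
      by (intro set_integrable_mult_right i)+
    have "(LINT \<tau>:{0<..}|lborel. f \<tau>) = (LINT \<tau>:{0<..}|lborel. ?A \<tau> + ?B \<tau>) - (LINT \<tau>:{0<..}|lborel. ?C \<tau>)"
      unfolding f_def by (rule set_integral_diff(2)[OF set_integral_add(1)[OF A B] C])
    also have "(LINT \<tau>:{0<..}|lborel. ?A \<tau> + ?B \<tau>) = (LINT \<tau>:{0<..}|lborel. ?A \<tau>) + (LINT \<tau>:{0<..}|lborel. ?B \<tau>)"
      by (rule set_integral_add(2)[OF A B])
    finally show ?thesis unfolding bessel_integral_def set_integral_mult_right .
  qed
  finally show ?thesis by (simp add: algebra_simps)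
qed

text \<open>\<open>conormal_density s y\<close> is \<open>y\<^sup>1\<^sup>-\<^sup>2\<^sup>s \<partial>/\<partial>y\<close> of \<open>y\<^sup>2\<^sup>s \<tau>\<^sup>-\<^sup>1\<^sup>-\<^sup>s exp (-y\<^sup>2/4\<tau>)\<close>.\<close>
definition conormal_density :: "real \<Rightarrow> real \<Rightarrow> real \<Rightarrow> real" where
  "conormal_density s y \<tau> = (2 * s - y\<^sup>2 / (2 * \<tau>)) * \<tau> powr (- 1 - s) * exp (- (y\<^sup>2 / 4 / \<tau>))"

text \<open>The time factor of \<open>ext_kernel\<close>: the inverse Gamma distribution of shape
  \<open>s\<close> and scale \<open>y\<^sup>2 / 4\<close>.\<close>

definition poisson_density :: "real \<Rightarrow> real \<Rightarrow> real \<Rightarrow> real" where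
  "poisson_density s y \<tau> = y powr (2 * s) / (4 powr s * Gamma s) * (\<tau> powr (- 1 - s) * exp (- (y\<^sup>2 / 4 / \<tau>)))"

lemma poisson_density_integrable:
  assumes "s > 0" "y > 0"
  shows "set_integrable lborel {0<..} (poisson_density s y)"
  unfolding poisson_density_def using assms
  by (intro set_integrable_mult_right set_integrable_powr_exp_inverse) auto

lemma conormal_density_integrable:
  assumes s: "s > 0" and y: "y > 0"
  shows "set_integrable lborel {0<..} (conormal_density s y)"
proof -
  have "set_integrable lborel {0<..} (\<lambda>\<tau>. 2 * s * (\<tau> powr (- 1 - s) * exp (- (y\<^sup>2 / 4 / \<tau>))) - y\<^sup>2 / 2 * (\<tau> powr (- 2 - s) * exp (- (y\<^sup>2 / 4 / \<tau>))))"
    using s y by (intro set_integral_diff(1) set_integrable_mult_right set_integrable_powr_exp_inverse) auto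
  also have "?this \<longleftrightarrow> ?thesis"
  proof (rule set_integrable_cong[OF refl refl])
    fix \<tau> :: real assume "\<tau> \<in> {0<..}"
    then have "\<tau> powr (- 2 - s) = \<tau> powr (- 1 - s) / \<tau>" using powr_diff[of \<tau> "- 1 - s" 1] by simp
    then show "2 * s * (\<tau> powr (- 1 - s) * exp (- (y\<^sup>2 / 4 / \<tau>))) - y\<^sup>2 / 2 * (\<tau> powr (- 2 - s) * exp (- (y\<^sup>2 / 4 / \<tau>))) = conormal_density s y \<tau>"
      by (simp add: conormal_density_def algebra_simps)
  qed
  finally show ?thesis .
qed

text \<open>For real \<open>m\<close> the recurrence collapses the two terms of the conormal density
  to \<open>- 2 * m\<close> times the integral with exponent \<open>- s\<close>. Reflection turns
  that into the integral of the Poisson density with parameter \<open>1 - s\<close> and leaves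
  \<open>m powr s\<close>, the symbol of the operator.\<close>

lemma laplace_conormal_density:
  assumes s: "0 < s" "s < 1" and y: "y > 0" and m: "Re m > 0"
  shows "laplace (conormal_density s y) m = - complex_of_real (2 * Gamma (1 - s)) * m powr complex_of_real s * laplace (poisson_density (1 - s) y) m"
proof (rule laplace_eqI[OF conormal_density_integrable[OF s(1) y] _ _ m])
  show "(\<lambda>m. - complex_of_real (2 * Gamma (1 - s)) * m powr complex_of_real s * laplace (poisson_density (1 - s) y) m) holomorphic_on {m. Re m > 0}"
    using s y by (intro holomorphic_intros laplace_holomorphic poisson_density_integrable) (auto simp: complex_nonpos_Reals_iff)
  fix r :: real assume r: "r > 0"
  \<comment> \<open>With this \<open>b\<close> the prefactor
    \<open>y powr (2 * (1 - s)) / 4 powr (1 - s)\<close> becomes \<open>b powr (1 - s)\<close>, the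
    power produced by reflection.\<close>
  define b where "b = y\<^sup>2 / 4"
  have b: "b > 0" using y by (simp add: b_def)
  have e: "exp (- (b / \<tau> + r * \<tau>)) = exp (- (b / \<tau>)) * exp (- (r * \<tau>))" for \<tau> by (simp flip: exp_add)
  have "(LINT \<tau>:{0<..}|lborel. conormal_density s y \<tau> * exp (- (r * \<tau>)))
      = (LINT \<tau>:{0<..}|lborel. 2 * s * (\<tau> powr (- 1 - s) * exp (- (b / \<tau> + r * \<tau>))) - 2 * b * (\<tau> powr (- 2 - s) * exp (- (b / \<tau> + r * \<tau>))))"
  proof (rule set_lebesgue_integral_cong)
    show "\<forall>\<tau>. \<tau> \<in> {0<..} \<longrightarrow> conormal_density s y \<tau> * exp (- (r * \<tau>)) = 2 * s * (\<tau> powr (- 1 - s) * exp (- (b / \<tau> + r * \<tau>))) - 2 * b * (\<tau> powr (- 2 - s) * exp (- (b / \<tau> + r * \<tau>)))"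
    proof (intro allI impI)
      fix \<tau> :: real assume "\<tau> \<in> {0<..}"
      then have t: "\<tau> powr (- 2 - s) = \<tau> powr (- 1 - s) / \<tau>" using powr_diff[of \<tau> "- 1 - s" 1] by simp
      show "conormal_density s y \<tau> * exp (- (r * \<tau>)) = 2 * s * (\<tau> powr (- 1 - s) * exp (- (b / \<tau> + r * \<tau>))) - 2 * b * (\<tau> powr (- 2 - s) * exp (- (b / \<tau> + r * \<tau>)))"
        unfolding conormal_density_def t e by (simp add: b_def algebra_simps)
    qed
  qed simp
  also have "\<dots> = 2 * (s * bessel_integral (- 1 - s) b r - b * bessel_integral (- 2 - s) b r)"
  proof -
    let ?A = "\<lambda>\<tau>. 2 * s * (\<tau> powr (- 1 - s) * exp (- (b / \<tau> + r * \<tau>)))"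
    let ?B = "\<lambda>\<tau>. 2 * b * (\<tau> powr (- 2 - s) * exp (- (b / \<tau> + r * \<tau>)))"
    have A: "set_integrable lborel {0<..} ?A" and B: "set_integrable lborel {0<..} ?B"
      by (intro set_integrable_mult_right set_integrable_bessel b r)+
    have "(LINT \<tau>:{0<..}|lborel. ?A \<tau> - ?B \<tau>) = 2 * s * bessel_integral (- 1 - s) b r - 2 * b * bessel_integral (- 2 - s) b r"
      unfolding set_integral_diff(2)[OF A B] set_integral_mult_right bessel_integral_def ..
    then show ?thesis by (simp only: right_diff_distrib mult.assoc)
  qed
  also have "\<dots> = - 2 * r * bessel_integral (- s) b r" by (simp add: bessel_integral_recurrence[OF b r])
  also have "\<dots> = - 2 * r * ((b / r) powr (1 - s) * bessel_integral (s - 2) b r)"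
    using bessel_integral_reflect[OF b r, of "- s"] by simp
  also have "r * (b / r) powr (1 - s) = r powr s * b powr (1 - s)"
    using b r by (simp add: powr_divide powr_diff)
  then have "- 2 * r * ((b / r) powr (1 - s) * bessel_integral (s - 2) b r) = - 2 * r powr s * b powr (1 - s) * bessel_integral (s - 2) b r"
    by simp
  finally have L: "(LINT \<tau>:{0<..}|lborel. conormal_density s y \<tau> * exp (- (r * \<tau>))) = - 2 * r powr s * b powr (1 - s) * bessel_integral (s - 2) b r" .
  have "y powr (2 * (1 - s)) = (y powr 2) powr (1 - s)" by (simp add: powr_powr)
  then have "y powr (2 * (1 - s)) / 4 powr (1 - s) = b powr (1 - s)"
    using y by (simp add: b_def powr_divide)
  then have c: "y powr (2 * (1 - s)) / (4 powr (1 - s) * Gamma (1 - s)) = b powr (1 - s) / Gamma (1 - s)" by (simp add: field_simps)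
  have "(LINT \<tau>:{0<..}|lborel. poisson_density (1 - s) y \<tau> * exp (- (r * \<tau>))) = b powr (1 - s) / Gamma (1 - s) * bessel_integral (s - 2) b r"
    unfolding poisson_density_def c bessel_integral_def set_integral_mult_right[symmetric] e b_def[symmetric] by (simp add: algebra_simps)
  moreover have "Gamma (1 - s) > 0" using s by (intro Gamma_real_pos) simp
  ultimately have "(LINT \<tau>:{0<..}|lborel. conormal_density s y \<tau> * exp (- (r * \<tau>))) = - (2 * Gamma (1 - s)) * r powr s * (LINT \<tau>:{0<..}|lborel. poisson_density (1 - s) y \<tau> * exp (- (r * \<tau>)))"
    unfolding L by simp
  then show "laplace (conormal_density s y) (complex_of_real r) = - complex_of_real (2 * Gamma (1 - s)) * complex_of_real r powr complex_of_real s * laplace (poisson_density (1 - s) y) (complex_of_real r)"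
    using powr_of_real[of r s] r by (simp add: laplace_of_real)
qed

section \<open>Superpositions of heat kernels\<close>

text \<open>Heat kernel at time \<open>\<tau>\<close> weighted by \<open>\<phi> \<tau>\<close>, kept
  as a function on space-time: the superposition over \<open>\<tau>\<close> is carried out by the
  space-time convolution, which shifts time as well.\<close>

definition heat_kernel :: "(real \<Rightarrow> real) \<Rightarrow> 'a::euclidean_space \<times> real \<Rightarrow> real" where
  "heat_kernel \<phi> = (\<lambda>(z, \<tau>). indicator {0<..} \<tau> * \<phi> \<tau> * gauss (4 * pi * \<tau>) z)"

lemma borel_measurable_gauss2 [measurable (raw)]:
  assumes [measurable]: "f \<in> borel_measurable M" "g \<in> borel_measurable M"
  shows "(\<lambda>x. gauss (f x) (g x)) \<in> borel_measurable M"
  unfolding gauss_def by measurable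

lemma borel_measurable_heat_kernel [measurable]:
  assumes [measurable]: "\<phi> \<in> borel_measurable borel"
  shows "heat_kernel \<phi> \<in> borel_measurable borel"
  unfolding heat_kernel_def borel_prod[symmetric] by measurable

lemma nn_integral_gauss:
  assumes "e > 0" shows "(\<integral>\<^sup>+z. ennreal (gauss e (z::'a::euclidean_space)) \<partial>lborel) = 1"
  using nn_integral_eq_integral[OF gauss_integral(1)[OF assms, where 'a='a]] gauss_integral(2)[OF assms, where 'a='a] by simp

lemma nn_integral_lborel_pair:
  fixes f :: "'a::euclidean_space \<times> 'b::euclidean_space \<Rightarrow> ennreal"
  assumes "f \<in> borel_measurable borel"
  shows "(\<integral>\<^sup>+p. f p \<partial>lborel) = (\<integral>\<^sup>+\<tau>. \<integral>\<^sup>+z. f (z, \<tau>) \<partial>lborel \<partial>lborel)"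
  using lborel_pair.nn_integral_snd[of f] assms
  by (simp add: lborel_prod borel_prod measurable_def[symmetric])

lemma integral_lborel_pair:
  fixes f :: "'a::euclidean_space \<times> 'b::euclidean_space \<Rightarrow> 'c::{banach, second_countable_topology}"
  assumes "integrable lborel f"
  shows "(LINT p|lborel. f p) = (LINT \<tau>|lborel. LINT z|lborel. f (z, \<tau>))"
  using lborel_pair.integral_snd[of "\<lambda>z \<tau>. f (z, \<tau>)"] assms by (simp add: lborel_prod)

lemma nn_integral_heat_kernel:
  assumes [measurable]: "\<phi> \<in> borel_measurable borel"
  shows "(\<integral>\<^sup>+p. ennreal \<bar>heat_kernel \<phi> (p :: 'a::euclidean_space \<times> real)\<bar> \<partial>lborel) = (\<integral>\<^sup>+\<tau>. ennreal (indicator {0<..} \<tau> * \<bar>\<phi> \<tau>\<bar>) \<partial>lborel)"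
proof -
  have "(\<integral>\<^sup>+p. ennreal \<bar>heat_kernel \<phi> (p :: 'a \<times> real)\<bar> \<partial>lborel) = (\<integral>\<^sup>+\<tau>. \<integral>\<^sup>+z. ennreal \<bar>heat_kernel \<phi> (z :: 'a, \<tau>)\<bar> \<partial>lborel \<partial>lborel)"
    by (rule nn_integral_lborel_pair) measurable
  also have "\<dots> = (\<integral>\<^sup>+\<tau>. ennreal (indicator {0<..} \<tau> * \<bar>\<phi> \<tau>\<bar>) \<partial>lborel)"
  proof (rule nn_integral_cong)
    fix \<tau> :: real
    have "(\<integral>\<^sup>+z. ennreal \<bar>heat_kernel \<phi> (z :: 'a, \<tau>)\<bar> \<partial>lborel) = (\<integral>\<^sup>+z. ennreal (indicator {0<..} \<tau> * \<bar>\<phi> \<tau>\<bar>) * ennreal (gauss (4 * pi * \<tau>) (z :: 'a)) \<partial>lborel)"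
      by (simp add: heat_kernel_def abs_mult flip: ennreal_mult)
    also have "\<dots> = ennreal (indicator {0<..} \<tau> * \<bar>\<phi> \<tau>\<bar>) * (\<integral>\<^sup>+z. ennreal (gauss (4 * pi * \<tau>) (z :: 'a)) \<partial>lborel)"
      by (rule nn_integral_cmult) measurable
    also have "\<dots> = ennreal (indicator {0<..} \<tau> * \<bar>\<phi> \<tau>\<bar>)"
      by (cases "\<tau> > 0") (simp_all add: nn_integral_gauss)
    finally show "(\<integral>\<^sup>+z. ennreal \<bar>heat_kernel \<phi> (z :: 'a, \<tau>)\<bar> \<partial>lborel) = ennreal (indicator {0<..} \<tau> * \<bar>\<phi> \<tau>\<bar>)" .
  qed
  finally show ?thesis .
qed

lemma integrable_heat_kernel:
  assumes [measurable]: "\<phi> \<in> borel_measurable borel" and i: "set_integrable lborel {0<..} \<phi>"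
  shows "integrable lborel (heat_kernel \<phi> :: 'a::euclidean_space \<times> real \<Rightarrow> real)"
proof -
  have "(\<integral>\<^sup>+\<tau>. ennreal (indicator {0<..} \<tau> * \<bar>\<phi> \<tau>\<bar>) \<partial>lborel) < \<infinity>"
    using i by (simp add: set_integrable_def integrable_iff_bounded abs_mult)
  then show ?thesis
    unfolding integrable_iff_bounded using nn_integral_heat_kernel[OF assms(1), where 'a='a] by simp
qed

definition heat_sym :: "'a::euclidean_space \<times> real \<Rightarrow> complex" where
  "heat_sym = (\<lambda>(\<xi>, \<sigma>). complex_of_real ((2 * pi * norm \<xi>)\<^sup>2) + 2 * complex_of_real pi * \<i> * complex_of_real \<sigma>)"

lemma heat_symbol_eq: "heat_symbol s z = heat_sym z powr complex_of_real s"
  by (simp add: heat_symbol_def heat_sym_def split_beta)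

text \<open>The real part vanishes only on the line of zero spatial frequency. Hence Laplace
  transforms need to be known only in the open half-plane.\<close>

lemma AE_heat_sym_pos: "AE z in lborel. Re (heat_sym (z :: 'a::euclidean_space \<times> real)) > 0"
proof -
  have "{0 :: 'a} \<times> (UNIV :: real set) \<in> null_sets (lborel \<Otimes>\<^sub>M lborel)"
    by (auto simp: null_sets_def lborel.emeasure_pair_measure_Times)
  then have "AE z in lborel. z \<notin> {0 :: 'a} \<times> (UNIV :: real set)" unfolding lborel_prod by (rule AE_not_in)
  then show ?thesis by eventually_elim (auto simp: heat_sym_def split_beta)
qed

lemma gauss_wave_integral:
  fixes \<xi> :: "'a::euclidean_space"
  assumes e: "e > 0"
  shows "(LINT z|lborel. gauss e z *\<^sub>R wave (- z) \<xi>) = complex_of_real (exp (- pi * e * (norm \<xi>)\<^sup>2))"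
proof -
  have "gauss e z *\<^sub>R wave (- z) \<xi> = (e powr (- real DIM('a) / 2)) *\<^sub>R (exp (- pi * (1 / e) * (norm z)\<^sup>2) *\<^sub>R wave (- \<xi>) z)" for z :: 'a
    by (simp add: gauss_def wave_def inner_commute)
  then have "(LINT z|lborel. gauss e z *\<^sub>R wave (- z) \<xi>) = (e powr (- real DIM('a) / 2)) *\<^sub>R complex_of_real (gauss (1 / e) (- \<xi>))"
    using integral_gaussian_wave(2)[of "1 / e" "- \<xi>"] e by (simp only: integral_scaleR_right) simp
  also have "\<dots> = complex_of_real (exp (- pi * e * (norm \<xi>)\<^sup>2))"
  proof -
    have "(1 / e) powr (- real DIM('a) / 2) = e powr (real DIM('a) / 2)"
      using e by (simp add: powr_divide powr_minus_divide)
    moreover have "e powr (- real DIM('a) / 2) * e powr (real DIM('a) / 2) = 1" using e by (simp flip: powr_add)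
    ultimately have "e powr (- real DIM('a) / 2) * gauss (1 / e) (- \<xi>) = exp (- pi * e * (norm \<xi>)\<^sup>2)"
      by (simp add: gauss_def mult.assoc[symmetric])
    then show ?thesis by (simp only: scaleR_conv_of_real of_real_mult[symmetric])
  qed
  finally show ?thesis .
qed

text \<open>The space integral gives the real exponential in the squared frequency, the time phase
  the imaginary one; their product is the Laplace kernel at \<open>heat_sym z\<close>.\<close>

lemma khat_heat_kernel:
  assumes [measurable]: "\<phi> \<in> borel_measurable borel" and i: "set_integrable lborel {0<..} \<phi>"
  shows "khat (heat_kernel \<phi>) (z :: 'a::euclidean_space \<times> real) = laplace \<phi> (heat_sym z)"
proof -
  obtain \<xi> :: 'a and \<sigma> where z: "z = (\<xi>, \<sigma>)" by (cases z)
  have int: "integrable lborel (\<lambda>r. heat_kernel \<phi> r *\<^sub>R wave (- r) z)"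
    by (rule Bochner_Integration.integrable_bound[OF integrable_heat_kernel[OF assms]]) auto
  have "khat (heat_kernel \<phi>) z = (LINT \<tau>|lborel. LINT x|lborel. heat_kernel \<phi> (x, \<tau>) *\<^sub>R wave (- (x, \<tau>)) z)"
    unfolding khat_def by (rule integral_lborel_pair[OF int])
  also have "\<dots> = (LINT \<tau>|lborel. indicator {0<..} \<tau> *\<^sub>R (\<phi> \<tau> *\<^sub>R exp (- (complex_of_real \<tau> * heat_sym z))))"
  proof (rule Bochner_Integration.integral_cong[OF refl])
    fix \<tau> :: real
    let ?E = "exp (- (2 * complex_of_real pi * \<i> * complex_of_real (\<tau> * \<sigma>)))"
    have w: "wave (- (x, \<tau>)) z = wave (- x) \<xi> * ?E" for x
      unfolding wave_def exp_add[symmetric] by (intro arg_cong[where f=exp]) (simp add: z inner_prod_def algebra_simps)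
    have "(LINT x|lborel. heat_kernel \<phi> (x, \<tau>) *\<^sub>R wave (- (x, \<tau>)) z)
      = (LINT x|lborel. (indicator {0<..} \<tau> * \<phi> \<tau>) *\<^sub>R ((gauss (4 * pi * \<tau>) x *\<^sub>R wave (- x) \<xi>) * ?E))"
      by (intro Bochner_Integration.integral_cong refl) (simp only: heat_kernel_def prod.case w, simp)
    also have "\<dots> = (indicator {0<..} \<tau> * \<phi> \<tau>) *\<^sub>R ((LINT x|lborel. gauss (4 * pi * \<tau>) x *\<^sub>R wave (- x) \<xi>) * ?E)"
      unfolding integral_scaleR_right integral_mult_left_zero ..
    also have "\<dots> = indicator {0<..} \<tau> *\<^sub>R (\<phi> \<tau> *\<^sub>R exp (- (complex_of_real \<tau> * heat_sym z)))"
    proof (cases "\<tau> > 0")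
      case True
      have "complex_of_real (exp (- pi * (4 * pi * \<tau>) * (norm \<xi>)\<^sup>2)) * ?E = exp (- (complex_of_real \<tau> * heat_sym z))"
        by (simp add: exp_of_real[symmetric] exp_add[symmetric] heat_sym_def z algebra_simps power2_eq_square)
      then show ?thesis using True gauss_wave_integral[of "4 * pi * \<tau>" \<xi>] by simp
    qed simp
    finally show "(LINT x|lborel. heat_kernel \<phi> (x, \<tau>) *\<^sub>R wave (- (x, \<tau>)) z) = indicator {0<..} \<tau> *\<^sub>R (\<phi> \<tau> *\<^sub>R exp (- (complex_of_real \<tau> * heat_sym z)))" .
  qed
  also have "\<dots> = laplace \<phi> (heat_sym z)" by (simp add: laplace_def set_lebesgue_integral_def)
  finally show ?thesis .
qed

lemma measurable_densities [measurable]: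
  "bessel_density s \<in> borel_measurable borel" "defect_density s \<in> borel_measurable borel"
  "poisson_density s y \<in> borel_measurable borel" "conormal_density s y \<in> borel_measurable borel"
  unfolding bessel_density_def[abs_def] defect_density_def[abs_def] poisson_density_def[abs_def] conormal_density_def[abs_def]
  by measurable

section \<open>Representation formulas\<close>

text \<open>Both sides have the same spectral function, since \<open>(1 + m) powr (- s) * (m powr s
  + ((1 + m) powr s - m powr s)) = 1\<close>.\<close>

lemma bessel_representation:
  fixes u :: "(real ^ 'n::finite) \<times> real \<Rightarrow> complex"
  assumes s: "0 < s" "s < 1" and u: "spectral u g" and f: "spectral f (\<lambda>z. heat_symbol s z * g z)"
  shows "AE p in lborel. u p = conv (heat_kernel (bessel_density s)) (\<lambda>p. f p + conv (heat_kernel (defect_density s)) u p) p"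
proof -
  note iB = defect_density_integrable[OF s] and iG = bessel_density_integrable[OF s(1)]
  have "spectral (conv (heat_kernel (bessel_density s)) (\<lambda>p. f p + conv (heat_kernel (defect_density s)) u p))
      (\<lambda>z. khat (heat_kernel (bessel_density s)) z * (heat_symbol s z * g z + khat (heat_kernel (defect_density s)) z * g z))"
    by (intro spectral_conv spectral_add u f integrable_heat_kernel iB iG measurable_densities)
  moreover have "AE z in lborel. g z = khat (heat_kernel (bessel_density s)) z * (heat_symbol s z * g z + khat (heat_kernel (defect_density s)) z * g z)"
    using AE_heat_sym_pos
  proof eventually_elim
    case (elim z)
    let ?m = "heat_sym z"
    have ne: "1 + ?m \<noteq> 0" using elim by (auto simp: complex_eq_iff)
    have "heat_symbol s z * g z + khat (heat_kernel (defect_density s)) z * g z = (1 + ?m) powr complex_of_real s * g z"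
      by (simp add: khat_heat_kernel iB heat_symbol_eq laplace_defect_density[OF s elim] left_diff_distrib)
    then show ?case
      using laplace_bessel_density[OF s(1) elim] ne by (simp add: khat_heat_kernel iG powr_minus)
  qed
  ultimately show ?thesis by (intro spectral_unique[OF u])
qed

text \<open>The factor \<open>m powr s\<close> in the Laplace identity is the operator acting on
  \<open>u\<close>, so it converts the spectral function of \<open>u\<close> into that of
  \<open>f\<close>.\<close>

lemma conormal_representation:
  fixes u :: "(real ^ 'n::finite) \<times> real \<Rightarrow> complex"
  assumes s: "0 < s" "s < 1" and y: "y > 0" and u: "spectral u g" and f: "spectral f (\<lambda>z. heat_symbol s z * g z)"
  shows "AE p in lborel. conv (heat_kernel (conormal_density s y)) u p = - complex_of_real (2 * Gamma (1 - s)) * conv (heat_kernel (poisson_density (1 - s) y)) f p"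
proof -
  have iP: "set_integrable lborel {0<..} (poisson_density (1 - s) y)" using s y by (intro poisson_density_integrable) auto
  note iC = conormal_density_integrable[OF s(1) y]
  have "spectral (conv (heat_kernel (conormal_density s y)) u) (\<lambda>z. khat (heat_kernel (conormal_density s y)) z * g z)"
    by (intro spectral_conv u integrable_heat_kernel iC measurable_densities)
  moreover have "spectral (\<lambda>p. - complex_of_real (2 * Gamma (1 - s)) * conv (heat_kernel (poisson_density (1 - s) y)) f p)
     (\<lambda>z. - complex_of_real (2 * Gamma (1 - s)) * (khat (heat_kernel (poisson_density (1 - s) y)) z * (heat_symbol s z * g z)))"
    by (intro spectral_conv spectral_cmult f integrable_heat_kernel iP measurable_densities)
  moreover have "AE z in lborel. khat (heat_kernel (conormal_density s y)) z * g z
     = - complex_of_real (2 * Gamma (1 - s)) * (khat (heat_kernel (poisson_density (1 - s) y)) z * (heat_symbol s z * g z))"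
    using AE_heat_sym_pos
  proof eventually_elim
    case (elim z)
    then show ?case using laplace_conormal_density[OF s y elim]
      by (simp add: khat_heat_kernel iC iP heat_symbol_eq mult_ac)
  qed
  ultimately show ?thesis by (rule spectral_unique)
qed

section \<open>Boundedness from a small convolution operator\<close>

lemma ennreal_sum_power2_le: "(a + b)\<^sup>2 \<le> 2 * a\<^sup>2 + 2 * (b\<^sup>2 :: ennreal)"
proof (cases "a = top \<or> b = top")
  case True
  then show ?thesis by (auto simp: power2_eq_square ennreal_mult_top ennreal_top_mult)
next
  case False
  then obtain x y where xy: "a = ennreal x" "b = ennreal y" "x \<ge> 0" "y \<ge> 0" by (metis ennreal_cases)
  have "(x + y)\<^sup>2 \<le> 2 * x\<^sup>2 + 2 * y\<^sup>2" using sum_squares_bound[of x y] by (simp add: power2_sum)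
  then have "ennreal ((x + y)\<^sup>2) \<le> ennreal (2 * x\<^sup>2 + 2 * y\<^sup>2)" by (rule ennreal_leI)
  also have "ennreal (2 * x\<^sup>2 + 2 * y\<^sup>2) = 2 * (ennreal x)\<^sup>2 + 2 * (ennreal y)\<^sup>2"
    using xy by (subst ennreal_plus) (auto simp: ennreal_mult ennreal_power)
  finally show ?thesis using xy by (simp add: ennreal_power flip: ennreal_plus)
qed

text \<open>
  If \<open>|u| \<le> G\<^sub>1 * (C |u| + B * |u|) + b\<close> and the first operator is a contraction by \<open>1/2\<close>, both on
  \<open>L\<^sup>2\<close> and on constants, then \<open>(|u| - 2b)\<^sup>+\<close> is dominated by its own image, hence vanishes.
\<close>
lemma bounded_if_small_convolution:
  fixes u :: "'a::euclidean_space \<Rightarrow> complex" and G1 B :: "'a \<Rightarrow> ennreal"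
  assumes u: "sq_int u"
    and [measurable]: "G1 \<in> borel_measurable borel" "B \<in> borel_measurable borel"
    and C: "C \<ge> 0" and b: "b \<ge> 0" and k: "k \<ge> 0" "k * (C + 1) \<le> 1 / 4"
    and G1: "(\<integral>\<^sup>+r. G1 r \<partial>lborel) \<le> ennreal k" and B: "(\<integral>\<^sup>+r. B r \<partial>lborel) \<le> 1"
    and le: "AE p in lborel. ennreal (cmod (u p)) \<le> nnconv G1 (\<lambda>p. ennreal C * ennreal (cmod (u p)) + nnconv B (\<lambda>p. ennreal (cmod (u p))) p) p + ennreal b"
  shows "AE p in lborel. cmod (u p) \<le> 2 * b"
proof -
  note [measurable] = sq_intD[OF u]
  define v where "v = (\<lambda>p. ennreal (cmod (u p)))"
  \<comment> \<open>\<open>ennreal\<close> sends negative numbers to 0, so this is the positive part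
    of \<open>|u| - 2 * b\<close>.\<close>
  define w where "w = (\<lambda>p. ennreal (cmod (u p) - 2 * b))"
  define H where "H = (\<lambda>p. ennreal C * w p + nnconv B w p)"
  have [measurable]: "v \<in> borel_measurable borel" "w \<in> borel_measurable borel" "H \<in> borel_measurable borel"
    unfolding v_def w_def H_def by measurable
  have vw: "v p \<le> w p + ennreal (2 * b)" for p
  proof -
    have "v p \<le> ennreal (max 0 (cmod (u p) - 2 * b) + 2 * b)" unfolding v_def by (intro ennreal_leI) simp
    also have "\<dots> = w p + ennreal (2 * b)"
      using b by (subst ennreal_plus) (auto simp: w_def max_def ennreal_neg)
    finally show ?thesis .
  qed
  have Bv: "nnconv B v p \<le> nnconv B w p + ennreal (2 * b)" for p
  proof -
    have "nnconv B v p \<le> (\<integral>\<^sup>+r. B r * w (p - r) + B r * ennreal (2 * b) \<partial>lborel)"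
      unfolding nnconv_def using vw by (intro nn_integral_mono) (auto simp: distrib_left[symmetric] intro!: mult_left_mono)
    also have "\<dots> = nnconv B w p + (\<integral>\<^sup>+r. B r \<partial>lborel) * ennreal (2 * b)"
      unfolding nnconv_def by (subst nn_integral_add) (auto simp: nn_integral_multc)
    also have "\<dots> \<le> nnconv B w p + 1 * ennreal (2 * b)" by (intro add_left_mono mult_right_mono B) simp
    finally show ?thesis by simp
  qed
  have Hv: "ennreal C * v p + nnconv B v p \<le> H p + ennreal (2 * b * (C + 1))" for p
  proof -
    have "ennreal C * v p + nnconv B v p \<le> ennreal C * (w p + ennreal (2 * b)) + (nnconv B w p + ennreal (2 * b))"
      by (intro add_mono mult_left_mono vw Bv) simp
    also have "\<dots> = H p + (ennreal C * ennreal (2 * b) + ennreal (2 * b))"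
      by (simp add: H_def distrib_left add_ac)
    also have "ennreal C * ennreal (2 * b) + ennreal (2 * b) = ennreal (2 * b * (C + 1))"
    proof -
      have "2 * b * (C + 1) = C * (2 * b) + 2 * b" by (simp add: algebra_simps)
      then show ?thesis using C b by (simp only:) (subst ennreal_plus, auto simp: ennreal_mult)
    qed
    finally show ?thesis .
  qed
  have G1v: "nnconv G1 (\<lambda>p. ennreal C * v p + nnconv B v p) p \<le> nnconv G1 H p + ennreal b" for p
  proof -
    have "nnconv G1 (\<lambda>p. ennreal C * v p + nnconv B v p) p \<le> (\<integral>\<^sup>+r. G1 r * H (p - r) + G1 r * ennreal (2 * b * (C + 1)) \<partial>lborel)"
      unfolding nnconv_def[of G1] using Hv by (intro nn_integral_mono) (auto simp: distrib_left[symmetric] intro!: mult_left_mono)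
    also have "\<dots> = nnconv G1 H p + (\<integral>\<^sup>+r. G1 r \<partial>lborel) * ennreal (2 * b * (C + 1))"
      unfolding nnconv_def by (subst nn_integral_add) (auto simp: nn_integral_multc)
    also have "\<dots> \<le> nnconv G1 H p + ennreal k * ennreal (2 * b * (C + 1))" by (intro add_left_mono mult_right_mono G1) simp
    also have "\<dots> \<le> nnconv G1 H p + ennreal b"
    proof (intro add_left_mono)
      \<comment> \<open>The constant part contributes at most \<open>b\<close> by
        \<open>k * (C + 1) \<le> 1 / 4\<close>; with the \<open>b\<close> of the hypothesis this
        makes the \<open>2 * b\<close> that \<open>w\<close> subtracts.\<close>
      have "k * (2 * b * (C + 1)) \<le> b" using mult_left_mono[OF k(2), of "2 * b"] b by (simp add: algebra_simps)
      then show "ennreal k * ennreal (2 * b * (C + 1)) \<le> ennreal b"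
        using k b C by (simp add: ennreal_mult[symmetric])
    qed
    finally show ?thesis .
  qed
  have wle: "AE p in lborel. w p \<le> nnconv G1 H p"
    using le
  proof eventually_elim
    case (elim p)
    then have "v p \<le> nnconv G1 H p + ennreal b + ennreal b"
      using G1v[of p] unfolding v_def by (meson add_right_mono order_trans)
    then have "v p \<le> nnconv G1 H p + ennreal (2 * b)" using b by (simp add: add.assoc flip: ennreal_plus)
    show ?case
    proof (cases "cmod (u p) \<le> 2 * b")
      case True
      then show ?thesis by (simp add: w_def ennreal_neg)
    next
      case False
      then have "v p = w p + ennreal (2 * b)" using b unfolding v_def w_def by (simp flip: ennreal_plus)
      then have "w p + ennreal (2 * b) \<le> nnconv G1 H p + ennreal (2 * b)"
        using \<open>v p \<le> nnconv G1 H p + ennreal (2 * b)\<close> by simp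
      then show ?thesis unfolding add.commute[of _ "ennreal (2 * b)"] by (simp add: ennreal_add_left_cancel_le)
    qed
  qed
  define W where "W = (\<integral>\<^sup>+p. (w p)\<^sup>2 \<partial>lborel)"
  have "W \<le> (\<integral>\<^sup>+p. (v p)\<^sup>2 \<partial>lborel)"
    unfolding W_def by (intro nn_integral_mono power_mono) (auto simp: w_def v_def b intro!: ennreal_leI)
  also have "\<dots> < top" using u unfolding v_def by (simp add: sq_int_iff)
  finally have Wfin: "W < top" .
  have "W \<le> (\<integral>\<^sup>+p. (nnconv G1 H p)\<^sup>2 \<partial>lborel)"
    unfolding W_def by (rule nn_integral_mono_AE, use wle in eventually_elim) (rule power_mono, auto)
  also have "\<dots> \<le> (\<integral>\<^sup>+r. G1 r \<partial>lborel)\<^sup>2 * (\<integral>\<^sup>+p. (H p)\<^sup>2 \<partial>lborel)" by (rule young_L2) measurable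
  also have "\<dots> \<le> (ennreal k)\<^sup>2 * (2 * (ennreal C)\<^sup>2 * W + 2 * W)"
  proof (intro mult_mono power_mono G1)
    have "(\<integral>\<^sup>+p. (H p)\<^sup>2 \<partial>lborel) \<le> (\<integral>\<^sup>+p. 2 * (ennreal C)\<^sup>2 * (w p)\<^sup>2 + 2 * (nnconv B w p)\<^sup>2 \<partial>lborel)"
      unfolding H_def
      by (intro nn_integral_mono order_trans[OF ennreal_sum_power2_le]) (simp add: power_mult_distrib mult.assoc)
    also have "\<dots> = 2 * (ennreal C)\<^sup>2 * W + 2 * (\<integral>\<^sup>+p. (nnconv B w p)\<^sup>2 \<partial>lborel)"
      unfolding W_def by (subst nn_integral_add) (auto simp: nn_integral_cmult)
    also have "(\<integral>\<^sup>+p. (nnconv B w p)\<^sup>2 \<partial>lborel) \<le> (\<integral>\<^sup>+r. B r \<partial>lborel)\<^sup>2 * W" unfolding W_def by (rule young_L2) measurable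
    also have "\<dots> \<le> 1\<^sup>2 * W" by (intro mult_right_mono power_mono B) auto
    finally show "(\<integral>\<^sup>+p. (H p)\<^sup>2 \<partial>lborel) \<le> 2 * (ennreal C)\<^sup>2 * W + 2 * W" by (simp add: mult_left_mono add_left_mono)
  qed auto
  finally have Wle: "W \<le> (ennreal k)\<^sup>2 * (2 * (ennreal C)\<^sup>2 * W + 2 * W)" .
  obtain x where x: "W = ennreal x" "x \<ge> 0" using Wfin by (cases W) auto
  have "(ennreal k)\<^sup>2 * (2 * (ennreal C)\<^sup>2 * W + 2 * W) = ennreal (k\<^sup>2 * (2 * C\<^sup>2 * x + 2 * x))"
    using x k C by (simp add: ennreal_power ennreal_mult ennreal_plus)
  with Wle have "x \<le> k\<^sup>2 * (2 * C\<^sup>2 * x + 2 * x)" using x k C by simp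
  \<comment> \<open>The factor is at most \<open>2 * (1 / 4)\<^sup>2\<close>, an eighth; a finite
    \<open>x\<close> bounded by an eighth of itself is 0.\<close>
  also have "\<dots> \<le> 2 * (k * (C + 1))\<^sup>2 * x"
  proof -
    have "2 * C\<^sup>2 * x + 2 * x \<le> 2 * (C + 1)\<^sup>2 * x" using C x by (simp add: power2_sum algebra_simps)
    then have "k\<^sup>2 * (2 * C\<^sup>2 * x + 2 * x) \<le> k\<^sup>2 * (2 * (C + 1)\<^sup>2 * x)" by (rule mult_left_mono) simp
    then show ?thesis by (simp add: power_mult_distrib mult_ac)
  qed
  also have "\<dots> \<le> 2 * (1 / 4)\<^sup>2 * x"
    using k C x by (intro mult_right_mono mult_left_mono power_mono) auto
  finally have "x = 0" using x by (simp add: power2_eq_square)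
  then have "W = 0" using x by simp
  then have "AE p in lborel. (w p)\<^sup>2 = 0" unfolding W_def by (subst (asm) nn_integral_0_iff_AE) auto
  then show ?thesis by eventually_elim (auto simp: w_def ennreal_eq_0_iff)
qed

section \<open>Modulus of continuity of the Bessel kernel\<close>

text \<open>After reflection both convolutions integrate the same \<open>F r\<close> against
  \<open>G (p - r)\<close> and \<open>G (q - r)\<close>, so only the L1 distance between
  \<open>G\<close> and a translate matters. Forward time shifts suffice since \<open>p\<close> and
  \<open>q\<close> may be exchanged.\<close>

lemma holder_of_L1_modulus:
  fixes G :: "'a::euclidean_space \<times> real \<Rightarrow> real" and F :: "'a \<times> real \<Rightarrow> complex"
  assumes G: "integrable lborel G" and [measurable]: "F \<in> borel_measurable borel"
    and F: "\<And>p. cmod (F p) \<le> L"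
    and mod: "\<And>e. snd e \<ge> 0 \<Longrightarrow> (LINT r|lborel. \<bar>G (r + e) - G r\<bar>) \<le> K * parabolic_dist e 0 powr \<alpha>"
  shows "cmod (conv G F p - conv G F q) \<le> L * K * parabolic_dist p q powr \<alpha>"
proof -
  note [measurable] = borel_measurable_integrable[OF G]
  have L: "L \<ge> 0" using F[of 0] norm_ge_zero order_trans by blast
  have *: "cmod (conv G F p - conv G F q) \<le> L * K * parabolic_dist p q powr \<alpha>" if "snd p \<ge> snd q" for p q
  proof -
    have iG: "integrable lborel (\<lambda>r. G (p - r) *\<^sub>R F r)" for p
    proof (rule Bochner_Integration.integrable_bound)
      show "integrable lborel (\<lambda>r. norm (G (p - r)) * L)"
        using integrable_norm[OF integrable_lborel_reflect[OF G, of p]] by simp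
      show "AE r in lborel. norm (G (p - r) *\<^sub>R F r) \<le> norm (norm (G (p - r)) * L)"
        by (intro AE_I2) (simp add: abs_mult L F mult_left_mono)
    qed measurable
    have cG: "conv G F p = (LINT r|lborel. G (p - r) *\<^sub>R F r)" for p
      unfolding conv_def using integral_lborel_reflect[of "\<lambda>r. G (p - r) *\<^sub>R F r" p] by simp
    have iD: "integrable lborel (\<lambda>r. G (p - r) - G (q - r))"
      by (intro Bochner_Integration.integrable_diff integrable_lborel_reflect G)
    have "conv G F p - conv G F q = (LINT r|lborel. (G (p - r) - G (q - r)) *\<^sub>R F r)"
      unfolding cG by (subst Bochner_Integration.integral_diff[symmetric, OF iG iG]) (simp add: scaleR_left_diff_distrib)
    also have "cmod \<dots> \<le> (LINT r|lborel. cmod ((G (p - r) - G (q - r)) *\<^sub>R F r))" by (rule integral_norm_bound)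
    also have "\<dots> \<le> (LINT r|lborel. \<bar>G (p - r) - G (q - r)\<bar> * L)"
    proof (rule integral_mono)
      show "integrable lborel (\<lambda>r. cmod ((G (p - r) - G (q - r)) *\<^sub>R F r))"
        unfolding scaleR_left_diff_distrib by (intro integrable_norm Bochner_Integration.integrable_diff iG)
      show "integrable lborel (\<lambda>r. \<bar>G (p - r) - G (q - r)\<bar> * L)" using integrable_norm[OF iD] by simp
      show "cmod ((G (p - r) - G (q - r)) *\<^sub>R F r) \<le> \<bar>G (p - r) - G (q - r)\<bar> * L" for r
        using F[of r] by (simp add: mult_left_mono)
    qed
    also have "\<dots> = L * (LINT r|lborel. \<bar>G (p - r) - G (q - r)\<bar>)" by simp
    also have "(LINT r|lborel. \<bar>G (p - r) - G (q - r)\<bar>) = (LINT r|lborel. \<bar>G (r + (p - q)) - G r\<bar>)"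
      using integral_lborel_reflect[of "\<lambda>r. \<bar>G (r + (p - q)) - G r\<bar>" q] by (simp add: algebra_simps)
    also have "\<dots> \<le> K * parabolic_dist (p - q) 0 powr \<alpha>" using that by (intro mod) simp
    also have "parabolic_dist (p - q) 0 = parabolic_dist p q" by (simp add: parabolic_dist_def)
    finally show ?thesis using L by (simp add: mult_left_mono mult.assoc)
  qed
  show ?thesis
  proof (cases "snd p \<ge> snd q")
    case False
    then have "cmod (conv G F q - conv G F p) \<le> L * K * parabolic_dist q p powr \<alpha>" by (intro *) simp
    moreover have "parabolic_dist q p = parabolic_dist p q"
      by (simp add: parabolic_dist_def norm_minus_commute abs_minus_commute)
    ultimately show ?thesis by (simp add: norm_minus_commute)
  qed (rule *)
qed

text \<open>For two densities of equal mass the positive and negative parts of the difference have equal mass.\<close>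
lemma integral_abs_diff_le:
  fixes f g h :: "'a::euclidean_space \<Rightarrow> real"
  assumes f: "integrable lborel f" and g: "integrable lborel g" and h: "integrable lborel h"
    and eq: "(LINT r|lborel. f r) = (LINT r|lborel. g r)"
    and le: "\<And>r. f r - g r \<le> h r" and h0: "\<And>r. 0 \<le> h r"
  shows "(LINT r|lborel. \<bar>g r - f r\<bar>) \<le> 2 * (LINT r|lborel. h r)"
proof -
  have "(LINT r|lborel. \<bar>g r - f r\<bar>) \<le> (LINT r|lborel. 2 * h r - (f r - g r))"
  proof (rule integral_mono)
    show "integrable lborel (\<lambda>r. \<bar>g r - f r\<bar>)"
      by (intro integrable_abs Bochner_Integration.integrable_diff f g)
    show "integrable lborel (\<lambda>r. 2 * h r - (f r - g r))"
      by (intro Bochner_Integration.integrable_diff integrable_mult_right f g h)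
    show "\<bar>g r - f r\<bar> \<le> 2 * h r - (f r - g r)" for r using le[of r] h0[of r] by linarith
  qed
  also have "\<dots> = (LINT r|lborel. 2 * h r) - (LINT r|lborel. f r - g r)"
    by (rule Bochner_Integration.integral_diff) (intro Bochner_Integration.integrable_diff integrable_mult_right f g h)+
  also have "(LINT r|lborel. f r - g r) = (LINT r|lborel. f r) - (LINT r|lborel. g r)"
    by (rule Bochner_Integration.integral_diff[OF f g])
  finally show ?thesis by (simp add: eq)
qed

lemma one_minus_exp_le_powr:
  fixes X \<theta> :: real assumes "X \<ge> 0" "0 \<le> \<theta>" "\<theta> \<le> 1"
  shows "1 - exp (- X) \<le> X powr \<theta>"
proof (cases "X = 0")
  case False
  then have X: "X > 0" using assms by simp
  show ?thesis
  proof (cases "X \<le> 1")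
    case True
    have "1 - exp (- X) \<le> X" using exp_ge_add_one_self[of "- X"] by linarith
    also have "X powr 1 \<le> X powr \<theta>" using X True assms by (intro powr_mono') auto
    then have "X \<le> X powr \<theta>" using X by simp
    finally show ?thesis .
  next
    case False
    have "1 - exp (- X) \<le> 1" by simp
    also have "1 \<le> X powr \<theta>" using False assms by (intro ge_one_powr_ge_zero) auto
    finally show ?thesis .
  qed
qed simp

lemma one_minus_exp_add_le:
  fixes X Y :: real assumes "X \<ge> 0" "Y \<ge> 0"
  shows "1 - exp (- (X + Y)) \<le> (1 - exp (- X)) + (1 - exp (- Y))"
proof -
  have "0 \<le> (1 - exp (- X)) * (1 - exp (- Y))" using assms by (intro mult_nonneg_nonneg) auto
  then show ?thesis by (simp add: algebra_simps flip: exp_add)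
qed

text \<open>Subadditivity, because a fraction \<open>x\<close> in the unit interval satisfies
  \<open>x \<le> x powr \<theta>\<close>.\<close>

lemma powr_one_plus_le:
  fixes a b \<theta> :: real assumes "a \<ge> 0" "b \<ge> 0" "0 \<le> \<theta>" "\<theta> \<le> 1"
  shows "(a + b) powr \<theta> \<le> a powr \<theta> + b powr \<theta>"
proof (cases "a + b = 0")
  case False
  then have p: "a + b > 0" using assms by simp
  have *: "x / (a + b) \<le> (x / (a + b)) powr \<theta>" if "0 \<le> x" "x \<le> a + b" for x
  proof (cases "x = 0")
    case False
    have "(x / (a + b)) powr 1 \<le> (x / (a + b)) powr \<theta>"
      using that False p assms by (intro powr_mono') auto
    then show ?thesis using that p by simp
  qed simp
  have "1 = a / (a + b) + b / (a + b)" using p by (simp add: add_divide_distrib[symmetric])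
  also have "\<dots> \<le> (a / (a + b)) powr \<theta> + (b / (a + b)) powr \<theta>" using assms by (intro add_mono *) auto
  also have "\<dots> = (a powr \<theta> + b powr \<theta>) / (a + b) powr \<theta>"
    using assms p by (simp add: powr_divide add_divide_distrib)
  finally show ?thesis using p by (simp add: field_simps)
qed (use assms in simp)

text \<open>With \<open>X = pi * (norm z)\<^sup>2 / (2 * e)\<close> the moment is
  \<open>2 * X\<close>, and \<open>X * exp (- 2 * X) \<le> exp (- X)\<close> absorbs it into the
  Gaussian of doubled parameter; the power of 2 restores the normalization.\<close>

lemma gauss_moment_le:
  assumes e: "e > 0"
  shows "gauss e (z::'a::euclidean_space) * (1 + pi * (norm z)\<^sup>2 / e) \<le> gauss e z + 2 * 2 powr (real DIM('a) / 2) * gauss (2 * e) z"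
proof -
  define X where "X = pi * (norm z)\<^sup>2 / (2 * e)"
  have X: "X \<le> exp X" using exp_ge_add_one_self[of X] by linarith
  have "exp (- 2 * X) * X \<le> exp (- 2 * X) * exp X" using X by (rule mult_left_mono) simp
  also have "\<dots> = exp (- X)" by (simp flip: exp_add)
  finally have "e powr (- real DIM('a) / 2) * (exp (- 2 * X) * X) \<le> e powr (- real DIM('a) / 2) * exp (- X)" by (rule mult_left_mono) simp
  moreover have "gauss e z = e powr (- real DIM('a) / 2) * exp (- 2 * X)" using e by (simp add: gauss_def X_def)
  moreover have "2 powr (real DIM('a) / 2) * gauss (2 * e) z = e powr (- real DIM('a) / 2) * exp (- X)"
  proof -
    have "2 powr (real DIM('a) / 2) * (2 * e) powr (- real DIM('a) / 2) = e powr (- real DIM('a) / 2)"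
      using e by (simp add: powr_mult mult.assoc[symmetric] flip: powr_add)
    then show ?thesis by (simp add: gauss_def X_def mult.assoc[symmetric])
  qed
  moreover have "pi * (norm z)\<^sup>2 / e = 2 * X" using e by (simp add: X_def)
  ultimately show ?thesis by (simp add: algebra_simps)
qed

text \<open>Each time slice has mass \<open>1 + c\<close> times the density, so majorants obtained
  from \<open>gauss_moment_le\<close> are integrable together with the density.\<close>

lemma integrable_gauss_moment:
  fixes \<phi> :: "real \<Rightarrow> real"
  assumes [measurable]: "\<phi> \<in> borel_measurable borel" and pos: "\<And>\<tau>. \<tau> > 0 \<Longrightarrow> \<phi> \<tau> \<ge> 0"
    and int: "set_integrable lborel {0<..} \<phi>" and c: "c \<ge> 0"
  shows "integrable lborel (\<lambda>(z :: 'a::euclidean_space, \<tau>). indicator {0<..} \<tau> * \<phi> \<tau> * (gauss (4 * pi * \<tau>) z + c * gauss (2 * (4 * pi * \<tau>)) z))"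
proof -
  define H where "H = (\<lambda>(z :: 'a, \<tau>). indicator {0<..} \<tau> * \<phi> \<tau> * (gauss (4 * pi * \<tau>) z + c * gauss (2 * (4 * pi * \<tau>)) z))"
  have Hm[measurable]: "H \<in> borel_measurable borel" unfolding H_def borel_prod[symmetric] by measurable
  have H0: "H r \<ge> 0" for r using pos c by (cases r) (auto simp: H_def indicator_def)
  have Hn: "(\<integral>\<^sup>+r. ennreal (H r) \<partial>lborel) = (\<integral>\<^sup>+\<tau>. ennreal (indicator {0<..} \<tau> * \<phi> \<tau>) * ennreal (1 + c) \<partial>lborel)"
  proof -
    have "(\<integral>\<^sup>+r. ennreal (H r) \<partial>lborel) = (\<integral>\<^sup>+\<tau>. \<integral>\<^sup>+z. ennreal (H (z, \<tau>)) \<partial>lborel \<partial>lborel)"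
      by (rule nn_integral_lborel_pair) measurable
    also have "\<dots> = (\<integral>\<^sup>+\<tau>. ennreal (indicator {0<..} \<tau> * \<phi> \<tau>) * ennreal (1 + c) \<partial>lborel)"
    proof (rule nn_integral_cong)
      fix \<tau> :: real
      show "(\<integral>\<^sup>+z. ennreal (H (z, \<tau>)) \<partial>lborel) = ennreal (indicator {0<..} \<tau> * \<phi> \<tau>) * ennreal (1 + c)"
      proof (cases "\<tau> > 0")
        case True
        have "(\<integral>\<^sup>+z. ennreal (H (z, \<tau>)) \<partial>lborel) = (\<integral>\<^sup>+z. ennreal (\<phi> \<tau>) * (ennreal (gauss (4 * pi * \<tau>) (z::'a)) + ennreal c * ennreal (gauss (2 * (4 * pi * \<tau>)) z)) \<partial>lborel)"
          using True pos[OF True] c by (intro nn_integral_cong) (simp add: H_def ennreal_mult ennreal_plus)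
        also have "\<dots> = ennreal (\<phi> \<tau>) * (\<integral>\<^sup>+z. ennreal (gauss (4 * pi * \<tau>) (z::'a)) + ennreal c * ennreal (gauss (2 * (4 * pi * \<tau>)) z) \<partial>lborel)"
          by (rule nn_integral_cmult) measurable
        also have "(\<integral>\<^sup>+z. ennreal (gauss (4 * pi * \<tau>) (z::'a)) + ennreal c * ennreal (gauss (2 * (4 * pi * \<tau>)) z) \<partial>lborel) = 1 + ennreal c * 1"
          using True by (subst nn_integral_add, simp, simp, subst nn_integral_cmult, simp) (simp add: nn_integral_gauss)
        finally show ?thesis using True c by (simp add: ennreal_plus)
      qed (simp add: H_def)
    qed
    finally show ?thesis .
  qed
  have "integrable lborel H"
  proof (subst integrable_iff_bounded, intro conjI)
    have "(\<integral>\<^sup>+\<tau>. ennreal (indicator {0<..} \<tau> * \<phi> \<tau>) \<partial>lborel) < \<infinity>"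
    proof -
      have "(\<integral>\<^sup>+\<tau>. ennreal (norm (indicator {0<..} \<tau> *\<^sub>R \<phi> \<tau>)) \<partial>lborel) < \<infinity>"
        using int unfolding set_integrable_def integrable_iff_bounded by blast
      moreover have "norm (indicator {0<..} \<tau> *\<^sub>R \<phi> \<tau>) = indicator {0<..} \<tau> * \<phi> \<tau>" for \<tau>
        using pos[of \<tau>] by (auto simp: indicator_def)
      ultimately show ?thesis by simp
    qed
    then have "(\<integral>\<^sup>+r. ennreal (H r) \<partial>lborel) < \<infinity>"
      unfolding Hn by (subst nn_integral_multc) (auto simp: ennreal_mult_less_top)
    then show "(\<integral>\<^sup>+r. ennreal (norm (H r)) \<partial>lborel) < \<infinity>" using H0 by simp
  qed measurable
  then show ?thesis unfolding H_def .
qed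

text \<open>A forward shift in time enlarges the denominator of the exponent, so only the spatial
  shift makes it worse; the normalization loses a power of
  \<open>\<tau> / (\<tau> + k)\<close>.\<close>

lemma gauss_shift_lower_bound:
  fixes z e :: "'a::euclidean_space"
  assumes t: "\<tau> > 0" and k: "k \<ge> 0"
  shows "gauss (4 * pi * (\<tau> + k)) (z + e) \<ge> gauss (4 * pi * \<tau>) z * ((\<tau> / (\<tau> + k)) powr (real DIM('a) / 2) * exp (- ((2 * norm z * norm e + (norm e)\<^sup>2) / (4 * \<tau>))))"
proof -
  let ?N = "real DIM('a) / 2"
  have "(norm (z + e))\<^sup>2 \<le> (norm z)\<^sup>2 + (2 * norm z * norm e + (norm e)\<^sup>2)"
    using power_mono[OF norm_triangle_ineq[of z e], of 2] by (simp add: power2_sum)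
  then have "(norm (z + e))\<^sup>2 / (4 * (\<tau> + k)) \<le> ((norm z)\<^sup>2 + (2 * norm z * norm e + (norm e)\<^sup>2)) / (4 * \<tau>)"
    using t k by (intro frac_le) auto
  then have "exp (- ((norm z)\<^sup>2 / (4 * \<tau>))) * exp (- ((2 * norm z * norm e + (norm e)\<^sup>2) / (4 * \<tau>))) \<le> exp (- ((norm (z + e))\<^sup>2 / (4 * (\<tau> + k))))"
    by (simp add: add_divide_distrib flip: exp_add)
  then have "(4 * pi * (\<tau> + k)) powr (- ?N) * (exp (- ((norm z)\<^sup>2 / (4 * \<tau>))) * exp (- ((2 * norm z * norm e + (norm e)\<^sup>2) / (4 * \<tau>))))
    \<le> (4 * pi * (\<tau> + k)) powr (- ?N) * exp (- ((norm (z + e))\<^sup>2 / (4 * (\<tau> + k))))" by (rule mult_left_mono) simp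
  moreover have "(4 * pi * (\<tau> + k)) powr (- ?N) = (4 * pi * \<tau>) powr (- ?N) * (\<tau> / (\<tau> + k)) powr ?N"
    using t k by (simp add: powr_mult powr_divide powr_minus_divide)
  moreover have "pi * x / (4 * pi * y) = x / (4 * y)" for x y :: real by simp
  ultimately show ?thesis using t k unfolding gauss_def by (simp add: mult_ac)
qed

lemma bessel_density_shift_lower_bound:
  assumes s: "0 < s" "s < 1" and t: "\<tau> > 0" and k: "k \<ge> 0"
  shows "bessel_density s (\<tau> + k) = bessel_density s \<tau> * ((\<tau> / (\<tau> + k)) powr (1 - s) * exp (- k))"
proof -
  have "(\<tau> + k) powr (s - 1) = \<tau> powr (s - 1) * (\<tau> / (\<tau> + k)) powr (1 - s)"
  proof -
    have "\<tau> powr (s - 1) * \<tau> powr (1 - s) = 1" using t by (simp flip: powr_add)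
    moreover have "(\<tau> + k) powr (s - 1) = 1 / (\<tau> + k) powr (1 - s)" using powr_minus_divide[of "\<tau> + k" "1 - s"] by simp
    ultimately show ?thesis using t k by (simp add: powr_divide)
  qed
  then show ?thesis by (simp add: bessel_density_def exp_add[symmetric] mult_ac)
qed

lemma ratio_powr_lower_bound:
  fixes \<tau> k N :: real
  assumes t: "\<tau> > 0" and k: "k \<ge> 0" and N: "N \<ge> 0"
  shows "exp (- (N * k / \<tau>)) \<le> (\<tau> / (\<tau> + k)) powr N"
proof -
  have "1 + k / \<tau> \<le> exp (k / \<tau>)" by (rule exp_ge_add_one_self)
  then have "(1 + k / \<tau>) powr N \<le> exp (k / \<tau>) powr N" using t k N by (intro powr_mono2) auto
  also have "\<dots> = exp (N * k / \<tau>)" by (simp add: powr_def)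
  finally have le: "(1 + k / \<tau>) powr N \<le> exp (N * k / \<tau>)" .
  have "1 + k / \<tau> > 0" using t k by (simp add: add_pos_nonneg)
  with le have "1 / exp (N * k / \<tau>) \<le> 1 / (1 + k / \<tau>) powr N" by (intro frac_le) auto
  also have "1 / (1 + k / \<tau>) powr N = (\<tau> / (\<tau> + k)) powr N"
  proof -
    have "1 + k / \<tau> = (\<tau> + k) / \<tau>" using t by (simp add: field_simps)
    then show ?thesis using t k by (simp add: powr_divide)
  qed
  finally show ?thesis by (simp add: exp_minus divide_inverse)
qed

lemma bessel_kernel_nonneg:
  assumes "s > 0" shows "heat_kernel (bessel_density s) r \<ge> 0"
  using assms by (cases r) (auto simp: heat_kernel_def bessel_density_def indicator_def intro!: mult_nonneg_nonneg divide_nonneg_nonneg Gamma_real_nonneg)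

text \<open>The shifted kernel is at least \<open>exp (- (X1 + X2))\<close> times the kernel, so the
  drop is at most \<open>?G r * (X1 powr (\<alpha> / 2) + X2 powr \<alpha>)\<close>. A wider
  Gaussian absorbs the powers of \<open>z\<close>, and \<open>\<tau> powr (- \<alpha> / 2)\<close>
  is integrable against the density. As translation preserves mass, a bound on drops bounds the L1
  distance.\<close>

lemma bessel_kernel_modulus:
  fixes s :: real
  assumes s: "0 < s" "s < 1" and a: "0 < \<alpha>" "\<alpha> \<le> s"
  shows "\<exists>K\<ge>0. \<forall>e :: 'a::euclidean_space \<times> real. snd e \<ge> 0 \<longrightarrow>
    (LINT r|lborel. \<bar>heat_kernel (bessel_density s) (r + e) - heat_kernel (bessel_density s) r\<bar>) \<le> K * parabolic_dist e 0 powr \<alpha>"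
proof -
  let ?G = "heat_kernel (bessel_density s) :: 'a \<times> real \<Rightarrow> real"
  define n where "n = real DIM('a)"
  \<comment> \<open>Order of the loss in \<open>\<tau> / (\<tau> + k)\<close>: \<open>n / 2\<close>
    from the Gaussian and \<open>1 - s\<close> from the density.\<close>
  define N where "N = n / 2 + (1 - s)"
  have N: "N \<ge> 0" using s by (simp add: N_def n_def)
  define c where "c = 2 * 2 powr (n / 2)"
  have c: "c \<ge> 0" by (simp add: c_def)
  \<comment> \<open>The constant \<open>N + 2\<close> is \<open>N + 1\<close> from the estimate of
    \<open>X1\<close> plus 1 from that of \<open>X2\<close>.\<close>
  define \<psi> where "\<psi> = (\<lambda>\<tau>. bessel_density s \<tau> * (1 + (N + 2) * \<tau> powr (- \<alpha> / 2)))"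
  define H where "H = (\<lambda>(z :: 'a, \<tau>). indicator {0<..} \<tau> * \<psi> \<tau> * (gauss (4 * pi * \<tau>) z + c * gauss (2 * (4 * pi * \<tau>)) z))"
  have [measurable]: "\<psi> \<in> borel_measurable borel" unfolding \<psi>_def by measurable
  have \<psi>0: "\<psi> \<tau> \<ge> 0" if "\<tau> > 0" for \<tau>
    unfolding \<psi>_def bessel_density_def using s N that by (auto intro!: mult_nonneg_nonneg divide_nonneg_nonneg add_nonneg_nonneg Gamma_real_nonneg)
  have \<psi>i: "set_integrable lborel {0<..} \<psi>"
  proof -
    have "set_integrable lborel {0<..} (\<lambda>\<tau>. (\<tau> powr (s - 1) * exp (- (1 * \<tau>))) / Gamma s + (N + 2) / Gamma s * (\<tau> powr (s - \<alpha> / 2 - 1) * exp (- (1 * \<tau>))))"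
      by (intro set_integral_add(1) set_integrable_divide set_integrable_mult_right set_integrable_powr_exp) (use s a in auto)
    moreover have "(\<tau> powr (s - 1) * exp (- (1 * \<tau>))) / Gamma s + (N + 2) / Gamma s * (\<tau> powr (s - \<alpha> / 2 - 1) * exp (- (1 * \<tau>))) = \<psi> \<tau>" for \<tau>
    proof -
      have "\<tau> powr (s - \<alpha> / 2 - 1) = \<tau> powr (s - 1) * \<tau> powr (- \<alpha> / 2)"
        using powr_add[of \<tau> "s - 1" "- \<alpha> / 2"] by (simp add: algebra_simps)
      then show ?thesis by (simp add: \<psi>_def bessel_density_def algebra_simps add_divide_distrib)
    qed
    ultimately show ?thesis by simp
  qed
  have H0: "H r \<ge> 0" for r using \<psi>0 c by (cases r) (auto simp: H_def indicator_def)
  have Hi: "integrable lborel H"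
    unfolding H_def by (rule integrable_gauss_moment) (use \<psi>0 \<psi>i c in auto)
  have Gi: "integrable lborel ?G" by (intro integrable_heat_kernel measurable_densities bessel_density_integrable s)
  have key: "?G r - ?G (r + e) \<le> parabolic_dist e 0 powr \<alpha> * H r" if e: "snd e \<ge> 0" for e r
  proof -
    obtain z \<tau> where r: "r = (z, \<tau>)" by (cases r)
    obtain x k where ek: "e = (x, k)" by (cases e)
    have k: "k \<ge> 0" using e ek by simp
    define d where "d = parabolic_dist e 0"
    have d: "norm x \<le> d" "k \<le> d\<^sup>2" "d \<ge> 0"
    proof -
      have d': "d = norm x + sqrt k" using k by (simp add: d_def parabolic_dist_def ek)
      show "norm x \<le> d" "d \<ge> 0" using k by (auto simp: d')
      have "(sqrt k)\<^sup>2 \<le> d\<^sup>2" using k by (intro power_mono) (auto simp: d')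
      then show "k \<le> d\<^sup>2" using k by simp
    qed
    show ?thesis
    proof (cases "\<tau> > 0")
      case True
      let ?g = "gauss (4 * pi * \<tau>) z"
      \<comment> \<open>\<open>X1\<close> collects the terms that are quadratic in the parabolic
        distance, \<open>X2\<close> is the linear cross term; hence the powers
        \<open>\<alpha> / 2\<close> and \<open>\<alpha>\<close>.\<close>
      define X1 where "X1 = N * k / \<tau> + k + (norm x)\<^sup>2 / (4 * \<tau>)"
      define X2 where "X2 = norm z * norm x / (2 * \<tau>)"
      have X0: "X1 \<ge> 0" "X2 \<ge> 0" using True k N by (auto simp: X1_def X2_def)
      have b0: "bessel_density s \<tau> \<ge> 0" using s by (simp add: bessel_density_def Gamma_real_nonneg)
      have "?G r * exp (- (X1 + X2)) \<le> ?G (r + e)"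
      proof -
        let ?E = "exp (- ((2 * norm z * norm x + (norm x)\<^sup>2) / (4 * \<tau>)))"
        have "exp (- (X1 + X2)) = exp (- (N * k / \<tau>)) * (exp (- k) * ?E)"
        proof -
          have "X1 + X2 = N * k / \<tau> + (k + (2 * norm z * norm x + (norm x)\<^sup>2) / (4 * \<tau>))"
            by (simp add: X1_def X2_def add_divide_distrib)
          then show ?thesis by (simp flip: exp_add)
        qed
        also have "\<dots> \<le> (\<tau> / (\<tau> + k)) powr N * (exp (- k) * ?E)"
          by (intro mult_right_mono ratio_powr_lower_bound True k N) simp
        also have "(\<tau> / (\<tau> + k)) powr N = (\<tau> / (\<tau> + k)) powr (n / 2) * (\<tau> / (\<tau> + k)) powr (1 - s)"
          by (simp add: N_def powr_add)
        finally have "bessel_density s \<tau> * ?g * exp (- (X1 + X2)) \<le> bessel_density s \<tau> * ?g * ((\<tau> / (\<tau> + k)) powr (n / 2) * (\<tau> / (\<tau> + k)) powr (1 - s) * (exp (- k) * ?E))"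
          using b0 by (intro mult_left_mono) auto
        also have "\<dots> = bessel_density s (\<tau> + k) * (?g * ((\<tau> / (\<tau> + k)) powr (n / 2) * ?E))"
          by (simp add: bessel_density_shift_lower_bound[OF s True k] mult_ac)
        also have "\<dots> \<le> bessel_density s (\<tau> + k) * gauss (4 * pi * (\<tau> + k)) (z + x)"
          using gauss_shift_lower_bound[OF True k, of z x] s True k
          by (intro mult_left_mono) (auto simp: n_def bessel_density_def Gamma_real_nonneg)
        finally show ?thesis using True k by (simp add: heat_kernel_def r ek)
      qed
      then have "?G r - ?G (r + e) \<le> ?G r * (1 - exp (- (X1 + X2)))" by (simp add: algebra_simps)
      also have "\<dots> \<le> ?G r * (X1 powr (\<alpha> / 2) + X2 powr \<alpha>)"
      proof (intro mult_left_mono)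
        have "1 - exp (- (X1 + X2)) \<le> (1 - exp (- X1)) + (1 - exp (- X2))" by (rule one_minus_exp_add_le[OF X0])
        also have "\<dots> \<le> X1 powr (\<alpha> / 2) + X2 powr \<alpha>"
          using X0 s a by (intro add_mono one_minus_exp_le_powr) auto
        finally show "1 - exp (- (X1 + X2)) \<le> X1 powr (\<alpha> / 2) + X2 powr \<alpha>" .
        show "0 \<le> ?G r" by (rule bessel_kernel_nonneg[OF s(1)])
      qed
      also have "\<dots> \<le> ?G r * (d powr \<alpha> * ((1 + (N + 2) * \<tau> powr (- \<alpha> / 2)) * (1 + (norm z)\<^sup>2 / (4 * \<tau>))))"
      proof (intro mult_left_mono)
        have "X1 \<le> d\<^sup>2 * (1 + (N + 1) / \<tau>)"
        proof -
          have "N * k / \<tau> \<le> N * d\<^sup>2 / \<tau>" using N d True by (intro divide_right_mono mult_left_mono) auto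
          moreover have "(norm x)\<^sup>2 / (4 * \<tau>) \<le> d\<^sup>2 / \<tau>" using d True by (intro frac_le power_mono) auto
          ultimately have "X1 \<le> N * d\<^sup>2 / \<tau> + d\<^sup>2 + d\<^sup>2 / \<tau>" using d by (simp add: X1_def)
          then show ?thesis using True by (simp add: field_simps)
        qed
        then have "X1 powr (\<alpha> / 2) \<le> (d\<^sup>2 * (1 + (N + 1) / \<tau>)) powr (\<alpha> / 2)" using X0 a by (intro powr_mono2) auto
        also have "\<dots> = (d\<^sup>2) powr (\<alpha> / 2) * (1 + (N + 1) / \<tau>) powr (\<alpha> / 2)"
        proof -
          have "0 \<le> (N + 1) / \<tau>" using True N by simp
          then have "0 \<le> 1 + (N + 1) / \<tau>" by linarith
          then show ?thesis by (simp add: powr_mult)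
        qed
        also have "(d\<^sup>2) powr (\<alpha> / 2) = d powr \<alpha>"
          using d powr_powr[of d 2 "\<alpha> / 2"] by (cases "d = 0") simp_all
        also have "(1 + (N + 1) / \<tau>) powr (\<alpha> / 2) \<le> 1 powr (\<alpha> / 2) + ((N + 1) / \<tau>) powr (\<alpha> / 2)"
          using True N a s by (intro powr_one_plus_le) auto
        also have "((N + 1) / \<tau>) powr (\<alpha> / 2) = (N + 1) powr (\<alpha> / 2) * \<tau> powr (- \<alpha> / 2)"
          using True N powr_minus_divide[of \<tau> "\<alpha> / 2"] by (simp add: powr_divide)
        also have "(N + 1) powr (\<alpha> / 2) \<le> (N + 1) powr 1" using N a s by (intro powr_mono) auto
        finally have 1: "X1 powr (\<alpha> / 2) \<le> d powr \<alpha> * (1 + (N + 1) * \<tau> powr (- \<alpha> / 2))"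
          using N by (simp add: mult_left_mono mult_right_mono)
        have "X2 = (norm z / (2 * sqrt \<tau>)) * (norm x / sqrt \<tau>)" using True by (simp add: X2_def field_simps)
        also have "\<dots> \<le> (norm z / (2 * sqrt \<tau>)) * (d / sqrt \<tau>)"
          using True d by (intro mult_left_mono divide_right_mono) auto
        finally have "X2 powr \<alpha> \<le> ((norm z / (2 * sqrt \<tau>)) * (d / sqrt \<tau>)) powr \<alpha>" using X0 a by (intro powr_mono2) auto
        also have "\<dots> = (norm z / (2 * sqrt \<tau>)) powr \<alpha> * (d powr \<alpha> * \<tau> powr (- \<alpha> / 2))"
        proof -
          have "sqrt \<tau> powr \<alpha> = \<tau> powr (\<alpha> / 2)" using True by (simp add: powr_powr flip: powr_half_sqrt)
          then show ?thesis using True d powr_minus_divide[of \<tau> "\<alpha> / 2"] by (simp add: powr_mult powr_divide)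
        qed
        \<comment> \<open>A power with exponent between 0 and 2 is at most one plus the square,
          which is the moment that \<open>gauss_moment_le\<close> handles.\<close>
        also have "(norm z / (2 * sqrt \<tau>)) powr \<alpha> \<le> 1 + (norm z)\<^sup>2 / (4 * \<tau>)"
        proof -
          let ?w = "norm z / (2 * sqrt \<tau>)"
          have w2: "?w\<^sup>2 = (norm z)\<^sup>2 / (4 * \<tau>)" using True by (simp add: power_divide power_mult_distrib)
          show ?thesis
          proof (cases "?w \<le> 1")
            case w: True
            have "?w powr \<alpha> \<le> 1 powr \<alpha>" using w True a by (intro powr_mono2) auto
            then show ?thesis using True by (simp add: add_increasing2)
          next
            case False
            have "?w powr \<alpha> \<le> ?w powr 2" using False a s by (intro powr_mono) auto
            also have "\<dots> = ?w\<^sup>2" using False True by simp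
            finally show ?thesis unfolding w2 by simp
          qed
        qed
        finally have 2: "X2 powr \<alpha> \<le> (1 + (norm z)\<^sup>2 / (4 * \<tau>)) * (d powr \<alpha> * \<tau> powr (- \<alpha> / 2))"
          by (simp add: mult_right_mono)
        define M where "M = 1 + (norm z)\<^sup>2 / (4 * \<tau>)"
        have M: "1 \<le> M" using True by (simp add: M_def)
        have "d powr \<alpha> * (1 + (N + 1) * \<tau> powr (- \<alpha> / 2)) * 1 \<le> d powr \<alpha> * (1 + (N + 1) * \<tau> powr (- \<alpha> / 2)) * M"
          using M N by (intro mult_left_mono) auto
        then have "X1 powr (\<alpha> / 2) + X2 powr \<alpha> \<le> d powr \<alpha> * (1 + (N + 1) * \<tau> powr (- \<alpha> / 2)) * M + M * (d powr \<alpha> * \<tau> powr (- \<alpha> / 2))"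
          using 1 2 unfolding M_def by linarith
        also have "\<dots> = d powr \<alpha> * ((1 + (N + 2) * \<tau> powr (- \<alpha> / 2)) * M)" by (simp add: algebra_simps)
        finally show "X1 powr (\<alpha> / 2) + X2 powr \<alpha> \<le> d powr \<alpha> * ((1 + (N + 2) * \<tau> powr (- \<alpha> / 2)) * (1 + (norm z)\<^sup>2 / (4 * \<tau>)))"
          unfolding M_def .
        show "0 \<le> ?G r" by (rule bessel_kernel_nonneg[OF s(1)])
      qed
      also have "\<dots> = d powr \<alpha> * (\<psi> \<tau> * (?g * (1 + pi * (norm z)\<^sup>2 / (4 * pi * \<tau>))))"
        using True by (simp add: heat_kernel_def r \<psi>_def mult_ac)
      also have "\<dots> \<le> d powr \<alpha> * (\<psi> \<tau> * (?g + c * gauss (2 * (4 * pi * \<tau>)) z))"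
      proof -
        have "?g * (1 + pi * (norm z)\<^sup>2 / (4 * pi * \<tau>)) \<le> ?g + c * gauss (2 * (4 * pi * \<tau>)) z"
          unfolding c_def n_def by (rule gauss_moment_le) (use True in simp)
        from mult_left_mono[OF mult_left_mono[OF this \<psi>0[OF True]], of "d powr \<alpha>"]
        show ?thesis by simp
      qed
      also have "\<dots> = parabolic_dist e 0 powr \<alpha> * H r" using True by (simp add: H_def r d_def)
      finally show ?thesis .
    next
      case False
      \<comment> \<open>At nonpositive time the kernel is 0, so there is no drop, however large the
        kernel is after a shift into positive time. This is the gain from the one-sided
        estimate.\<close>
      then have "?G r = 0" by (simp add: heat_kernel_def r)
      moreover have "0 \<le> ?G (r + e)" by (rule bessel_kernel_nonneg[OF s(1)])
      ultimately show ?thesis using H0[of r] by (simp add: order_trans[of _ 0])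
    qed
  qed
  have "(LINT r|lborel. \<bar>?G (r + e) - ?G r\<bar>) \<le> (2 * (LINT r|lborel. H r)) * parabolic_dist e 0 powr \<alpha>" if e: "snd e \<ge> 0" for e
  proof -
    have "(LINT r|lborel. \<bar>?G (r + e) - ?G r\<bar>) \<le> 2 * (LINT r|lborel. parabolic_dist e 0 powr \<alpha> * H r)"
    proof (rule integral_abs_diff_le[OF Gi integrable_lborel_translate[OF Gi] integrable_mult_right[OF Hi]])
      show "(LINT r|lborel. ?G r) = (LINT r|lborel. ?G (r + e))"
        by (rule integral_lborel_translate[symmetric]) measurable
      show "?G r - ?G (r + e) \<le> parabolic_dist e 0 powr \<alpha> * H r" for r by (rule key[OF e])
      show "0 \<le> parabolic_dist e 0 powr \<alpha> * H r" for r using H0[of r] by simp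
    qed
    then show ?thesis by (simp add: mult_ac)
  qed
  then show ?thesis using H0 by (intro exI[of _ "2 * (LINT r|lborel. H r)"]) auto
qed

section \<open>Regularity of solutions\<close>

lemma D_multi_le_C_k_norm:
  assumes "(\<alpha>, j) \<in> multi_indices k" and "C_k_norm k V \<le> ennreal K" and "K \<ge> 0"
  shows "\<bar>D_multi \<alpha> j V p\<bar> \<le> K"
proof -
  let ?g = "\<lambda>(\<alpha>, j). SUP p. ennreal \<bar>D_multi \<alpha> j V p\<bar>"
  have "ennreal \<bar>D_multi \<alpha> j V p\<bar> \<le> ?g (\<alpha>, j)" unfolding prod.case by (rule SUP_upper) simp
  also have "\<dots> \<le> sum ?g (multi_indices k)"
    by (rule member_le_sum[OF assms(1)]) (auto simp: finite_multi_indices)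
  also have "\<dots> = C_k_norm k V" by (simp add: C_k_norm_def)
  also note assms(2)
  finally show ?thesis using assms(3) by (simp add: ennreal_le_iff)
qed

text \<open>For multi-indices of size at most one the list picked by \<open>SOME\<close> is unique,
  so \<open>D_multi\<close> unfolds to a plain derivative.\<close>

lemma
  assumes "C_k_norm k V \<le> ennreal K" and "K \<ge> 0"
  shows C_k_norm_bound: "\<bar>V p\<bar> \<le> K"
    and C_k_norm_D_x_bound: "k \<ge> 1 \<Longrightarrow> \<bar>D_x i V p\<bar> \<le> K"
    and C_k_norm_D_t_bound: "k \<ge> 1 \<Longrightarrow> \<bar>D_t V p\<bar> \<le> K"
proof -
  have "(SOME is. mset is = {#}) = ([] :: 'a list)" by simp
  then show "\<bar>V p\<bar> \<le> K"
    using D_multi_le_C_k_norm[of "{#}" 0 k V K p] assms by (simp add: multi_indices_def D_multi_def)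
  have "(SOME is. mset is = {#i#}) = [i]"
    by (rule some_equality) (auto simp: mset_single_iff)
  then show "k \<ge> 1 \<Longrightarrow> \<bar>D_x i V p\<bar> \<le> K"
    using D_multi_le_C_k_norm[of "{#i#}" 0 k V K p] assms by (simp add: multi_indices_def D_multi_def)
  show "k \<ge> 1 \<Longrightarrow> \<bar>D_t V p\<bar> \<le> K"
    using D_multi_le_C_k_norm[of "{#}" 1 k V K p] assms by (simp add: multi_indices_def D_multi_def)
qed

lemma lipschitz_along_partial:
  fixes V :: "'a::real_normed_vector \<Rightarrow> real"
  assumes d: "has_partial b V" and K: "\<And>p. \<bar>partial b V p\<bar> \<le> K"
  shows "\<bar>V (p + h *\<^sub>R b) - V p\<bar> \<le> K * \<bar>h\<bar>"
proof -
  define g where "g = (\<lambda>h. V (p + h *\<^sub>R b))"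
  have D: "(g has_real_derivative partial b V (p + t *\<^sub>R b)) (at t)" for t
  proof -
    have "(\<lambda>h. V ((p + t *\<^sub>R b) + h *\<^sub>R b)) differentiable at 0" using d by (simp add: has_partial_def)
    then have "((\<lambda>h. V ((p + t *\<^sub>R b) + h *\<^sub>R b)) has_real_derivative partial b V (p + t *\<^sub>R b)) (at 0)"
      unfolding partial_def by (simp add: DERIV_deriv_iff_real_differentiable)
    moreover have "(\<lambda>h. V ((p + t *\<^sub>R b) + h *\<^sub>R b)) = (\<lambda>h. g (h + t))" by (simp add: g_def algebra_simps)
    ultimately show ?thesis using DERIV_shift[of g _ 0 t] by simp
  qed
  have "norm (g h - g 0) \<le> K * norm (h - 0)"
    by (rule field_differentiable_bound[where S=UNIV and f'="\<lambda>t. partial b V (p + t *\<^sub>R b)"]) (use D K in auto)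
  then show ?thesis by (simp add: g_def)
qed

text \<open>Coordinates are exchanged one at a time through the hybrid points \<open>w A\<close>, so
  the mean value inequality is applied only along the axes, where the derivatives are given.\<close>

lemma lipschitz_of_partials:
  fixes V :: "(real ^ 'n::finite) \<times> real \<Rightarrow> real"
  assumes dx: "\<And>i. has_partial (axis i 1, 0) V" and dt: "has_partial (0, 1) V"
    and Kx: "\<And>i p. \<bar>D_x i V p\<bar> \<le> K" and Kt: "\<And>p. \<bar>D_t V p\<bar> \<le> K" and K: "K \<ge> 0"
  shows "\<bar>V (x, t) - V (x', t')\<bar> \<le> K * (real CARD('n) * norm (x - x') + \<bar>t - t'\<bar>)"
proof -
  define w where "w = (\<lambda>A. \<chi> i. if i \<in> A then x $ i else x' $ i)"
  have step: "\<bar>V (w A, t) - V (x', t)\<bar> \<le> K * (\<Sum>i\<in>A. \<bar>x $ i - x' $ i\<bar>)" if "finite A" for A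
    using that
  proof induction
    case empty
    have "w {} = x'" by (simp add: w_def vec_eq_iff)
    then show ?case by simp
  next
    case (insert i A)
    have "w (insert i A) = w A + (x $ i - x' $ i) *\<^sub>R axis i 1"
      using insert.hyps by (auto simp: w_def vec_eq_iff axis_def)
    then have "(w (insert i A), t) = (w A, t) + (x $ i - x' $ i) *\<^sub>R (axis i 1, 0)" by simp
    then have "\<bar>V (w (insert i A), t) - V (w A, t)\<bar> \<le> K * \<bar>x $ i - x' $ i\<bar>"
      using lipschitz_along_partial[OF dx Kx] by metis
    then have "\<bar>V (w (insert i A), t) - V (x', t)\<bar> \<le> K * \<bar>x $ i - x' $ i\<bar> + K * (\<Sum>i\<in>A. \<bar>x $ i - x' $ i\<bar>)"
      using insert.IH by linarith
    then show ?case using insert.hyps by (simp add: distrib_left)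
  qed
  have "w UNIV = x" by (simp add: w_def vec_eq_iff)
  then have "\<bar>V (x, t) - V (x', t)\<bar> \<le> K * (\<Sum>i\<in>UNIV. \<bar>x $ i - x' $ i\<bar>)" using step[of UNIV] by simp
  also have "(\<Sum>i\<in>UNIV. \<bar>x $ i - x' $ i\<bar>) \<le> (\<Sum>i\<in>(UNIV::'n set). norm (x - x'))"
    by (rule sum_mono) (metis component_le_norm_cart vector_minus_component)
  finally have 1: "\<bar>V (x, t) - V (x', t)\<bar> \<le> K * (real CARD('n) * norm (x - x'))" using K by (simp add: mult_left_mono)
  have "(x', t) = (x', t') + (t - t') *\<^sub>R (0, 1)" by simp
  then have "\<bar>V (x', t) - V (x', t')\<bar> \<le> K * \<bar>t - t'\<bar>" using lipschitz_along_partial[OF dt Kt] by metis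
  with 1 show ?thesis unfolding distrib_left by linarith
qed

text \<open>For \<open>d \<le> 1\<close> the Lipschitz bound is stronger, as the time increment is
  at most \<open>d\<^sup>2 \<le> d \<le> d powr \<alpha>\<close>; beyond that \<open>2 * K\<close>
  suffices. The summand 2 in the constant covers both the time increment and the second
  case.\<close>

lemma potential_holder:
  fixes V :: "(real ^ 'n::finite) \<times> real \<Rightarrow> real"
  assumes C: "C_k k V" "C_k_norm k V \<le> ennreal K" "k \<ge> 1" and K: "K \<ge> 0" and a: "0 < \<alpha>" "\<alpha> \<le> 1"
  shows "\<bar>V p - V q\<bar> \<le> K * (real CARD('n) + 2) * parabolic_dist p q powr \<alpha>"
proof -
  obtain k' where k: "k = Suc k'" using C(3) by (cases k) auto
  have dx: "\<And>i. has_partial (axis i 1, 0) V" and dt: "has_partial (0, 1) V" using C(1) unfolding k C_k.simps by blast+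
  define d where "d = parabolic_dist p q"
  have d: "d \<ge> 0" "norm (fst p - fst q) \<le> d" "sqrt \<bar>snd p - snd q\<bar> \<le> d" unfolding d_def parabolic_dist_def by simp_all
  have "\<bar>V p - V q\<bar> \<le> K * ((real CARD('n) + 2) * d powr \<alpha>)"
  proof (cases "d \<le> 1")
    case True
    have pw: "x \<le> d powr \<alpha>" if "x \<le> d" for x
    proof (cases "d = 0")
      case False
      have "d powr 1 \<le> d powr \<alpha>" using True False d a by (intro powr_mono') auto
      then show ?thesis using d that by simp
    qed (use that a in simp)
    have "\<bar>snd p - snd q\<bar> = (sqrt \<bar>snd p - snd q\<bar>)\<^sup>2" by simp
    also have "\<dots> \<le> d\<^sup>2" using d by (intro power_mono) auto
    also have "\<dots> \<le> d" using True d by (simp add: power2_eq_square mult_left_le)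
    finally have t: "\<bar>snd p - snd q\<bar> \<le> d powr \<alpha>" by (rule pw)
    have "\<bar>V p - V q\<bar> \<le> K * (real CARD('n) * norm (fst p - fst q) + \<bar>snd p - snd q\<bar>)"
      using lipschitz_of_partials[OF dx dt C_k_norm_D_x_bound[OF C(2) K C(3)] C_k_norm_D_t_bound[OF C(2) K C(3)] K, of "fst p" "snd p" "fst q" "snd q"] by simp
    also have "\<dots> \<le> K * (real CARD('n) * d powr \<alpha> + 2 * d powr \<alpha>)"
    proof (intro mult_left_mono add_mono K)
      show "norm (fst p - fst q) \<le> d powr \<alpha>" by (rule pw[OF d(2)])
      show "\<bar>snd p - snd q\<bar> \<le> 2 * d powr \<alpha>" using t by (simp add: order_trans[OF t])
    qed simp
    finally show ?thesis by (simp add: distrib_right)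
  next
    case False
    have "\<bar>V p - V q\<bar> \<le> 2 * K" using C_k_norm_bound[OF C(2) K, of p] C_k_norm_bound[OF C(2) K, of q] by linarith
    also have "\<dots> \<le> K * ((real CARD('n) + 2) * d powr \<alpha>)"
    proof -
      have "1 \<le> d powr \<alpha>" using False a by (intro ge_one_powr_ge_zero) auto
      then have "2 * 1 \<le> (real CARD('n) + 2) * d powr \<alpha>" by (intro mult_mono) auto
      then show ?thesis using K by (simp add: mult_left_mono mult.commute)
    qed
    finally show ?thesis .
  qed
  then show ?thesis by (simp add: d_def mult.assoc)
qed

section \<open>Boundedness and Hoelder continuity of the solution\<close>

text \<open>The mass is the limit at \<open>r = 0\<close> of the Laplace transform
  \<open>(1 + r) powr s - r powr s\<close>, which subadditivity bounds by 1.\<close>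

lemma defect_density_mass:
  assumes s: "0 < s" "s < 1"
  shows "(LINT \<tau>:{0<..}|lborel. defect_density s \<tau>) \<le> 1"
proof (rule LIMSEQ_le_const2)
  let ?r = "\<lambda>n. 1 / real (Suc n)"
  show "(\<lambda>n. LINT \<tau>:{0<..}|lborel. defect_density s \<tau> * exp (- (?r n * \<tau>))) \<longlonglongrightarrow> (LINT \<tau>:{0<..}|lborel. defect_density s \<tau>)"
    unfolding set_lebesgue_integral_def
  proof (rule integral_dominated_convergence[where w="\<lambda>\<tau>. norm (indicator {0<..} \<tau> *\<^sub>R defect_density s \<tau>)"])
    show "integrable lborel (\<lambda>\<tau>. norm (indicator {0<..} \<tau> *\<^sub>R defect_density s \<tau>))"
      using defect_density_integrable[OF s] unfolding set_integrable_def by (rule integrable_norm)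
    show "AE \<tau> in lborel. (\<lambda>n. indicator {0<..} \<tau> *\<^sub>R (defect_density s \<tau> * exp (- (?r n * \<tau>)))) \<longlonglongrightarrow> indicator {0<..} \<tau> *\<^sub>R defect_density s \<tau>"
    proof (intro AE_I2)
      fix \<tau> :: real
      have "(\<lambda>n. indicator {0<..} \<tau> *\<^sub>R (defect_density s \<tau> * exp (- (?r n * \<tau>)))) \<longlonglongrightarrow> indicator {0<..} \<tau> *\<^sub>R (defect_density s \<tau> * exp (- (0 * \<tau>)))"
        by (intro tendsto_intros LIMSEQ_Suc lim_1_over_n)
      then show "(\<lambda>n. indicator {0<..} \<tau> *\<^sub>R (defect_density s \<tau> * exp (- (?r n * \<tau>)))) \<longlonglongrightarrow> indicator {0<..} \<tau> *\<^sub>R defect_density s \<tau>" by simp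
    qed
    show "AE \<tau> in lborel. norm (indicator {0<..} \<tau> *\<^sub>R (defect_density s \<tau> * exp (- (?r n * \<tau>)))) \<le> norm (indicator {0<..} \<tau> *\<^sub>R defect_density s \<tau>)" for n
    proof (intro AE_I2)
      fix \<tau> :: real
      have "\<bar>defect_density s \<tau>\<bar> * exp (- (?r n * \<tau>)) \<le> \<bar>defect_density s \<tau>\<bar> * 1" if "\<tau> > 0"
        using that by (intro mult_left_mono) auto
      then show "norm (indicator {0<..} \<tau> *\<^sub>R (defect_density s \<tau> * exp (- (?r n * \<tau>)))) \<le> norm (indicator {0<..} \<tau> *\<^sub>R defect_density s \<tau>)"
        by (cases "\<tau> > 0") (auto simp: abs_mult)
    qed
  qed measurable
  have le1: "(LINT \<tau>:{0<..}|lborel. defect_density s \<tau> * exp (- (r * \<tau>))) \<le> 1" if "r > 0" for r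
    using powr_one_plus_le[of 1 r s] that s by (simp add: laplace_defect_density_real[OF s])
  show "\<exists>N. \<forall>n\<ge>N. (LINT \<tau>:{0<..}|lborel. defect_density s \<tau> * exp (- (?r n * \<tau>))) \<le> 1"
    by (intro exI[of _ 0] allI impI le1) simp
qed

lemma nn_integral_heat_kernel_eq:
  assumes [measurable]: "\<phi> \<in> borel_measurable borel" and i: "set_integrable lborel {0<..} \<phi>" and pos: "\<And>\<tau>. \<tau> > 0 \<Longrightarrow> \<phi> \<tau> \<ge> 0"
  shows "(\<integral>\<^sup>+p. ennreal \<bar>heat_kernel \<phi> (p :: 'a::euclidean_space \<times> real)\<bar> \<partial>lborel) = ennreal (LINT \<tau>:{0<..}|lborel. \<phi> \<tau>)"
proof -
  have "(\<integral>\<^sup>+\<tau>. ennreal (indicator {0<..} \<tau> * \<bar>\<phi> \<tau>\<bar>) \<partial>lborel) = (\<integral>\<^sup>+\<tau>. ennreal (indicator {0<..} \<tau> *\<^sub>R \<phi> \<tau>) \<partial>lborel)"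
    using pos by (intro nn_integral_cong) (auto simp: indicator_def)
  also have "\<dots> = ennreal (LINT \<tau>:{0<..}|lborel. \<phi> \<tau>)"
    unfolding set_lebesgue_integral_def
    by (rule nn_integral_eq_integral) (use i pos in \<open>auto simp: set_integrable_def indicator_def\<close>)
  finally show ?thesis using nn_integral_heat_kernel[OF assms(1), where 'a='a] by simp
qed

lemma bessel_density_small_mass:
  assumes s: "0 < s" and k: "k > 0"
  shows "\<exists>\<delta>>0. (LINT \<tau>:{0<..}|lborel. bessel_density s \<tau> * indicator {..\<delta>} \<tau>) \<le> k"
proof -
  let ?r = "\<lambda>n. 1 / real (Suc n)"
  have "(\<lambda>n. LINT \<tau>:{0<..}|lborel. bessel_density s \<tau> * indicator {..?r n} \<tau>) \<longlonglongrightarrow> (LINT \<tau>::real|lborel. (0::real))"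
    unfolding set_lebesgue_integral_def
  proof (rule integral_dominated_convergence[where f="\<lambda>_. 0 :: real" and w="\<lambda>\<tau>. norm (indicator {0<..} \<tau> *\<^sub>R bessel_density s \<tau>)"])
    show "integrable lborel (\<lambda>\<tau>. norm (indicator {0<..} \<tau> *\<^sub>R bessel_density s \<tau>))"
      using bessel_density_integrable[OF s] unfolding set_integrable_def by (rule integrable_norm)
    show "AE \<tau> in lborel. (\<lambda>n. indicator {0<..} \<tau> *\<^sub>R (bessel_density s \<tau> * indicator {..?r n} \<tau>)) \<longlonglongrightarrow> 0"
    proof (intro AE_I2 tendsto_eventually)
      fix \<tau> :: real
      show "\<forall>\<^sub>F n in sequentially. indicator {0<..} \<tau> *\<^sub>R (bessel_density s \<tau> * indicator {..?r n} \<tau>) = 0"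
      proof (cases "\<tau> > 0")
        case True
        have "?r \<longlonglongrightarrow> 0" by (intro LIMSEQ_Suc lim_1_over_n)
        from order_tendstoD(2)[OF this True] have "\<forall>\<^sub>F n in sequentially. ?r n < \<tau>" .
        then show ?thesis by eventually_elim (simp add: indicator_def)
      qed simp
    qed
    show "AE \<tau> in lborel. norm (indicator {0<..} \<tau> *\<^sub>R (bessel_density s \<tau> * indicator {..?r n} \<tau>)) \<le> norm (indicator {0<..} \<tau> *\<^sub>R bessel_density s \<tau>)" for n
      by (intro AE_I2) (auto simp: indicator_def)
  qed measurable
  then have "(\<lambda>n. LINT \<tau>:{0<..}|lborel. bessel_density s \<tau> * indicator {..?r n} \<tau>) \<longlonglongrightarrow> 0" by simp
  then have "\<forall>\<^sub>F n in sequentially. (LINT \<tau>:{0<..}|lborel. bessel_density s \<tau> * indicator {..?r n} \<tau>) < k" using k by (rule order_tendstoD)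
  then obtain n where "(LINT \<tau>:{0<..}|lborel. bessel_density s \<tau> * indicator {..?r n} \<tau>) < k"
    using eventually_happens trivial_limit_sequentially by blast
  then show ?thesis by (intro exI[of _ "?r n"] conjI less_imp_le) simp
qed

lemma gauss_le: "e > 0 \<Longrightarrow> gauss e (z :: 'a::euclidean_space) \<le> e powr (- real DIM('a) / 2)"
  by (simp add: gauss_def mult_left_le)

text \<open>The equation fixes \<open>u\<close> only almost everywhere, so the result concerns a
  representative: \<open>v\<close> is the Bessel kernel convolved with a bounded version of
  \<open>F\<close>. Boundedness has to come first, because the L1 modulus of the kernel yields
  Hoelder continuity only against bounded functions.\<close>

lemma regular_representative:
  fixes u f :: "(real ^ 'n::finite) \<times> real \<Rightarrow> complex"
  assumes s: "0 < s" "s < 1" and a: "0 < \<alpha>" "\<alpha> \<le> s"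
    and u: "spectral u g" and f: "spectral f (\<lambda>z. heat_symbol s z * g z)"
    and C: "C \<ge> 0" "AE p in lborel. cmod (f p) \<le> C * cmod (u p)"
  obtains v L K where "v \<in> borel_measurable borel" "AE p in lborel. u p = v p" "\<And>p. cmod (v p) \<le> L"
    "\<And>p q. cmod (v p - v q) \<le> K * parabolic_dist p q powr \<alpha>" "K \<ge> 0"
proof -
  let ?G = "heat_kernel (bessel_density s) :: (real ^ 'n) \<times> real \<Rightarrow> real"
  let ?B = "heat_kernel (defect_density s) :: (real ^ 'n) \<times> real \<Rightarrow> real"
  note iB = defect_density_integrable[OF s] and iG = bessel_density_integrable[OF s(1)]
  have Bi: "integrable lborel ?B" and Gi: "integrable lborel ?G"
    by (intro integrable_heat_kernel measurable_densities iB iG)+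
  have su: "sq_int u" and sf: "sq_int f" using u f by (auto simp: spectral_def)
  define F where "F = (\<lambda>p. f p + conv ?B u p)"
  have sF: "sq_int F" unfolding F_def by (intro sq_int_add sf sq_int_conv Bi su)
  note [measurable] = sq_intD[OF su] sq_intD[OF sf] sq_intD[OF sF]
  have rep: "AE p in lborel. u p = conv ?G F p" unfolding F_def by (rule bessel_representation[OF s u f])
  define nB where "nB = (\<lambda>r. ennreal \<bar>?B r\<bar>)"
  have [measurable]: "nB \<in> borel_measurable borel" unfolding nB_def by measurable
  have nB1: "(\<integral>\<^sup>+r. nB r \<partial>lborel) \<le> 1"
  proof -
    have "(\<integral>\<^sup>+r. nB r \<partial>lborel) = ennreal (LINT \<tau>:{0<..}|lborel. defect_density s \<tau>)"
      unfolding nB_def by (rule nn_integral_heat_kernel_eq[OF _ iB]) (use defect_density_nonneg[OF s] in simp_all)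
    then show ?thesis using defect_density_mass[OF s] by (simp add: ennreal_le_1)
  qed
  have Fle: "AE p in lborel. ennreal (cmod (F p)) \<le> ennreal C * ennreal (cmod (u p)) + nnconv nB (\<lambda>p. ennreal (cmod (u p))) p"
    using C(2)
  proof eventually_elim
    case (elim p)
    have "cmod (F p) \<le> cmod (f p) + cmod (conv ?B u p)" unfolding F_def by (rule norm_triangle_ineq)
    then have "ennreal (cmod (F p)) \<le> ennreal (cmod (f p) + cmod (conv ?B u p))" by (rule ennreal_leI)
    also have "\<dots> = ennreal (cmod (f p)) + ennreal (cmod (conv ?B u p))" by (rule ennreal_plus) simp_all
    also have "\<dots> \<le> ennreal (C * cmod (u p)) + nnconv nB (\<lambda>p. ennreal (cmod (u p))) p"
      unfolding nB_def by (intro add_mono ennreal_leI elim norm_conv_le_nnconv)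
    finally show ?case using C(1) by (simp add: ennreal_mult)
  qed
  \<comment> \<open>The mass that \<open>bounded_if_small_convolution\<close> allows to the part of
    the kernel near \<open>\<tau> = 0\<close>.\<close>
  define k where "k = 1 / (4 * (C + 1))"
  have k: "k > 0" "k * (C + 1) \<le> 1 / 4" using C(1) by (auto simp: k_def)
  obtain \<delta> where \<delta>: "\<delta> > 0" "(LINT \<tau>:{0<..}|lborel. bessel_density s \<tau> * indicator {..\<delta>} \<tau>) \<le> k"
    using bessel_density_small_mass[OF s(1) k(1)] by auto
  \<comment> \<open>\<open>\<phi>1\<close> carries the singular part of the kernel, of mass at most
    \<open>k\<close>; \<open>G2\<close> keeps the times beyond \<open>\<delta>\<close>, where the
    kernel is bounded.\<close>
  define \<phi>1 where "\<phi>1 = (\<lambda>\<tau>. bessel_density s \<tau> * indicator {..\<delta>} \<tau>)"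
  define G2 where "G2 = (\<lambda>r :: (real ^ 'n) \<times> real. ?G r * indicator {\<delta><..} (snd r))"
  have [measurable]: "\<phi>1 \<in> borel_measurable borel" unfolding \<phi>1_def by measurable
  have G2m[measurable]: "G2 \<in> borel_measurable borel"
    unfolding G2_def heat_kernel_def case_prod_beta borel_prod[symmetric] by measurable
  have bpos: "bessel_density s \<tau> \<ge> 0" for \<tau> using s by (simp add: bessel_density_def Gamma_real_nonneg)
  have \<phi>1i: "set_integrable lborel {0<..} \<phi>1"
    using set_integrable_mult_bounded[OF iG, of "indicator {..\<delta>} :: real \<Rightarrow> real" 1] by (simp add: \<phi>1_def indicator_le_1)
  define n1 where "n1 = (\<lambda>r :: (real ^ 'n) \<times> real. ennreal \<bar>heat_kernel \<phi>1 r\<bar>)"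
  have [measurable]: "n1 \<in> borel_measurable borel" unfolding n1_def by measurable
  have n1k: "(\<integral>\<^sup>+r. n1 r \<partial>lborel) \<le> ennreal k"
  proof -
    have "(\<integral>\<^sup>+r. n1 r \<partial>lborel) = ennreal (LINT \<tau>:{0<..}|lborel. \<phi>1 \<tau>)"
      unfolding n1_def by (rule nn_integral_heat_kernel_eq[OF _ \<phi>1i]) (use bpos in \<open>simp_all add: \<phi>1_def\<close>)
    then show ?thesis using \<delta>(2) by (simp add: \<phi>1_def ennreal_leI)
  qed
  have Gsplit: "ennreal \<bar>?G r\<bar> = n1 r + ennreal \<bar>G2 r\<bar>" for r
    by (cases r) (auto simp: n1_def G2_def heat_kernel_def \<phi>1_def indicator_def)
  have G2sq: "integrable lborel (\<lambda>r. (G2 r)\<^sup>2)"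
  proof (rule Bochner_Integration.integrable_bound)
    \<comment> \<open>Bounds for \<open>\<tau> > \<delta>\<close> of the density and of the
      Gaussian, multiplied. Then the square of \<open>G2\<close> is at most \<open>M\<close> times
      the integrable kernel.\<close>
    define M where "M = \<delta> powr (s - 1) / Gamma s * (4 * pi * \<delta>) powr (- real CARD('n) / 2)"
    show "integrable lborel (\<lambda>r. M * ?G r)" using Gi by (rule integrable_mult_right)
    have "G2 r \<le> M" "0 \<le> G2 r" for r
    proof -
      obtain z \<tau> where r: "r = (z, \<tau>)" by (cases r)
      have G: "Gamma s > 0" using s by (intro Gamma_real_pos) simp
      show "0 \<le> G2 r" by (simp add: G2_def bessel_kernel_nonneg[OF s(1)])
      show "G2 r \<le> M"
      proof (cases "\<tau> > \<delta>")
        case True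
        have "\<tau> powr (s - 1) \<le> \<delta> powr (s - 1)" using True \<delta> s by (intro powr_mono2') auto
        then have "\<tau> powr (s - 1) * exp (- \<tau>) \<le> \<delta> powr (s - 1) * 1" using True \<delta> by (intro mult_mono) auto
        then have b: "bessel_density s \<tau> \<le> \<delta> powr (s - 1) / Gamma s" using G by (simp add: bessel_density_def divide_right_mono)
        have "gauss (4 * pi * \<tau>) z \<le> (4 * pi * \<tau>) powr (- real CARD('n) / 2)"
          using gauss_le[of "4 * pi * \<tau>" z] True \<delta> by simp
        also have "\<dots> \<le> (4 * pi * \<delta>) powr (- real CARD('n) / 2)" using True \<delta> by (intro powr_mono2') auto
        finally have "bessel_density s \<tau> * gauss (4 * pi * \<tau>) z \<le> M"
          unfolding M_def using b bpos G by (intro mult_mono) auto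
        then show ?thesis using True \<delta> by (simp add: G2_def r heat_kernel_def)
      next
        case False
        then show ?thesis using G by (simp add: G2_def r M_def)
      qed
    qed
    note G2M = this
    show "AE r in lborel. norm ((G2 r)\<^sup>2) \<le> norm (M * ?G r)"
    proof (intro AE_I2)
      fix r
      have "G2 r * G2 r \<le> M * ?G r"
      proof (rule mult_mono)
        show "G2 r \<le> M" "0 \<le> G2 r" by (rule G2M)+
        then show "0 \<le> M" by linarith
        show "G2 r \<le> ?G r" using bessel_kernel_nonneg[OF s(1), of r] by (simp add: G2_def indicator_def)
      qed
      then show "norm ((G2 r)\<^sup>2) \<le> norm (M * ?G r)" by (simp add: power2_eq_square)
    qed
  qed measurable
  \<comment> \<open>Bounds the convolution of the square integrable functions \<open>G2\<close> and
    \<open>F\<close> at every point.\<close>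
  define b where "b = (LINT r|lborel. (G2 r)\<^sup>2) + (LINT r|lborel. (cmod (F r))\<^sup>2)"
  have b: "b \<ge> 0" by (simp add: b_def)
  have nconv: "ennreal (cmod (conv ?G F p)) \<le> nnconv n1 (\<lambda>p. ennreal (cmod (F p))) p + ennreal b" for p
  proof -
    have "ennreal (cmod (conv ?G F p)) \<le> nnconv (\<lambda>r. ennreal \<bar>?G r\<bar>) (\<lambda>r. ennreal (cmod (F r))) p"
      by (rule norm_conv_le_nnconv)
    also have "\<dots> = nnconv n1 (\<lambda>p. ennreal (cmod (F p))) p + (\<integral>\<^sup>+r. ennreal \<bar>G2 r\<bar> * ennreal (cmod (F (p - r))) \<partial>lborel)"
      unfolding nnconv_def Gsplit distrib_right by (rule nn_integral_add) measurable
    also have "(\<integral>\<^sup>+r. ennreal \<bar>G2 r\<bar> * ennreal (cmod (F (p - r))) \<partial>lborel) \<le> ennreal b"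
      using integrable_shift_mult_sq_int(2)[OF sF G2m G2sq, of p] by (simp add: b_def ennreal_mult)
    finally show ?thesis by (simp add: add_left_mono)
  qed
  have ub: "AE p in lborel. cmod (u p) \<le> 2 * b"
  proof (rule bounded_if_small_convolution[OF su, of n1 nB C b k])
    show "AE p in lborel. ennreal (cmod (u p)) \<le> nnconv n1 (\<lambda>p. ennreal C * ennreal (cmod (u p)) + nnconv nB (\<lambda>p. ennreal (cmod (u p))) p) p + ennreal b"
      using rep
    proof eventually_elim
      case (elim p)
      show ?case unfolding elim
        by (rule order_trans[OF nconv add_right_mono[OF nnconv_mono_AE]]) (use Fle elim in simp)
    qed
  qed (use k b C n1k nB1 in auto)
  \<comment> \<open>The first summand bounds \<open>f\<close> and the second the convolution with
    the defect kernel, whose mass is at most one.\<close>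
  define L where "L = C * (2 * b) + 2 * b"
  have FL: "AE p in lborel. cmod (F p) \<le> L"
    using Fle ub
  proof eventually_elim
    case (elim p)
    have "nnconv nB (\<lambda>p. ennreal (cmod (u p))) p \<le> nnconv nB (\<lambda>p. ennreal (2 * b)) p"
      by (rule nnconv_mono_AE) (use ub in \<open>auto intro: ennreal_leI\<close>)
    also have "\<dots> = (\<integral>\<^sup>+r. nB r \<partial>lborel) * ennreal (2 * b)" unfolding nnconv_def by (rule nn_integral_multc) measurable
    also have "\<dots> \<le> 1 * ennreal (2 * b)" by (rule mult_right_mono[OF nB1]) simp
    finally have "nnconv nB (\<lambda>p. ennreal (cmod (u p))) p \<le> ennreal (2 * b)" by simp
    moreover have "ennreal C * ennreal (cmod (u p)) \<le> ennreal C * ennreal (2 * b)"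
      by (rule mult_left_mono[OF ennreal_leI[OF elim(2)]]) simp
    ultimately have "ennreal (cmod (F p)) \<le> ennreal C * ennreal (2 * b) + ennreal (2 * b)"
      using order_trans[OF elim(1) add_mono] by blast
    also have "\<dots> = ennreal L"
    proof -
      have "ennreal L = ennreal (C * (2 * b)) + ennreal (2 * b)" unfolding L_def using C(1) b by (intro ennreal_plus) auto
      then show ?thesis using C(1) b by (simp add: ennreal_mult)
    qed
    finally show ?case using C(1) b by (subst (asm) ennreal_le_iff) (simp_all add: L_def)
  qed
  \<comment> \<open>A change on a null set makes the bound hold everywhere; convolutions do not
    notice it.\<close>
  define F' where "F' = (\<lambda>p. if cmod (F p) \<le> L then F p else 0)"
  have L0: "L \<ge> 0" using C(1) b by (simp add: L_def)
  have [measurable]: "F' \<in> borel_measurable borel" unfolding F'_def by measurable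
  have F'L: "cmod (F' p) \<le> L" for p using L0 by (simp add: F'_def)
  have FF': "AE p in lborel. F p = F' p" using FL by eventually_elim (simp add: F'_def)
  define v where "v = conv ?G F'"
  have uv: "AE p in lborel. u p = v p"
    using rep by eventually_elim (simp add: v_def conv_cong_AE[OF _ _ _ FF'])
  obtain K where K: "K \<ge> 0" "\<And>e :: (real ^ 'n) \<times> real. snd e \<ge> 0 \<Longrightarrow> (LINT r|lborel. \<bar>?G (r + e) - ?G r\<bar>) \<le> K * parabolic_dist e 0 powr \<alpha>"
    using bessel_kernel_modulus[OF s a, where 'a="real ^ 'n"] by blast
  show ?thesis
  proof (rule that[of v "(LINT r|lborel. \<bar>?G r\<bar>) * L" "L * K"])
    show "v \<in> borel_measurable borel" unfolding v_def by measurable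
    show "AE p in lborel. u p = v p" by (rule uv)
    show "cmod (v p) \<le> (LINT r|lborel. \<bar>?G r\<bar>) * L" for p
    proof -
      have "cmod (v p) \<le> (LINT r|lborel. cmod (?G r *\<^sub>R F' (p - r)))" unfolding v_def conv_def by (rule integral_norm_bound)
      also have "\<dots> \<le> (LINT r|lborel. \<bar>?G r\<bar> * L)"
      proof (rule integral_mono')
        show "integrable lborel (\<lambda>r. \<bar>?G r\<bar> * L)" using Gi by simp
        show "cmod (?G r *\<^sub>R F' (p - r)) \<le> \<bar>?G r\<bar> * L" for r by (simp add: F'L mult_left_mono)
        show "0 \<le> \<bar>?G r\<bar> * L" for r using L0 by simp
      qed
      finally show ?thesis by simp
    qed
    show "cmod (v p - v q) \<le> L * K * parabolic_dist p q powr \<alpha>" for p q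
      unfolding v_def by (rule holder_of_L1_modulus[OF Gi _ F'L K(2)]) measurable
    show "L * K \<ge> 0" using L0 K by simp
  qed
qed

section \<open>The extension and its conormal derivative\<close>

lemma integrable_scaleR_bounded:
  fixes k :: "'a \<Rightarrow> real" and w :: "'a \<Rightarrow> complex"
  assumes k: "integrable M k" and L: "\<And>x. cmod (w x) \<le> L" and [measurable]: "w \<in> borel_measurable M"
  shows "integrable M (\<lambda>x. k x *\<^sub>R w x)"
proof (rule Bochner_Integration.integrable_bound)
  note [measurable] = borel_measurable_integrable[OF k]
  show "(\<lambda>x. k x *\<^sub>R w x) \<in> borel_measurable M" by measurable
  show "integrable M (\<lambda>x. k x * L)" using k by simp
  show "AE x in M. norm (k x *\<^sub>R w x) \<le> norm (k x * L)"
    using L by (intro AE_I2) (auto simp: abs_mult intro!: mult_left_mono order_trans[OF L abs_ge_self])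
qed

lemma integral_lebesgue_cong_AE:
  fixes f g :: "'a::euclidean_space \<Rightarrow> 'b::{banach, second_countable_topology}"
  assumes g: "g \<in> borel_measurable borel" and eq: "AE x in lborel. f x = g x"
  shows "(LINT x|lebesgue. f x) = (LINT x|lborel. g x)"
proof -
  have eq': "AE x in lebesgue. f x = g x" using eq by (rule AE_completion)
  have g': "g \<in> borel_measurable lebesgue" using g by (intro measurable_completion) simp
  have "(LINT x|lebesgue. f x) = (LINT x|lebesgue. g x)"
    by (rule integral_cong_AE[OF borel_measurable_lebesgueI_AE[OF g' eq'] g' eq'])
  then show ?thesis using integral_lebesgue_eq_lborel[OF g] by simp
qed

section \<open>The extension as a convolution and its derivative in \<open>y\<close>\<close>

lemma ext_kernel_eq:
  assumes "\<tau> > 0"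
  shows "ext_kernel s (z :: real ^ 'n::finite) y \<tau> = poisson_density s y \<tau> * gauss (4 * pi * \<tau>) z"
proof -
  have 1: "exp (- ((norm z)\<^sup>2 + y\<^sup>2) / (4 * \<tau>)) = exp (- (y\<^sup>2 / 4 / \<tau>)) * exp (- pi * (norm z)\<^sup>2 / (4 * pi * \<tau>))"
    using assms by (simp add: field_simps flip: exp_add)
  have 2: "4 powr (real CARD('n) / 2 + s) = 4 powr (real CARD('n) / 2) * 4 powr s" by (rule powr_add)
  have 3: "\<tau> powr (real CARD('n) / 2 + 1 + s) = \<tau> powr (real CARD('n) / 2) * \<tau> powr (1 + s)"
    by (simp add: powr_add mult_ac)
  have 4: "\<tau> powr (- 1 - s) = 1 / \<tau> powr (1 + s)" by (simp add: powr_minus_divide[symmetric])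
  have 5: "(4 * pi * \<tau>) powr (- real DIM(real ^ 'n) / 2) = 1 / (4 powr (real CARD('n) / 2) * pi powr (real CARD('n) / 2) * \<tau> powr (real CARD('n) / 2))"
    using assms by (simp add: powr_mult powr_minus_divide)
  define q :: real where "q = 4 powr (real CARD('n) / 2)"
  show ?thesis
    unfolding ext_kernel_def Let_def gauss_def poisson_density_def
    unfolding 1 2 3 4 5 q_def[symmetric] by (simp add: mult_ac)
qed

text \<open>\<open>extension\<close> is an iterated Lebesgue integral of an arbitrary
  representative. Tonelli for a Borel null set covering the exceptional set shows that on almost
  every time slice \<open>u\<close> and \<open>v\<close> agree almost everywhere in space; the outer
  integral ignores the other slices.\<close>

lemma extension_eq_conv:
  fixes u v :: "(real ^ 'n::finite) \<times> real \<Rightarrow> complex"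
  assumes s: "0 < s" and y: "y > 0" and v[measurable]: "v \<in> borel_measurable borel"
    and uv: "AE p in lebesgue. u p = v p" and vL: "\<And>p. cmod (v p) \<le> L"
  shows "extension s u x y t = conv (heat_kernel (poisson_density s y)) v (x, t)"
proof -
  let ?k = "heat_kernel (poisson_density s y) :: (real ^ 'n) \<times> real \<Rightarrow> real"
  have "{p. u p \<noteq> v p} \<in> null_sets lebesgue" using uv by (simp add: completion.AE_iff_null_sets)
  then obtain N where N: "N \<in> null_sets lborel" "{p. u p \<noteq> v p} \<subseteq> N"
    unfolding null_sets_completion_iff2 by blast
  have [measurable]: "N \<in> sets borel" using N by auto
  have "(\<integral>\<^sup>+\<tau>. \<integral>\<^sup>+z. indicator N ((x, t) - (z, \<tau>)) \<partial>lborel \<partial>lborel) = (\<integral>\<^sup>+r. indicator N ((x, t) - r) \<partial>lborel)"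
    by (rule nn_integral_lborel_pair[symmetric]) measurable
  also have "\<dots> = (\<integral>\<^sup>+r. indicator N r \<partial>lborel)" by (rule nn_integral_lborel_reflect) measurable
  also have "\<dots> = 0" using N by (simp add: null_setsD1)
  finally have "(\<integral>\<^sup>+\<tau>. \<integral>\<^sup>+z. indicator N (x - z, t - \<tau>) \<partial>lborel \<partial>lborel) = 0" by simp
  then have "AE \<tau> in lborel. (\<integral>\<^sup>+z. indicator N (x - z, t - \<tau>) \<partial>lborel) = 0"
    using nn_integral_0_iff_AE[of "\<lambda>\<tau>. \<integral>\<^sup>+z. indicator N (x - z, t - \<tau>) \<partial>lborel" lborel] by simp
  then have AE: "AE \<tau> in lborel. AE z in lborel. u (x - z, t - \<tau>) = v (x - z, t - \<tau>)"
  proof eventually_elim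
    case (elim \<tau>)
    have "AE z in lborel. (indicator N (x - z, t - \<tau>) :: ennreal) = 0"
      using elim nn_integral_0_iff_AE[of "\<lambda>z. indicator N (x - z, t - \<tau>)" lborel] by simp
    then show ?case by eventually_elim (use N(2) in \<open>auto simp: indicator_def split: if_splits\<close>)
  qed
  define I where "I = (\<lambda>\<tau>. LINT z|lborel. ?k (z, \<tau>) *\<^sub>R v ((x, t) - (z, \<tau>)))"
  have Im: "I \<in> borel_measurable borel" unfolding I_def by measurable
  have "extension s u x y t = (LINT \<tau>|lborel. I \<tau>)"
    unfolding extension_def set_lebesgue_integral_def
  proof (rule integral_lebesgue_cong_AE[OF Im])
    show "AE \<tau> in lborel. indicator {0<..} \<tau> *\<^sub>R (LINT z|lebesgue. complex_of_real (ext_kernel s z y \<tau>) * u (x - z, t - \<tau>)) = I \<tau>"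
      using AE
    proof eventually_elim
      case (elim \<tau>)
      show ?case
      proof (cases "\<tau> > 0")
        case True
        have "(LINT z|lebesgue. complex_of_real (ext_kernel s z y \<tau>) * u (x - z, t - \<tau>)) = I \<tau>"
          unfolding I_def
        proof (rule integral_lebesgue_cong_AE)
          show "AE z in lborel. complex_of_real (ext_kernel s z y \<tau>) * u (x - z, t - \<tau>) = ?k (z, \<tau>) *\<^sub>R v ((x, t) - (z, \<tau>))"
            using elim by eventually_elim (simp add: ext_kernel_eq[OF True] heat_kernel_def True scaleR_conv_of_real)
        qed measurable
        then show ?thesis using True by simp
      qed (simp add: I_def heat_kernel_def)
    qed
  qed
  also have "\<dots> = conv ?k v (x, t)"
    unfolding I_def conv_def
  proof (rule integral_lborel_pair[symmetric, where f="\<lambda>r. ?k r *\<^sub>R v ((x, t) - r)"])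
    have "integrable lborel ?k" by (intro integrable_heat_kernel measurable_densities poisson_density_integrable s y)
    then show "integrable lborel (\<lambda>r. ?k r *\<^sub>R v ((x, t) - r))"
      by (rule integrable_scaleR_bounded[where L=L]) (use vL in simp_all)
  qed
  finally show ?thesis .
qed

lemma heat_kernel_abs_le:
  assumes "\<And>\<tau>. \<tau> > 0 \<Longrightarrow> \<bar>\<phi> \<tau>\<bar> \<le> \<psi> \<tau>"
  shows "\<bar>heat_kernel \<phi> r\<bar> \<le> heat_kernel \<psi> r"
  using assms by (cases r) (auto simp: heat_kernel_def indicator_def abs_mult intro: mult_right_mono)

text \<open>For heights between \<open>y / 2\<close> and \<open>2 * y\<close> one integrable density
  dominates all conormal densities. The factor \<open>y powr (2 * s - 1)\<close> is split off
  because the weight of the conormal derivative cancels it.\<close>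

lemma conv_poisson_has_vector_derivative:
  fixes v :: "'a::euclidean_space \<times> real \<Rightarrow> complex"
  assumes s: "0 < s" and y: "y > 0" and v[measurable]: "v \<in> borel_measurable borel" and vL: "\<And>p. cmod (v p) \<le> L"
  shows "((\<lambda>\<eta>. conv (heat_kernel (poisson_density s \<eta>)) v p) has_vector_derivative
    (y powr (2 * s - 1) / (4 powr s * Gamma s)) *\<^sub>R conv (heat_kernel (conormal_density s y)) v p) (at y)"
proof -
  have L0: "L \<ge> 0" using vL[of 0] norm_ge_zero order_trans by blast
  have G: "Gamma s > 0" using s by (intro Gamma_real_pos) simp
  define A where "A = 4 powr s * Gamma s"
  have A: "A > 0" using G by (simp add: A_def)
  define c where "c = (\<lambda>\<eta>. \<eta> powr (2 * s - 1) / A)"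
  \<comment> \<open>For these heights \<open>\<eta>\<^sup>2 / 4 \<ge> y\<^sup>2 / 16\<close> in the
    exponent and \<open>\<eta>\<^sup>2 \<le> 4 * y\<^sup>2\<close> in the factor.\<close>
  define \<psi> where "\<psi> = (\<lambda>\<tau>. 2 * s * (\<tau> powr (- 1 - s) * exp (- (y\<^sup>2 / 16 / \<tau>))) + 2 * y\<^sup>2 * (\<tau> powr (- 2 - s) * exp (- (y\<^sup>2 / 16 / \<tau>))))"
  \<comment> \<open>The sign of \<open>2 * s - 1\<close> depends on \<open>s\<close>, so the powers
    at both ends of the interval are added.\<close>
  define C where "C = ((y / 2) powr (2 * s - 1) + (2 * y) powr (2 * s - 1)) / A"
  define f where "f = (\<lambda>\<eta> r. heat_kernel (poisson_density s \<eta>) r *\<^sub>R v (p - r))"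
  define D where "D = (\<lambda>\<eta> r h :: real. (h * c \<eta>) *\<^sub>R (heat_kernel (conormal_density s \<eta>) r *\<^sub>R v (p - r)))"
  have psi: "set_integrable lborel {0<..} \<psi>"
    unfolding \<psi>_def using y s by (intro set_integral_add set_integrable_mult_right set_integrable_powr_exp_inverse) auto
  have [measurable]: "\<psi> \<in> borel_measurable borel" unfolding \<psi>_def by measurable
  have conle: "\<bar>conormal_density s \<eta> \<tau>\<bar> \<le> \<psi> \<tau>" if "y / 2 < \<eta>" "\<eta> < 2 * y" "\<tau> > 0" for \<eta> \<tau>
  proof -
    have e1: "y\<^sup>2 / 16 \<le> \<eta>\<^sup>2 / 4" using power_mono[of "y/2" \<eta> 2] that y by (simp add: power_divide)
    have e2: "\<eta>\<^sup>2 \<le> 4 * y\<^sup>2" using power_mono[of \<eta> "2*y" 2] that y by (simp add: power_mult_distrib)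
    have "exp (- (\<eta>\<^sup>2 / 4 / \<tau>)) \<le> exp (- (y\<^sup>2 / 16 / \<tau>))" using divide_right_mono[OF e1, of \<tau>] that by simp
    moreover have "\<bar>2 * s - \<eta>\<^sup>2 / (2 * \<tau>)\<bar> \<le> 2 * s + 2 * y\<^sup>2 / \<tau>"
    proof -
      have "\<eta>\<^sup>2 / (2 * \<tau>) \<le> 4 * y\<^sup>2 / (2 * \<tau>)" using e2 that by (intro divide_right_mono) auto
      moreover have "0 \<le> \<eta>\<^sup>2 / (2 * \<tau>)" "0 \<le> y\<^sup>2 / \<tau>" using that by auto
      ultimately show ?thesis using s by (simp add: abs_le_iff)
    qed
    ultimately have "\<bar>conormal_density s \<eta> \<tau>\<bar> \<le> (2 * s + 2 * y\<^sup>2 / \<tau>) * \<tau> powr (- 1 - s) * exp (- (y\<^sup>2 / 16 / \<tau>))"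
      unfolding conormal_density_def abs_mult using that s y by (intro mult_mono) auto
    also have "\<dots> = \<psi> \<tau>"
    proof -
      have "\<tau> powr (- 2 - s) = \<tau> powr (- 1 - s) / \<tau>" using powr_diff[of \<tau> "- 1 - s" 1] that by simp
      then show ?thesis by (simp add: \<psi>_def algebra_simps)
    qed
    finally show ?thesis .
  qed
  have cle: "\<bar>c \<eta>\<bar> \<le> C" if "y / 2 < \<eta>" "\<eta> < 2 * y" for \<eta>
  proof -
    have "\<eta> powr (2 * s - 1) \<le> (y / 2) powr (2 * s - 1) + (2 * y) powr (2 * s - 1)"
    proof (cases "2 * s - 1 \<ge> 0")
      case True
      have "\<eta> powr (2 * s - 1) \<le> (2 * y) powr (2 * s - 1)" using that y True by (intro powr_mono2) auto
      then show ?thesis by (simp add: add_increasing)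
    next
      case False
      have "\<eta> powr (2 * s - 1) \<le> (y / 2) powr (2 * s - 1)" using that y False by (intro powr_mono2') auto
      then show ?thesis by (simp add: add_increasing2)
    qed
    then show ?thesis using A by (simp add: c_def C_def divide_right_mono)
  qed
  have "((\<lambda>\<eta>. LINT r|lborel. f \<eta> r) has_derivative (\<lambda>h. LINT r|lborel. D y r h)) (at y)"
  proof (rule has_derivative_lebesgue_integral(1)[where S="{y/2<..<2*y}" and g="\<lambda>r. C * heat_kernel \<psi> r * L"])
    show "open {y/2<..<2*y}" "convex {y/2<..<2*y}" "y \<in> {y/2<..<2*y}" using y by (auto simp: convex_real_interval)
    show "integrable lborel (f \<eta>)" if "\<eta> \<in> {y/2<..<2*y}" for \<eta>
    proof -
      have "integrable lborel (heat_kernel (poisson_density s \<eta>) :: 'a \<times> real \<Rightarrow> real)"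
        using that y by (intro integrable_heat_kernel measurable_densities poisson_density_integrable s) auto
      then show ?thesis unfolding f_def
        by (rule integrable_scaleR_bounded[where L=L]) (use vL in simp_all)
    qed
    show "((\<lambda>\<eta>. f \<eta> r) has_derivative D \<eta> r) (at \<eta>)" if "\<eta> \<in> {y/2<..<2*y}" for \<eta> r
    proof -
      have \<eta>: "\<eta> > 0" using that y by auto
      obtain z \<tau> where r: "r = (z, \<tau>)" by (rule prod.exhaust)
      have "((\<lambda>\<eta>. heat_kernel (poisson_density s \<eta>) r) has_real_derivative c \<eta> * heat_kernel (conormal_density s \<eta>) r) (at \<eta>)"
      proof (cases "\<tau> > 0")
        case True
        have p: "\<eta> powr (2 * s) = \<eta> powr (2 * s - 1) * \<eta>" using \<eta> by (simp add: powr_diff)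
        define T where "T = \<tau> powr (- 1 - s)"
        define E where "E = exp (- (\<eta>\<^sup>2 / 4 / \<tau>))"
        have dE: "((\<lambda>\<eta>. exp (- (\<eta>\<^sup>2 / 4 / \<tau>))) has_real_derivative E * (- (2 * \<eta> / 4 / \<tau>))) (at \<eta>)"
          unfolding E_def using True by (auto intro!: derivative_eq_intros)
        have "((\<lambda>\<eta>. \<eta> powr (2 * s) / A * (T * exp (- (\<eta>\<^sup>2 / 4 / \<tau>)))) has_real_derivative
            2 * s * \<eta> powr (2 * s - 1) / A * (T * E) + T * (E * (- (2 * \<eta> / 4 / \<tau>))) * (\<eta> powr (2 * s) / A)) (at \<eta>)"
          unfolding E_def by (intro DERIV_mult DERIV_cdivide DERIV_cmult has_real_derivative_powr \<eta> dE[unfolded E_def])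
        also have "2 * s * \<eta> powr (2 * s - 1) / A * (T * E) + T * (E * (- (2 * \<eta> / 4 / \<tau>))) * (\<eta> powr (2 * s) / A)
            = c \<eta> * ((2 * s - \<eta>\<^sup>2 / (2 * \<tau>)) * T * E)"
          unfolding c_def p using True A by (simp add: field_simps power2_eq_square)
        finally have "((\<lambda>\<eta>. poisson_density s \<eta> \<tau>) has_real_derivative c \<eta> * conormal_density s \<eta> \<tau>) (at \<eta>)"
          unfolding poisson_density_def conormal_density_def A_def[symmetric] T_def E_def .
        then have "((\<lambda>\<eta>. poisson_density s \<eta> \<tau> * gauss (4 * pi * \<tau>) z) has_real_derivative c \<eta> * conormal_density s \<eta> \<tau> * gauss (4 * pi * \<tau>) z) (at \<eta>)"
          by (rule DERIV_cmult_right)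
        then show ?thesis using True by (simp add: heat_kernel_def r mult_ac)
      qed (simp add: heat_kernel_def r)
      then have "((\<lambda>\<eta>. heat_kernel (poisson_density s \<eta>) r) has_derivative (\<lambda>h. h * (c \<eta> * heat_kernel (conormal_density s \<eta>) r))) (at \<eta>)"
        unfolding has_field_derivative_def by (subst mult.commute)
      from has_derivative_scaleR_left[OF this, of "v (p - r)"]
      show ?thesis by (simp add: f_def D_def[abs_def] mult.assoc)
    qed
    show "(\<lambda>r. D y r h) \<in> borel_measurable lborel" for h unfolding D_def by measurable
    show "norm (D \<eta> r h) \<le> C * heat_kernel \<psi> r * L * norm h" if "\<eta> \<in> {y/2<..<2*y}" for \<eta> r h
    proof -
      have "norm (D \<eta> r h) = \<bar>c \<eta>\<bar> * \<bar>heat_kernel (conormal_density s \<eta>) r\<bar> * cmod (v (p - r)) * norm h"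
        by (simp add: D_def abs_mult)
      also have "\<dots> \<le> C * heat_kernel \<psi> r * L * norm h"
        using that cle[of \<eta>] heat_kernel_abs_le[of "conormal_density s \<eta>" \<psi> r] conle[of \<eta>] vL[of "p - r"] L0
        by (intro mult_right_mono mult_mono) (auto intro: order_trans[OF abs_ge_zero])
      finally show ?thesis .
    qed
    show "integrable lborel (\<lambda>r. C * heat_kernel \<psi> r * L :: real)"
      by (intro integrable_mult_left integrable_mult_right integrable_heat_kernel psi) measurable
  qed
  moreover have "(LINT r|lborel. D y r h) = h *\<^sub>R (c y *\<^sub>R conv (heat_kernel (conormal_density s y)) v p)" for h
    unfolding D_def conv_def by (simp only: integral_scaleR_right scaleR_scaleR[symmetric])
  ultimately show ?thesis
    by (simp add: has_vector_derivative_def f_def conv_def[abs_def] c_def A_def)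
qed

lemma continuous_conv:
  fixes k :: "'a::euclidean_space \<Rightarrow> real"
  assumes k: "integrable lborel k" and w: "continuous_on UNIV w" and L: "\<And>p. cmod (w p) \<le> L"
  shows "continuous_on UNIV (conv k w)"
  unfolding continuous_on_eq_continuous_at[OF open_UNIV]
proof (intro ballI continuous_at_sequentiallyI)
  fix p X assume X: "X \<longlonglongrightarrow> (p :: 'a)"
  have [measurable]: "w \<in> borel_measurable borel" using w by (rule borel_measurable_continuous_onI)
  note [measurable] = borel_measurable_integrable[OF k]
  show "(\<lambda>n. conv k w (X n)) \<longlonglongrightarrow> conv k w p" unfolding conv_def
  proof (rule integral_dominated_convergence[where w="\<lambda>r. \<bar>k r\<bar> * L"])
    show "integrable lborel (\<lambda>r. \<bar>k r\<bar> * L)" using k by simp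
    show "AE r in lborel. (\<lambda>n. k r *\<^sub>R w (X n - r)) \<longlonglongrightarrow> k r *\<^sub>R w (p - r)"
      using w X by (intro AE_I2 tendsto_intros continuous_on_tendsto_compose[OF w]) auto
    show "AE r in lborel. norm (k r *\<^sub>R w (X n - r)) \<le> \<bar>k r\<bar> * L" for n
      using L by (intro AE_I2) (simp add: mult_left_mono)
  qed measurable
qed

text \<open>The set of disagreement is open and null, hence empty.\<close>

lemma continuous_eq_if_AE_eq:
  fixes F G :: "'a::euclidean_space \<Rightarrow> complex"
  assumes "continuous_on UNIV F" "continuous_on UNIV G" "AE p in lborel. F p = G p"
  shows "F p = G p"
proof -
  have "open {p. F p \<noteq> G p}" using assms(1,2) by (rule open_Collect_neq)
  moreover have "{p. F p \<noteq> G p} \<in> null_sets lebesgue"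
    using AE_completion[OF assms(3)] by (simp add: completion.AE_iff_null_sets)
  then have "negligible {p. F p \<noteq> G p}" by (simp add: negligible_iff_null_sets)
  ultimately have "{p. F p \<noteq> G p} = {}" using open_not_negligible by blast
  then show ?thesis by blast
qed

lemma parabolic_holder_continuous:
  fixes w :: "'a::real_normed_vector \<times> real \<Rightarrow> complex"
  assumes w: "\<And>p q. cmod (w p - w q) \<le> K * parabolic_dist p q powr \<alpha>" and a: "\<alpha> > 0"
  shows "continuous_on UNIV w"
  unfolding continuous_on_eq_continuous_at[OF open_UNIV]
proof (intro ballI continuous_at_sequentiallyI)
  fix p X assume X: "X \<longlonglongrightarrow> (p :: 'a \<times> real)"
  have "(\<lambda>n. parabolic_dist (X n) p) \<longlonglongrightarrow> norm (fst p - fst p) + sqrt \<bar>snd p - snd p\<bar>"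
    unfolding parabolic_dist_def by (intro tendsto_intros X)
  then have "(\<lambda>n. parabolic_dist (X n) p powr \<alpha>) \<longlonglongrightarrow> 0"
    using a by (intro tendsto_zero_powrI[OF _ tendsto_const]) (auto simp: parabolic_dist_def)
  then have "(\<lambda>n. K * parabolic_dist (X n) p powr \<alpha>) \<longlonglongrightarrow> 0" by (rule tendsto_mult_right_zero)
  then have "(\<lambda>n. w (X n) - w p) \<longlonglongrightarrow> 0"
    by (rule Lim_null_comparison[rotated]) (use w in auto)
  then show "(\<lambda>n. w (X n)) \<longlonglongrightarrow> w p" by (rule LIM_zero_cancel)
qed

section \<open>Parabolic scaling and the trace at \<open>y = 0\<close>\<close>

text \<open>Counting powers of \<open>y\<close>, the density contributes
  \<open>2 * \<sigma> - 2 - 2 * \<sigma> = - 2\<close> and the Gaussian \<open>- DIM('a)\<close>;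
  the Jacobian of the scaling compensates both.\<close>

lemma heat_kernel_poisson_scaling:
  assumes y: "y > 0"
  shows "y\<^sup>2 * y ^ DIM('a) * heat_kernel (poisson_density \<sigma> y) (y *\<^sub>R (z::'a::euclidean_space), y\<^sup>2 * \<rho>) = heat_kernel (poisson_density \<sigma> 1) (z, \<rho>)"
proof (cases "\<rho> > 0")
  case True
  have y2: "(y\<^sup>2) powr b = y powr (2 * b)" for b using y by (simp add: powr_powr flip: powr_numeral)
  have "poisson_density \<sigma> y (y\<^sup>2 * \<rho>) = poisson_density \<sigma> 1 \<rho> * y powr (- 2)"
  proof -
    have "(y\<^sup>2 * \<rho>) powr (- 1 - \<sigma>) = y powr (- 2 - 2 * \<sigma>) * \<rho> powr (- 1 - \<sigma>)"
      using y True by (simp add: powr_mult y2 algebra_simps)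
    moreover have "y powr (2 * \<sigma>) * y powr (- 2 - 2 * \<sigma>) = y powr (- 2)" by (simp flip: powr_add)
    moreover have "y\<^sup>2 / 4 / (y\<^sup>2 * \<rho>) = 1\<^sup>2 / 4 / \<rho>" using y by simp
    ultimately show ?thesis by (simp add: poisson_density_def)
  qed
  moreover have "gauss (4 * pi * (y\<^sup>2 * \<rho>)) (y *\<^sub>R z) = y powr (- real DIM('a)) * gauss (4 * pi * \<rho>) z"
  proof -
    have "(4 * pi * (y\<^sup>2 * \<rho>)) powr (- real DIM('a) / 2) = (y\<^sup>2) powr (- real DIM('a) / 2) * (4 * pi * \<rho>) powr (- real DIM('a) / 2)"
      using y True by (simp add: powr_mult)
    moreover have "(norm (y *\<^sub>R z))\<^sup>2 / (4 * pi * (y\<^sup>2 * \<rho>)) = (norm z)\<^sup>2 / (4 * pi * \<rho>)"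
      using y by (simp add: power_mult_distrib)
    ultimately show ?thesis by (simp add: gauss_def y2 power_mult_distrib)
  qed
  moreover have "y powr (- 2) = 1 / y\<^sup>2" "y powr (- real DIM('a)) = 1 / y ^ DIM('a)"
    using y by (simp_all add: powr_minus_divide powr_realpow)
  ultimately show ?thesis using y True by (simp add: heat_kernel_def)
qed (use y in \<open>simp add: heat_kernel_def zero_less_mult_iff\<close>)

text \<open>The dependence on \<open>y\<close> moves from the kernel, singular as \<open>y\<close>
  tends to 0, into the argument of \<open>w\<close>, where Hoelder continuity applies.\<close>

lemma conv_poisson_scaled:
  fixes w :: "'a::euclidean_space \<times> real \<Rightarrow> complex"
  assumes s: "0 < \<sigma>" and y: "y > 0" and [measurable]: "w \<in> borel_measurable borel" and wL: "\<And>p. cmod (w p) \<le> L"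
  shows "conv (heat_kernel (poisson_density \<sigma> y)) w (x, t) =
    (LINT r|lborel. heat_kernel (poisson_density \<sigma> 1) r *\<^sub>R w (x - y *\<^sub>R fst r, t - y\<^sup>2 * snd r))"
proof -
  let ?k = "\<lambda>y. heat_kernel (poisson_density \<sigma> y) :: 'a \<times> real \<Rightarrow> real"
  have i: "integrable lborel (?k y)" if "y > 0" for y
    by (intro integrable_heat_kernel measurable_densities poisson_density_integrable s that)
  have "integrable lborel (\<lambda>r. ?k y r *\<^sub>R w ((x, t) - r))"
    by (rule integrable_scaleR_bounded[OF i[OF y], where L=L]) (use wL in simp_all)
  then have "conv (?k y) w (x, t) = (LINT \<tau>|lborel. LINT z|lborel. ?k y (z, \<tau>) *\<^sub>R w ((x, t) - (z, \<tau>)))"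
    unfolding conv_def by (rule integral_lborel_pair)
  also have "\<dots> = (LINT \<tau>|lborel. y ^ DIM('a) *\<^sub>R (LINT z|lborel. ?k y (y *\<^sub>R z, \<tau>) *\<^sub>R w (x - y *\<^sub>R z, t - \<tau>)))"
    using y by (subst integral_lborel_affine[where c=y and t=0]) (auto)
  also have "\<dots> = y\<^sup>2 *\<^sub>R (LINT \<rho>|lborel. y ^ DIM('a) *\<^sub>R (LINT z|lborel. ?k y (y *\<^sub>R z, y\<^sup>2 * \<rho>) *\<^sub>R w (x - y *\<^sub>R z, t - y\<^sup>2 * \<rho>)))"
    using y by (subst integral_lborel_affine[where c="y\<^sup>2" and t=0]) (auto)
  also have "\<dots> = (LINT \<rho>|lborel. LINT z|lborel. (y\<^sup>2 * y ^ DIM('a) * ?k y (y *\<^sub>R z, y\<^sup>2 * \<rho>)) *\<^sub>R w (x - y *\<^sub>R z, t - y\<^sup>2 * \<rho>))"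
    by (simp flip: scaleR_scaleR)
  also have "\<dots> = (LINT \<rho>|lborel. LINT z|lborel. ?k 1 (z, \<rho>) *\<^sub>R w (x - y *\<^sub>R fst (z, \<rho>), t - y\<^sup>2 * snd (z, \<rho>)))"
    unfolding heat_kernel_poisson_scaling[OF y] by simp
  also have "\<dots> = (LINT r|lborel. ?k 1 r *\<^sub>R w (x - y *\<^sub>R fst r, t - y\<^sup>2 * snd r))"
  proof (rule integral_lborel_pair[symmetric])
    show "integrable lborel (\<lambda>r. ?k 1 r *\<^sub>R w (x - y *\<^sub>R fst r, t - y\<^sup>2 * snd r))"
      by (rule integrable_scaleR_bounded[OF i, where L=L]) (use wL in \<open>simp_all add: borel_prod[symmetric]\<close>)
  qed
  finally show ?thesis .
qed

text \<open>The weight costs a factor \<open>1 + \<tau> powr (\<alpha> / 2)\<close> and a Gaussian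
  moment. As the density decays like \<open>\<tau> powr (- 1 - \<sigma>)\<close>, integrability at
  infinity follows from \<open>\<alpha> / 2 < \<sigma>\<close>.\<close>

lemma integrable_poisson_moment:
  assumes s: "0 < \<sigma>" and a: "0 < \<alpha>" "\<alpha> \<le> 1" "\<alpha> \<le> \<sigma>"
  shows "integrable lborel (\<lambda>r :: 'a::euclidean_space \<times> real. heat_kernel (poisson_density \<sigma> 1) r * (2 + norm (fst r) + sqrt (snd r)) powr \<alpha>)"
proof -
  define c where "c = 2 * 2 powr (real DIM('a) / 2)"
  define \<phi> where "\<phi> = (\<lambda>\<rho>. 4 * (poisson_density \<sigma> 1 \<rho> * (1 + \<rho> powr (\<alpha> / 2))))"
  define H where "H = (\<lambda>(z :: 'a, \<tau>). indicator {0<..} \<tau> * \<phi> \<tau> * (gauss (4 * pi * \<tau>) z + c * gauss (2 * (4 * pi * \<tau>)) z))"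
  have [measurable]: "\<phi> \<in> borel_measurable borel" unfolding \<phi>_def by measurable
  have G: "Gamma \<sigma> > 0" using s by (intro Gamma_real_pos) simp
  have ppos: "poisson_density \<sigma> 1 \<rho> \<ge> 0" for \<rho> using G by (simp add: poisson_density_def)
  have "set_integrable lborel {0<..} (\<lambda>\<rho>. poisson_density \<sigma> 1 \<rho> * \<rho> powr (\<alpha> / 2))"
  proof -
    have "set_integrable lborel {0<..} (\<lambda>\<rho>. 1 / (4 powr \<sigma> * Gamma \<sigma>) * (\<rho> powr (- 1 - \<sigma> + \<alpha> / 2) * exp (- (1 / 4 / \<rho>))))"
      using s a by (intro set_integrable_mult_right set_integrable_powr_exp_inverse) auto
    also have "(\<lambda>\<rho>. 1 / (4 powr \<sigma> * Gamma \<sigma>) * (\<rho> powr (- 1 - \<sigma> + \<alpha> / 2) * exp (- (1 / 4 / \<rho>)))) = (\<lambda>\<rho>. poisson_density \<sigma> 1 \<rho> * \<rho> powr (\<alpha> / 2))"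
      by (simp add: poisson_density_def powr_add mult_ac)
    finally show ?thesis .
  qed
  then have \<phi>i: "set_integrable lborel {0<..} \<phi>"
    unfolding \<phi>_def distrib_left by (intro set_integrable_mult_right set_integral_add) (use s in \<open>simp_all add: poisson_density_integrable\<close>)
  have Hi: "integrable lborel H"
    unfolding H_def by (rule integrable_gauss_moment[OF _ _ \<phi>i]) (auto simp: \<phi>_def c_def ppos)
  show ?thesis
  proof (rule Bochner_Integration.integrable_bound[OF Hi])
    show "AE r :: 'a \<times> real in lborel. norm (heat_kernel (poisson_density \<sigma> 1) r * (2 + norm (fst r) + sqrt (snd r)) powr \<alpha>) \<le> norm (H r)"
    proof (intro AE_I2)
      fix r :: "'a \<times> real"
      obtain z \<rho> where r: "r = (z, \<rho>)" by (rule prod.exhaust)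
      show "norm (heat_kernel (poisson_density \<sigma> 1) r * (2 + norm (fst r) + sqrt (snd r)) powr \<alpha>) \<le> norm (H r)"
      proof (cases "\<rho> > 0")
        case True
        define q where "q = sqrt \<rho>"
        define X where "X = norm z / q"
        have q: "q > 0" "q * q = \<rho>" using True by (auto simp: q_def)
        have X: "X \<ge> 0" "norm z = X * q" using q by (auto simp: X_def)
        have Xe: "4 * (1 + pi * (norm z)\<^sup>2 / (4 * pi * \<rho>)) = 4 + X\<^sup>2"
          using q by (simp add: X(2) power_mult_distrib power2_eq_square flip: q(2))
        \<comment> \<open>The difference of the two sides of the next inequality, with the square in
          \<open>X\<close> completed.\<close>
        have "0 \<le> q * ((X - 1/2)\<^sup>2 + 11/4) + X\<^sup>2 + 2" using q by simp
        then have "2 + norm z + q \<le> (1 + q) * (4 + X\<^sup>2)"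
          unfolding X(2) by (simp add: power2_eq_square algebra_simps)
        then have "(2 + norm z + q) powr \<alpha> \<le> ((1 + q) * (4 + X\<^sup>2)) powr \<alpha>"
          using q a by (intro powr_mono2) auto
        also have "\<dots> = (1 + q) powr \<alpha> * (4 + X\<^sup>2) powr \<alpha>" by (rule powr_mult)
        also have "\<dots> \<le> (1 + \<rho> powr (\<alpha> / 2)) * (4 + X\<^sup>2)"
        proof (rule mult_mono)
          have "q powr \<alpha> = \<rho> powr (\<alpha> / 2)" unfolding q_def using True by (simp add: powr_powr flip: powr_half_sqrt)
          then show "(1 + q) powr \<alpha> \<le> 1 + \<rho> powr (\<alpha> / 2)" using powr_one_plus_le[of 1 q \<alpha>] q a by simp
          have "(4 + X\<^sup>2) powr \<alpha> \<le> (4 + X\<^sup>2) powr 1" using a by (intro powr_mono) (auto intro: order_trans[of 1 4])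
          then show "(4 + X\<^sup>2) powr \<alpha> \<le> 4 + X\<^sup>2" by simp
        qed auto
        finally have m: "(2 + norm z + q) powr \<alpha> \<le> (1 + \<rho> powr (\<alpha> / 2)) * (4 + X\<^sup>2)" .
        let ?p = "poisson_density \<sigma> 1 \<rho>" and ?g = "gauss (4 * pi * \<rho>) z"
        have "?p * ?g * (2 + norm z + q) powr \<alpha> \<le> ?p * ?g * ((1 + \<rho> powr (\<alpha> / 2)) * (4 + X\<^sup>2))"
          using m ppos by (intro mult_left_mono) auto
        also have "\<dots> = \<phi> \<rho> * (?g * (1 + pi * (norm z)\<^sup>2 / (4 * pi * \<rho>)))"
          unfolding Xe[symmetric] \<phi>_def by (simp only: mult_ac)
        also have "\<dots> \<le> \<phi> \<rho> * (?g + c * gauss (2 * (4 * pi * \<rho>)) z)"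
          unfolding c_def using True ppos by (intro mult_left_mono gauss_moment_le) (auto simp: \<phi>_def)
        finally have "?p * ?g * (2 + norm z + q) powr \<alpha> \<le> H r" using True by (simp add: H_def r)
        moreover have "0 \<le> ?p * ?g * (2 + norm z + q) powr \<alpha>" using ppos by simp
        moreover have "heat_kernel (poisson_density \<sigma> 1) r * (2 + norm (fst r) + sqrt (snd r)) powr \<alpha> = ?p * ?g * (2 + norm z + q) powr \<alpha>"
          using True by (simp add: r heat_kernel_def q_def)
        ultimately show ?thesis by (simp only: real_norm_def)
      qed (simp add: r heat_kernel_def)
    qed
    have "(\<lambda>r :: 'a \<times> real. (2 + norm (fst r) + sqrt (snd r)) powr \<alpha>) \<in> borel_measurable borel"
      unfolding borel_prod[symmetric] by measurable
    then show "(\<lambda>r :: 'a \<times> real. heat_kernel (poisson_density \<sigma> 1) r * (2 + norm (fst r) + sqrt (snd r)) powr \<alpha>) \<in> borel_measurable lborel"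
      by simp
  qed
qed

text \<open>On the bounded set both \<open>d\<close> and the square root of
  \<open>|y\<^sup>2 - y'\<^sup>2|\<close> are at most \<open>q = sqrt (4 * M * d)\<close>. The
  arguments of \<open>w\<close> are therefore at parabolic distance at most \<open>q * m r\<close>,
  and the kernel has a finite moment with weight \<open>m r powr \<alpha>\<close>.\<close>

lemma parabolic_holder_poisson_trace:
  fixes w :: "(real ^ 'n::finite) \<times> real \<Rightarrow> complex"
  assumes s: "0 < \<sigma>" and a: "0 < \<alpha>" "\<alpha> \<le> 1" "\<alpha> \<le> \<sigma>" and [measurable]: "w \<in> borel_measurable borel"
    and wL: "\<And>p. cmod (w p) \<le> L" and wK: "\<And>p q. cmod (w p - w q) \<le> K * parabolic_dist p q powr \<alpha>" and K: "K \<ge> 0" and M: "M > 0"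
  shows "parabolic_holder_on (\<alpha> / 2) (half_ball_upto M \<times> {- M\<^sup>2<..<M\<^sup>2})
    (\<lambda>((x, y), t). LINT r|lborel. heat_kernel (poisson_density \<sigma> 1) r *\<^sub>R w (x - y *\<^sub>R fst r, t - y\<^sup>2 * snd r))"
proof -
  let ?k = "heat_kernel (poisson_density \<sigma> 1) :: (real ^ 'n) \<times> real \<Rightarrow> real"
  \<comment> \<open>The 2 accounts for the differences in \<open>x\<close> and \<open>t\<close>, the
    other terms for those of \<open>y *\<^sub>R z\<close> and
    \<open>y\<^sup>2 * \<rho>\<close>.\<close>
  define m where "m = (\<lambda>r :: (real ^ 'n) \<times> real. 2 + norm (fst r) + sqrt (snd r))"
  define B where "B = (LINT r|lborel. ?k r * m r powr \<alpha>)"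
  have mi: "integrable lborel (\<lambda>r. ?k r * m r powr \<alpha>)" unfolding m_def by (rule integrable_poisson_moment[OF s a])
  have ki: "integrable lborel ?k" by (intro integrable_heat_kernel measurable_densities poisson_density_integrable s) simp
  have G: "Gamma \<sigma> > 0" using s by (intro Gamma_real_pos) simp
  have kpos: "?k r \<ge> 0" for r using G by (cases r) (simp add: heat_kernel_def poisson_density_def)
  have int: "integrable lborel (\<lambda>r. ?k r *\<^sub>R w (x - y *\<^sub>R fst r, t - y\<^sup>2 * snd r))" for x y t
    by (rule integrable_scaleR_bounded[OF ki, where L=L]) (use wL in \<open>simp_all add: borel_prod[symmetric]\<close>)
  have main: "cmod ((LINT r|lborel. ?k r *\<^sub>R w (x - y *\<^sub>R fst r, t - y\<^sup>2 * snd r)) - (LINT r|lborel. ?k r *\<^sub>R w (x' - y' *\<^sub>R fst r, t' - y'\<^sup>2 * snd r)))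
      \<le> K * (4 * M) powr (\<alpha> / 2) * B * parabolic_dist ((x, y), t) ((x', y'), t') powr (\<alpha> / 2)"
    if P: "(x, y) \<in> half_ball_upto M" "\<bar>t\<bar> < M\<^sup>2" and Q: "(x', y') \<in> half_ball_upto M" "\<bar>t'\<bar> < M\<^sup>2" for x y t x' y' t'
  proof -
    define d where "d = parabolic_dist ((x, y), t) ((x', y'), t')"
    have d: "d = norm (x - x', y - y') + sqrt \<bar>t - t'\<bar>" by (simp add: d_def parabolic_dist_def)
    have y: "0 \<le> y" "y \<le> M" "norm (x, y) < M" using P norm_snd_le[of y x] by (auto simp: half_ball_upto_def)
    have y': "0 \<le> y'" "y' \<le> M" "norm (x', y') < M" using Q norm_snd_le[of y' x'] by (auto simp: half_ball_upto_def)
    have d0: "d \<ge> 0" and dx: "norm (x - x') \<le> d" and dy: "\<bar>y - y'\<bar> \<le> d" and dt: "sqrt \<bar>t - t'\<bar> \<le> d"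
      using norm_fst_le[of "x - x'" "y - y'"] norm_snd_le[of "y - y'" "x - x'"] unfolding d by (auto intro: add_increasing add_increasing2)
    have dM: "d \<le> 4 * M"
    proof -
      have "norm (x - x', y - y') \<le> norm (x, y) + norm (x', y')" using norm_triangle_ineq4[of "(x, y)" "(x', y')"] by simp
      moreover have "sqrt \<bar>t - t'\<bar> \<le> sqrt ((2 * M)\<^sup>2)" using P Q zero_le_power2[of M] by (intro real_sqrt_le_mono) (simp add: power_mult_distrib)
      moreover have "sqrt ((2 * M)\<^sup>2) = 2 * M" by (rule real_sqrt_unique) (use M in auto)
      ultimately show ?thesis unfolding d using y(3) y'(3) by linarith
    qed
    \<comment> \<open>The factor \<open>4 * M\<close> bounds \<open>d\<close>, which gives
      \<open>d \<le> q\<close>, and also \<open>y + y'\<close>, which controls the difference of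
      squares.\<close>
    define q where "q = sqrt (4 * M * d)"
    have dq: "d \<le> q" unfolding q_def using d0 dM by (intro real_le_rsqrt) (simp add: power2_eq_square mult_right_mono)
    have q0: "q \<ge> 0" using d0 M by (simp add: q_def)
    have sq: "sqrt (\<bar>y\<^sup>2 - y'\<^sup>2\<bar>) \<le> q"
    proof -
      have "\<bar>y\<^sup>2 - y'\<^sup>2\<bar> = \<bar>y + y'\<bar> * \<bar>y - y'\<bar>" by (simp add: power2_eq_square algebra_simps flip: abs_mult)
      also have "\<dots> \<le> (4 * M) * d" using y y' M dy by (intro mult_mono) auto
      finally show ?thesis by (simp add: q_def)
    qed
    have pt: "cmod (?k r *\<^sub>R w (x - y *\<^sub>R fst r, t - y\<^sup>2 * snd r) - ?k r *\<^sub>R w (x' - y' *\<^sub>R fst r, t' - y'\<^sup>2 * snd r))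
        \<le> K * q powr \<alpha> * (?k r * m r powr \<alpha>)" for r
    proof -
      obtain z \<rho> where r: "r = (z, \<rho>)" by (rule prod.exhaust)
      show ?thesis
      proof (cases "\<rho> > 0")
        case True
        let ?d = "parabolic_dist (x - y *\<^sub>R z, t - y\<^sup>2 * \<rho>) (x' - y' *\<^sub>R z, t' - y'\<^sup>2 * \<rho>)"
        have "norm ((x - y *\<^sub>R z) - (x' - y' *\<^sub>R z)) = norm ((x - x') - (y - y') *\<^sub>R z)" by (simp add: algebra_simps)
        also have "\<dots> \<le> norm (x - x') + \<bar>y - y'\<bar> * norm z" using norm_triangle_ineq4[of "x - x'" "(y - y') *\<^sub>R z"] by simp
        also have "\<dots> \<le> q + q * norm z" using dx dy dq by (intro add_mono mult_right_mono) auto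
        finally have 1: "norm ((x - y *\<^sub>R z) - (x' - y' *\<^sub>R z)) \<le> q + q * norm z" .
        have "\<bar>(t - y\<^sup>2 * \<rho>) - (t' - y'\<^sup>2 * \<rho>)\<bar> = \<bar>(t - t') - (y\<^sup>2 - y'\<^sup>2) * \<rho>\<bar>" by (simp add: algebra_simps)
        also have "\<dots> \<le> \<bar>t - t'\<bar> + \<bar>y\<^sup>2 - y'\<^sup>2\<bar> * \<rho>" using abs_triangle_ineq4[of "t - t'" "(y\<^sup>2 - y'\<^sup>2) * \<rho>"] True by (simp add: abs_mult)
        finally have "sqrt \<bar>(t - y\<^sup>2 * \<rho>) - (t' - y'\<^sup>2 * \<rho>)\<bar> \<le> sqrt (\<bar>t - t'\<bar> + \<bar>y\<^sup>2 - y'\<^sup>2\<bar> * \<rho>)" by (rule real_sqrt_le_mono)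
        also have "\<dots> \<le> sqrt \<bar>t - t'\<bar> + sqrt (\<bar>y\<^sup>2 - y'\<^sup>2\<bar> * \<rho>)" using True by (intro sqrt_add_le_add_sqrt) auto
        also have "\<dots> \<le> q + q * sqrt \<rho>" unfolding real_sqrt_mult using dt dq sq True by (intro add_mono mult_right_mono) auto
        finally have "?d \<le> q * m r" using 1 by (simp add: parabolic_dist_def m_def r algebra_simps)
        then have "?d powr \<alpha> \<le> (q * m r) powr \<alpha>" using a by (intro powr_mono2) (auto simp: parabolic_dist_def)
        also have "\<dots> = q powr \<alpha> * m r powr \<alpha>" by (rule powr_mult)
        finally have "K * ?d powr \<alpha> \<le> K * (q powr \<alpha> * m r powr \<alpha>)" using K by (rule mult_left_mono)
        from order_trans[OF wK this] have "cmod (w (x - y *\<^sub>R z, t - y\<^sup>2 * \<rho>) - w (x' - y' *\<^sub>R z, t' - y'\<^sup>2 * \<rho>)) \<le> K * (q powr \<alpha> * m r powr \<alpha>)" .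
        from mult_left_mono[OF this kpos[of r]] show ?thesis
          using kpos[of r] by (simp add: r mult_ac flip: scaleR_diff_right)
      qed (simp add: r heat_kernel_def)
    qed
    have "cmod ((LINT r|lborel. ?k r *\<^sub>R w (x - y *\<^sub>R fst r, t - y\<^sup>2 * snd r)) - (LINT r|lborel. ?k r *\<^sub>R w (x' - y' *\<^sub>R fst r, t' - y'\<^sup>2 * snd r)))
        = cmod (LINT r|lborel. ?k r *\<^sub>R w (x - y *\<^sub>R fst r, t - y\<^sup>2 * snd r) - ?k r *\<^sub>R w (x' - y' *\<^sub>R fst r, t' - y'\<^sup>2 * snd r))"
      by (subst Bochner_Integration.integral_diff[OF int int]) simp
    also have "\<dots> \<le> (LINT r|lborel. K * q powr \<alpha> * (?k r * m r powr \<alpha>))"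
      by (rule order_trans[OF integral_norm_bound integral_mono'])
        (use pt kpos K in \<open>auto intro!: integrable_mult_right mi\<close>)
    also have "\<dots> = K * q powr \<alpha> * B" by (simp add: B_def)
    also have "q powr \<alpha> = (4 * M) powr (\<alpha> / 2) * d powr (\<alpha> / 2)"
      using M d0 by (simp add: q_def powr_powr powr_mult flip: powr_half_sqrt)
    finally show ?thesis unfolding d_def by (simp add: mult_ac)
  qed
  define W where "W = (\<lambda>((x, y), t). LINT r|lborel. ?k r *\<^sub>R w (x - y *\<^sub>R fst r, t - y\<^sup>2 * snd r))"
  have "parabolic_holder_on (\<alpha> / 2) (half_ball_upto M \<times> {- M\<^sup>2<..<M\<^sup>2}) W"
    unfolding parabolic_holder_on_def
  proof (intro exI[of _ "K * (4 * M) powr (\<alpha> / 2) * B"] ballI)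
    fix P Q :: "((real ^ 'n) \<times> real) \<times> real"
    assume P: "P \<in> half_ball_upto M \<times> {- M\<^sup>2<..<M\<^sup>2}" and Q: "Q \<in> half_ball_upto M \<times> {- M\<^sup>2<..<M\<^sup>2}"
    have pq: "P = ((fst (fst P), snd (fst P)), snd P)" "Q = ((fst (fst Q), snd (fst Q)), snd Q)" by simp_all
    show "cmod (W P - W Q) \<le> K * (4 * M) powr (\<alpha> / 2) * B * parabolic_dist P Q powr (\<alpha> / 2)"
      using main[of "fst (fst P)" "snd (fst P)" "snd P" "fst (fst Q)" "snd (fst Q)" "snd Q"] P Q
      by (simp add: W_def split_beta mem_Times_iff abs_less_iff)
  qed
  then show ?thesis unfolding W_def .
qed

section \<open>From the equation to the conormal derivative\<close>

text \<open>The symbol stays in the closed right half-plane, away from the branch cut except at 0,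
  where the power is continuous because \<open>s > 0\<close>.\<close>

lemma borel_measurable_heat_symbol:
  assumes "0 < s"
  shows "(heat_symbol s :: (real ^ 'n::finite) \<times> real \<Rightarrow> complex) \<in> borel_measurable borel"
  unfolding heat_symbol_def split_beta
proof (intro borel_measurable_continuous_onI continuous_on_powr_complex)
qed (use assms in \<open>auto intro!: continuous_intros\<close>)

text \<open>The spectral identity holds almost everywhere, with an exceptional set that may change
  with \<open>y\<close>, whereas the conormal derivative is needed at every point. Continuity of
  both sides removes the exceptional sets.\<close>

lemma conormal_representation_pointwise:
  fixes u f v f' :: "(real ^ 'n::finite) \<times> real \<Rightarrow> complex"
  assumes s: "0 < s" "s < 1" and y: "y > 0" and u: "spectral u g" and f: "spectral f (\<lambda>z. heat_symbol s z * g z)"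
    and uv: "AE p in lborel. u p = v p" and ff: "AE p in lborel. f p = f' p"
    and v: "continuous_on UNIV v" "\<And>p. cmod (v p) \<le> L" and f': "continuous_on UNIV f'" "\<And>p. cmod (f' p) \<le> L'"
  shows "conv (heat_kernel (conormal_density s y)) v p = - complex_of_real (2 * Gamma (1 - s)) * conv (heat_kernel (poisson_density (1 - s) y)) f' p"
proof (rule continuous_eq_if_AE_eq[where F="conv (heat_kernel (conormal_density s y)) v" and
      G="\<lambda>p. - complex_of_real (2 * Gamma (1 - s)) * conv (heat_kernel (poisson_density (1 - s) y)) f' p"])
  let ?C = "heat_kernel (conormal_density s y) :: (real ^ 'n) \<times> real \<Rightarrow> real"
  let ?P = "heat_kernel (poisson_density (1 - s) y) :: (real ^ 'n) \<times> real \<Rightarrow> real"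
  have C: "integrable lborel ?C" by (intro integrable_heat_kernel measurable_densities conormal_density_integrable s y)
  have P: "integrable lborel ?P" by (intro integrable_heat_kernel measurable_densities poisson_density_integrable y) (use s in simp)
  have [measurable]: "u \<in> borel_measurable borel" "f \<in> borel_measurable borel"
    using u f by (auto simp: spectral_def sq_int_def)
  have [measurable]: "v \<in> borel_measurable borel" "f' \<in> borel_measurable borel"
    using v f' by (auto intro: borel_measurable_continuous_onI)
  have Cv: "conv ?C u p = conv ?C v p" for p by (rule conv_cong_AE[OF _ _ _ uv]) measurable
  have Pf: "conv ?P f p = conv ?P f' p" for p by (rule conv_cong_AE[OF _ _ _ ff]) measurable
  show "continuous_on UNIV (conv ?C v)" by (rule continuous_conv[OF C v])
  show "continuous_on UNIV (\<lambda>p. - complex_of_real (2 * Gamma (1 - s)) * conv ?P f' p)"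
    by (intro continuous_on_mult_left continuous_conv[OF P f'])
  show "AE p in lborel. conv ?C v p = - complex_of_real (2 * Gamma (1 - s)) * conv ?P f' p"
    using conormal_representation[OF s y u f] by (simp only: Cv Pf)
qed

text \<open>Trades the Lebesgue classes of \<open>H_eq\<close> for Borel representatives. Square
  integrability of \<open>heat_symbol s z * h z\<close> comes from its representing the transform of
  the right-hand side.\<close>

lemma Dom_H_spectral:
  fixes u f :: "(real ^ 'n::finite) \<times> real \<Rightarrow> complex" and q :: "(real ^ 'n) \<times> real \<Rightarrow> real"
  assumes s: "0 < s" and eq: "H_eq s u (\<lambda>p. complex_of_real (q p) * u p)" and q: "q \<in> borel_measurable borel" "\<And>p. \<bar>q p\<bar> \<le> B"
  obtains w h where "AE p in lebesgue. u p = w p" "spectral w h"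
    "spectral (\<lambda>p. complex_of_real (q p) * w p) (\<lambda>z. heat_symbol s z * h z)"
proof -
  let ?f = "\<lambda>p. complex_of_real (q p) * u p"
  obtain g where ug: "has_L2_fourier u g" and fg: "has_L2_fourier ?f (\<lambda>p. heat_symbol s p * g p)"
    using eq by (auto simp: H_eq_def)
  obtain w where w: "sq_int w" "AE p in lebesgue. u p = w p"
    using ug by (auto simp: has_L2_fourier_def elim: sq_int_representative)
  obtain h where h: "sq_int h" "AE p in lebesgue. g p = h p"
    using ug by (auto simp: has_L2_fourier_def elim: sq_int_representative)
  have [measurable]: "q \<in> borel_measurable borel" "h \<in> borel_measurable borel" by (fact q sq_intD[OF h(1)])+
  note [measurable] = borel_measurable_heat_symbol[OF s, where 'n='n]
  have qw: "sq_int (\<lambda>p. complex_of_real (q p) * w p)"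
    by (rule sq_int_mult_bounded[OF w(1), where B=B]) (use q in auto)
  have hh: "sq_int (\<lambda>z. heat_symbol s z * h z)"
    unfolding sq_int_def
  proof
    have L: "integrable lebesgue (\<lambda>z. (cmod (heat_symbol s z * g z))\<^sup>2)"
      using fg by (simp add: has_L2_fourier_def L2_def)
    have m: "(\<lambda>z. (cmod (heat_symbol s z * h z))\<^sup>2) \<in> borel_measurable borel" by measurable
    have "integrable lebesgue (\<lambda>z. (cmod (heat_symbol s z * h z))\<^sup>2)"
    proof (rule integrable_cong_AE_imp[OF L])
      show "(\<lambda>z. (cmod (heat_symbol s z * h z))\<^sup>2) \<in> borel_measurable lebesgue"
        using m by (intro measurable_completion) simp
      show "AE z in lebesgue. (cmod (heat_symbol s z * g z))\<^sup>2 = (cmod (heat_symbol s z * h z))\<^sup>2"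
        using h(2) by eventually_elim simp
    qed
    then show "integrable lborel (\<lambda>z. (cmod (heat_symbol s z * h z))\<^sup>2)"
      using integrable_lebesgue_iff_lborel[OF m] by simp
  qed measurable
  have "spectral w h" by (rule spectral_if_L2_fourier[OF ug w h])
  moreover have "spectral (\<lambda>p. complex_of_real (q p) * w p) (\<lambda>z. heat_symbol s z * h z)"
  proof (rule spectral_if_L2_fourier[OF fg qw _ hh])
    show "AE p in lebesgue. complex_of_real (q p) * u p = complex_of_real (q p) * w p"
      using w(2) by eventually_elim simp
    show "AE p in lebesgue. heat_symbol s p * g p = heat_symbol s p * h p"
      using h(2) by eventually_elim simp
  qed
  ultimately show ?thesis by (rule that[OF w(2)])
qed

lemma parabolic_holder_on_cmult:
  assumes "parabolic_holder_on \<alpha> S W"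
  shows "parabolic_holder_on \<alpha> S (\<lambda>P. c * W P)"
proof -
  obtain C where C: "\<And>P Q. P \<in> S \<Longrightarrow> Q \<in> S \<Longrightarrow> cmod (W P - W Q) \<le> C * parabolic_dist P Q powr \<alpha>"
    using assms unfolding parabolic_holder_on_def by blast
  have "cmod (c * W P - c * W Q) \<le> cmod c * C * parabolic_dist P Q powr \<alpha>" if "P \<in> S" "Q \<in> S" for P Q
    using mult_left_mono[OF C[OF that] norm_ge_zero[of c]] by (simp add: mult_ac flip: right_diff_distrib norm_mult)
  then show ?thesis unfolding parabolic_holder_on_def by blast
qed

text \<open>The coefficient \<open>q\<close> absorbs the constant of the equation. The bound
  \<open>\<alpha> \<le> s\<close> serves the regularity of \<open>u\<close>, and
  \<open>\<alpha> \<le> 1 - s\<close> the trace of the extension of \<open>f\<close> with parameter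
  \<open>1 - s\<close>.\<close>

lemma extension_regularity:
  fixes u :: "(real ^ 'n::finite) \<times> real \<Rightarrow> complex" and q :: "(real ^ 'n) \<times> real \<Rightarrow> real"
  assumes s: "0 < s" "s < 1" and a: "0 < \<alpha>" "\<alpha> \<le> s" "\<alpha> \<le> 1 - s"
    and eq: "H_eq s u (\<lambda>p. complex_of_real (q p) * u p)"
    and qB: "\<And>p. \<bar>q p\<bar> \<le> B" and qK: "\<And>p p'. \<bar>q p - q p'\<bar> \<le> B' * parabolic_dist p p' powr \<alpha>"
  shows "y > 0 \<Longrightarrow> (\<lambda>\<eta>. extension s u x \<eta> t) differentiable (at y)"
    and "M > 0 \<Longrightarrow> parabolic_holder_upto (\<alpha> / 2) (half_ball M \<times> {- M\<^sup>2<..<M\<^sup>2}) (half_ball_upto M \<times> {- M\<^sup>2<..<M\<^sup>2})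
      (weighted_U_y (1 - 2 * s) (extension s u))"
proof -
  have "continuous_on UNIV (\<lambda>p. complex_of_real (q p))"
    by (rule parabolic_holder_continuous[OF _ a(1), of _ B']) (use qK in \<open>simp flip: of_real_diff\<close>)
  then have qc: "continuous_on UNIV q" using continuous_on_Re by fastforce
  then have qm[measurable]: "q \<in> borel_measurable borel" by (rule borel_measurable_continuous_onI)
  have B: "B \<ge> 0" using qB[of 0] by simp
  obtain w h where uw: "AE p in lebesgue. u p = w p" and wh: "spectral w h"
    and fh: "spectral (\<lambda>p. complex_of_real (q p) * w p) (\<lambda>z. heat_symbol s z * h z)"
    using Dom_H_spectral[OF s(1) eq qm qB] .
  have le: "AE p in lborel. cmod (complex_of_real (q p) * w p) \<le> B * cmod (w p)"
    using qB by (intro AE_I2) (simp add: norm_mult mult_right_mono)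
  obtain v :: "(real ^ 'n) \<times> real \<Rightarrow> complex" and L K where v[measurable]: "v \<in> borel_measurable borel" and wv: "AE p in lborel. w p = v p"
    and vL: "\<And>p. cmod (v p) \<le> L" and vK: "\<And>p p'. cmod (v p - v p') \<le> K * parabolic_dist p p' powr \<alpha>" and K: "K \<ge> 0"
    by (rule regular_representative[OF s a(1,2) wh fh B le]) (rule that)
  define f where "f = (\<lambda>p. complex_of_real (q p) * v p)"
  have fL: "cmod (f p) \<le> B * L" for p
    unfolding f_def norm_mult using qB[of p] vL[of p] B by (intro mult_mono) auto
  have L: "L \<ge> 0" using order_trans[OF norm_ge_zero vL[of 0]] .
  have fK: "cmod (f p - f p') \<le> \<bar>B * K + B' * L\<bar> * parabolic_dist p p' powr \<alpha>" for p p'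
  proof -
    have "f p - f p' = complex_of_real (q p) * (v p - v p') + complex_of_real (q p - q p') * v p'"
      by (simp add: f_def algebra_simps)
    then have "cmod (f p - f p') \<le> cmod (complex_of_real (q p) * (v p - v p')) + cmod (complex_of_real (q p - q p') * v p')"
      by (metis norm_triangle_ineq)
    also have "\<dots> = \<bar>q p\<bar> * cmod (v p - v p') + \<bar>q p - q p'\<bar> * cmod (v p')"
      by (simp only: norm_mult norm_of_real)
    also have "\<dots> \<le> B * (K * parabolic_dist p p' powr \<alpha>) + (B' * parabolic_dist p p' powr \<alpha>) * L"
      using qB qK vL vK B by (intro add_mono mult_mono) (auto intro: order_trans[OF abs_ge_zero qK])
    also have "\<dots> = (B * K + B' * L) * parabolic_dist p p' powr \<alpha>" by (simp add: algebra_simps)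
    also have "\<dots> \<le> \<bar>B * K + B' * L\<bar> * parabolic_dist p p' powr \<alpha>" by (intro mult_right_mono) auto
    finally show ?thesis .
  qed
  have vc: "continuous_on UNIV v" by (rule parabolic_holder_continuous[OF vK a(1)])
  have fc: "continuous_on UNIV f" by (rule parabolic_holder_continuous[OF fK a(1)])
  have fm[measurable]: "f \<in> borel_measurable borel" unfolding f_def by measurable
  have wf: "AE p in lborel. complex_of_real (q p) * w p = f p"
    using wv by eventually_elim (simp add: f_def)
  have uv: "AE p in lebesgue. u p = v p" using uw AE_completion[OF wv] by eventually_elim simp
  define A where "A = 4 powr s * Gamma s"
  have vd: "((\<lambda>\<eta>. extension s u x \<eta> t) has_vector_derivative
      (y powr (2 * s - 1) / A) *\<^sub>R conv (heat_kernel (conormal_density s y)) v (x, t)) (at y)" if y: "y > 0" for x y t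
  proof (rule has_vector_derivative_transform_within_open)
    show "((\<lambda>\<eta>. conv (heat_kernel (poisson_density s \<eta>)) v (x, t)) has_vector_derivative
      (y powr (2 * s - 1) / A) *\<^sub>R conv (heat_kernel (conormal_density s y)) v (x, t)) (at y)"
      unfolding A_def by (rule conv_poisson_has_vector_derivative[OF s(1) y v vL])
    \<comment> \<open>Extension and convolution agree only for positive heights; as differentiation
      is local, the open half-line suffices.\<close>
    show "open {0::real<..}" "y \<in> {0<..}" using y by auto
    show "conv (heat_kernel (poisson_density s \<eta>)) v (x, t) = extension s u x \<eta> t" if "\<eta> \<in> {0<..}" for \<eta>
      using extension_eq_conv[OF s(1) _ v uv vL, of \<eta> x t] that by simp
  qed
  show "(\<lambda>\<eta>. extension s u x \<eta> t) differentiable (at y)" if "y > 0"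
    using vd[OF that] by (rule differentiableI_vector)
  \<comment> \<open>Defined for \<open>y = 0\<close> as well; a multiple of it is the witness for
    Hoelder continuity up to the boundary.\<close>
  define W where "W = (\<lambda>((x, y), t). LINT r|lborel. heat_kernel (poisson_density (1 - s) 1) r *\<^sub>R f (x - y *\<^sub>R fst r, t - y\<^sup>2 * snd r))"
  define c where "c = complex_of_real (1 / A) * - complex_of_real (2 * Gamma (1 - s))"
  have U: "weighted_U_y (1 - 2 * s) (extension s u) ((x, y), t) = c * W ((x, y), t)" if y: "y > 0" for x y t
  proof -
    have "y powr (1 - 2 * s) * (y powr (2 * s - 1) / A) = 1 / A" using y by (simp flip: powr_add)
    then have "weighted_U_y (1 - 2 * s) (extension s u) ((x, y), t) = complex_of_real (1 / A) * conv (heat_kernel (conormal_density s y)) v (x, t)"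
      using vector_derivative_at[OF vd[OF y, of x t]] by (simp add: weighted_U_y_def scaleR_conv_of_real[symmetric] del: of_real_divide)
    also have "conv (heat_kernel (conormal_density s y)) v (x, t) = - complex_of_real (2 * Gamma (1 - s)) * conv (heat_kernel (poisson_density (1 - s) y)) f (x, t)"
      by (rule conormal_representation_pointwise[OF s y wh fh wv wf vc vL fc fL])
    also have "conv (heat_kernel (poisson_density (1 - s) y)) f (x, t) = W ((x, y), t)"
      using conv_poisson_scaled[OF _ y fm fL, of "1 - s" x t] s by (simp add: W_def)
    finally show ?thesis by (simp add: c_def mult.assoc)
  qed
  show "parabolic_holder_upto (\<alpha> / 2) (half_ball M \<times> {- M\<^sup>2<..<M\<^sup>2}) (half_ball_upto M \<times> {- M\<^sup>2<..<M\<^sup>2})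
      (weighted_U_y (1 - 2 * s) (extension s u))" if M: "M > 0"
    unfolding parabolic_holder_upto_def
  proof (intro exI[of _ "\<lambda>P. c * W P"] conjI ballI)
    show "c * W P = weighted_U_y (1 - 2 * s) (extension s u) P" if "P \<in> half_ball M \<times> {- M\<^sup>2<..<M\<^sup>2}" for P
      using U[of "snd (fst P)" "fst (fst P)" "snd P"] that by (auto simp: half_ball_def)
    show "parabolic_holder_on (\<alpha> / 2) (half_ball_upto M \<times> {- M\<^sup>2<..<M\<^sup>2}) (\<lambda>P. c * W P)"
      unfolding W_def
      by (rule parabolic_holder_on_cmult[OF parabolic_holder_poisson_trace[OF _ a(1) _ a(3) fm fL fK _ M]]) (use s a in auto)
  qed
qed

theorem lemma5p6:
  fixes s a :: real
  assumes "0 < s" and "s < 1" and "a = 1 - 2 * s"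
  shows "\<exists>\<alpha>. 0 < \<alpha> \<and> \<alpha> \<le> 1 \<and>
    (\<forall>(K::real) (V :: (real ^ 'n::finite) \<times> real \<Rightarrow> real) (u :: (real ^ 'n) \<times> real \<Rightarrow> complex).
       K > 0 \<longrightarrow>
       (1/2 \<le> s \<longrightarrow> C_k 1 V \<and> C_k_norm 1 V \<le> ennreal K) \<longrightarrow>
       (s < 1/2 \<longrightarrow> C_k 2 V \<and> C_k_norm 2 V \<le> ennreal K \<and> L_inf_norm (radial_grad V) \<le> ennreal K) \<longrightarrow>
       u \<in> Dom_H s \<longrightarrow>
       H_eq s u (\<lambda>p. complex_of_real (Gamma (1 - s) / (2 powr (2 * s - 1) * Gamma s) * V p) * u p) \<longrightarrow>
       (\<forall>x y t. 0 < y \<longrightarrow> (\<lambda>\<eta>. extension s u x \<eta> t) differentiable (at y)) \<and>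
       (\<forall>M>0. parabolic_holder_upto \<alpha>
                 (half_ball M \<times> {- M\<^sup>2 <..< M\<^sup>2}) (half_ball_upto M \<times> {- M\<^sup>2 <..< M\<^sup>2})
                 (weighted_U_y a (extension s u))))"
proof -
  \<comment> \<open>Depends on \<open>s\<close> alone, hence on \<open>a\<close>, and is fixed
    before \<open>K\<close>, \<open>V\<close>, \<open>u\<close> and \<open>M\<close>; the trace
    estimate later halves it.\<close>
  define \<alpha> where "\<alpha> = min s (1 - s)"
  have \<alpha>: "0 < \<alpha>" "\<alpha> \<le> s" "\<alpha> \<le> 1 - s" "\<alpha> \<le> 1" using assms by (auto simp: \<alpha>_def)
  define c where "c = Gamma (1 - s) / (2 powr (2 * s - 1) * Gamma s)"
  show ?thesis
  proof (intro exI[of _ "\<alpha> / 2"] conjI allI impI)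
    show "0 < \<alpha> / 2" "\<alpha> / 2 \<le> 1" using \<alpha> by auto
    fix K :: real and V :: "(real ^ 'n) \<times> real \<Rightarrow> real" and u :: "(real ^ 'n) \<times> real \<Rightarrow> complex"
    assume K: "K > 0" and V1: "1/2 \<le> s \<longrightarrow> C_k 1 V \<and> C_k_norm 1 V \<le> ennreal K"
      and V2: "s < 1/2 \<longrightarrow> C_k 2 V \<and> C_k_norm 2 V \<le> ennreal K \<and> L_inf_norm (radial_grad V) \<le> ennreal K"
      and eq: "H_eq s u (\<lambda>p. complex_of_real (Gamma (1 - s) / (2 powr (2 * s - 1) * Gamma s) * V p) * u p)"
    \<comment> \<open>Unifies the two smoothness assumptions; in both, \<open>k \<ge> 1\<close>
      provides bounded first derivatives.\<close>
    define k :: nat where "k = (if s < 1/2 then 2 else 1)"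
    have k: "k \<ge> 1" "C_k k V" "C_k_norm k V \<le> ennreal K" using V1 V2 by (auto simp: k_def)
    have VB: "\<bar>c * V p\<bar> \<le> \<bar>c\<bar> * K" for p
      unfolding abs_mult using C_k_norm_bound[OF k(3)] K by (intro mult_left_mono) auto
    have VH: "\<bar>c * V p - c * V p'\<bar> \<le> \<bar>c\<bar> * (K * (real CARD('n) + 2)) * parabolic_dist p p' powr \<alpha>" for p p'
      unfolding right_diff_distrib[symmetric] abs_mult mult.assoc[of "\<bar>c\<bar>"]
      using potential_holder[OF k(2,3,1) _ \<alpha>(1,4), of p p'] K by (intro mult_left_mono) auto
    note reg = extension_regularity[OF assms(1,2) \<alpha>(1-3) eq[folded c_def] VB VH]
    show "(\<lambda>\<eta>. extension s u x \<eta> t) differentiable (at y)" if "0 < y" for x y t using that by (rule reg(1))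
    show "parabolic_holder_upto (\<alpha> / 2) (half_ball M \<times> {- M\<^sup>2 <..< M\<^sup>2}) (half_ball_upto M \<times> {- M\<^sup>2 <..< M\<^sup>2}) (weighted_U_y a (extension s u))"
      if "M > 0" for M unfolding assms(3) using that by (rule reg(2))
  qed
qed

end
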